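(* Let $X_t$ be a stationary (time-homogeneous) Markov diffusion process under the measure $P$ on the domain $D_x\subseteq\mathbb{R}$, with Markov generator $$\mathcal{L}_X f(x)=b(x)\frac{df(x)}{dx}+\frac12\sigma^2(x)\frac{d^2f(x)}{dx^2}.$$ Assume $\rho\ge 0$. Then $\{\rho,h,Y\}$ is a stochastic transformation of $(X_t,P)$ if and only if $$h(x)=c_1\varphi^+_\rho(x)+c_2\varphi^-_\rho(x),\qquad Y(x)=\frac{1}{h(x)}\bigl(c_3\varphi^+_\rho(x)+c_4\varphi^-_\rho(x)\bigr),$$ where $c_1,c_2,c_3,c_4\in\mathbb{R}$ are parameters with $c_1,c_2\ge 0$ and $c_1c_4-c_2c_3\neq 0$, and $\varphi^+_\rho(x)$ and $\varphi^-_\rho(x)$ are increasing and decreasing solutions, respectively, of the differential equation $\mathcal{L}_X\varphi(x)=\rho\,\varphi(x)$.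
   Context: $D_x=[D^1,D^2]$ is a possibly infinite interval; $X_t$ is a regular diffusion, $b$ and $\sigma$ are smooth and $\sigma>0$ in the interior of $D_x$, and there is no killing in the interior of $D_x$. The functions $\varphi^+_\rho,\varphi^-_\rho$ are the (positive, linearly independent) increasing and decreasing fundamental solutions; for $\rho>0$ they are characterized up to positive multiples by $E_x(e^{-\rho H_z})=\varphi^+_\rho(x)/\varphi^+_\rho(z)$ for $x\le z$ and $E_x(e^{-\rho H_z})=\varphi^-_\rho(x)/\varphi^-_\rho(z)$ for $x\ge z$, where $H_z$ is the first hitting time of $z$. Stochastic transformation: a triple $\{\rho,h,Y\}$ where $\rho$ and the positive function $h$ define an absolutely continuous measure change $dP^h_t=e^{-\rho t}h(X_t)\,dP_t$, i.e. $P^h(A\mid X_0=x)=E\bigl(e^{-\rho t}\frac{h(X_t)}{h(x)}\mathbb{I}_A\mid X_0=x\bigr)$ for $A\in\mathcal{F}_t$ (this requires $e^{-\rho t}E(h(X_t)\mid X_0=x)\le h(x)$; mass may be lost to a cemetery point, so the transformed process need not be conservative), and $Y:D_x\to D_y\subseteq\mathbb{R}$ is a diffeomorphism such that $(Y(X_t),P^h)$ is a driftless process. It is required that the transformed process $(X_t,P^h)$ has no killing in the interior of $D_x$. A process is driftless if its generator has zero first-order coefficient; equivalently, the process stopped at the boundary of its domain is a local martingale.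
   Formalization: For ρ=0 the solutions φ± are also required to satisfy the hitting-time identities, h is required to be continuous on D_x (including boundary points that belong to it), and Y is a diffeomorphism with its formula only in the interior of D_x; otherwise the claim fails or is undefined. *)

theory Defs
  imports "HOL-Probability.Probability"
begin

section \<open>Smooth functions, test functions and second-order operators\<close>

text \<open>All three regularity notions are used on open sets only, where
  \<^term>\<open>deriv f x\<close> depends just on the values of \<^term>\<open>f\<close> near \<^term>\<open>x\<close>.\<close>

definition smooth_on :: "real set \<Rightarrow> (real \<Rightarrow> real) \<Rightarrow> bool" where
  "smooth_on I f \<longleftrightarrow> (\<forall>n. \<forall>x\<in>I. (deriv ^^ n) f differentiable (at x))"

definition C2_on :: "real set \<Rightarrow> (real \<Rightarrow> real) \<Rightarrow> bool" where
  "C2_on I f \<longleftrightarrow>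
     (\<forall>x\<in>I. f differentiable (at x)) \<and>
     (\<forall>x\<in>I. deriv f differentiable (at x)) \<and>
     continuous_on I (deriv (deriv f))"

definition diffeomorphism_on :: "real set \<Rightarrow> (real \<Rightarrow> real) \<Rightarrow> bool" where
  "diffeomorphism_on I Y \<longleftrightarrow>
     inj_on Y I \<and> smooth_on I Y \<and> smooth_on (Y ` I) (inv_into I Y)"

definition test_function :: "real set \<Rightarrow> (real \<Rightarrow> real) \<Rightarrow> bool" where
  "test_function I f \<longleftrightarrow>
     C2_on UNIV f \<and> compact (closure {x. f x \<noteq> 0}) \<and> closure {x. f x \<noteq> 0} \<subseteq> I"

definition diff_op ::
  "(real \<Rightarrow> real) \<Rightarrow> (real \<Rightarrow> real) \<Rightarrow> (real \<Rightarrow> real) \<Rightarrow> real \<Rightarrow> real" where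
  "diff_op a s f x = a x * deriv f x + (s x)\<^sup>2 / 2 * deriv (deriv f) x"

section \<open>Transition operators and generators\<close>

text \<open>
  A process with lifetime is given by \<open>X\<close> and \<open>\<zeta>\<close>: it is at \<open>X t \<omega>\<close> for \<open>0 \<le> t < \<zeta> \<omega>\<close> and in the
  cemetery afterwards, where all functions vanish; the values \<open>X t \<omega>\<close> for \<open>t \<ge> \<zeta> \<omega>\<close> are
  irrelevant. \<open>Q t x\<close> is the (sub-probability) law of the process started in \<open>x\<close>, on events up
  to time \<open>t\<close>.
\<close>

definition transition ::
  "(real \<Rightarrow> 'w \<Rightarrow> real) \<Rightarrow> ('w \<Rightarrow> ereal) \<Rightarrow> (real \<Rightarrow> real \<Rightarrow> 'w measure) \<Rightarrow>
   real \<Rightarrow> (real \<Rightarrow> real) \<Rightarrow> real \<Rightarrow> real" where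
  "transition X \<zeta> Q t f x = (\<integral>\<omega>. (if ereal t < \<zeta> \<omega> then f (X t \<omega>) else 0) \<partial>Q t x)"

text \<open>Transition operators, on \<^term>\<open>Y ` I\<close>, of the image process \<open>Y(X\<^sub>t)\<close>. A function with compact
  support in \<^term>\<open>Y ` I\<close> is pulled back to \<open>I\<close> and extended by zero, so that no value of \<open>Y\<close>
  outside \<open>I\<close> plays a role.\<close>

definition image_transition ::
  "real set \<Rightarrow> (real \<Rightarrow> real) \<Rightarrow> (real \<Rightarrow> (real \<Rightarrow> real) \<Rightarrow> real \<Rightarrow> real) \<Rightarrow>
   real \<Rightarrow> (real \<Rightarrow> real) \<Rightarrow> real \<Rightarrow> real" where
  "image_transition I Y T t g y =
     T t (\<lambda>x. if x \<in> I then g (Y x) else 0) (inv_into I Y y)"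

text \<open>On the open set \<open>I\<close> the generator of the operators \<open>T\<close> is
  \<open>f \<mapsto> a f' + s\<^sup>2 f'' / 2 - k f\<close>; the zero-order coefficient \<open>k\<close> is the killing rate. The
  condition is on test functions supported inside \<open>I\<close>, so it leaves the boundary behaviour
  free.\<close>

definition has_generator_on ::
  "real set \<Rightarrow> (real \<Rightarrow> (real \<Rightarrow> real) \<Rightarrow> real \<Rightarrow> real) \<Rightarrow>
   (real \<Rightarrow> real) \<Rightarrow> (real \<Rightarrow> real) \<Rightarrow> (real \<Rightarrow> real) \<Rightarrow> bool" where
  "has_generator_on I T a s k \<longleftrightarrow>
     (\<forall>f. test_function I f \<longrightarrow>
       (\<forall>x\<in>I. ((\<lambda>t. (T t f x - f x) / t) \<longlongrightarrow> diff_op a s f x - k x * f x) (at_right 0)))"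

definition no_killing_on ::
  "real set \<Rightarrow> (real \<Rightarrow> (real \<Rightarrow> real) \<Rightarrow> real \<Rightarrow> real) \<Rightarrow> bool" where
  "no_killing_on I T \<longleftrightarrow> (\<exists>a s. has_generator_on I T a s (\<lambda>_. 0))"

definition driftless_on ::
  "real set \<Rightarrow> (real \<Rightarrow> (real \<Rightarrow> real) \<Rightarrow> real \<Rightarrow> real) \<Rightarrow> bool" where
  "driftless_on I T \<longleftrightarrow> (\<exists>s k. has_generator_on I T (\<lambda>_. 0) s k)"

section \<open>Regular one-dimensional diffusions\<close>

definition hitting_time ::
  "(real \<Rightarrow> 'w \<Rightarrow> real) \<Rightarrow> ('w \<Rightarrow> ereal) \<Rightarrow> real \<Rightarrow> 'w \<Rightarrow> ereal" where
  "hitting_time X \<zeta> z \<omega> = Inf (ereal ` {t. 0 \<le> t \<and> ereal t < \<zeta> \<omega> \<and> X t \<omega> = z})"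

text \<open>The function \<open>\<rho> z x \<mapsto> E\<^sub>x(exp (-\<rho> H\<^sub>z))\<close>, with the integrand zero where \<open>H\<^sub>z = \<infinity>\<close>; in
  particular it is the hitting probability \<open>P\<^sub>x(H\<^sub>z < \<infinity>)\<close> if \<open>\<rho> = 0\<close>.\<close>

definition hitting_laplace ::
  "(real \<Rightarrow> 'w \<Rightarrow> real) \<Rightarrow> ('w \<Rightarrow> ereal) \<Rightarrow> (real \<Rightarrow> 'w measure) \<Rightarrow>
   real \<Rightarrow> real \<Rightarrow> real \<Rightarrow> real" where
  "hitting_laplace X \<zeta> P \<rho> z x =
     (\<integral>\<omega>. (if hitting_time X \<zeta> z \<omega> = \<infinity> then 0
           else exp (- \<rho> * real_of_ereal (hitting_time X \<zeta> z \<omega>))) \<partial>P x)"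

text \<open>
  \<open>D\<close> is the state space; boundary points of the interval may or may not belong to it, and the
  behaviour at the boundary (reflection, absorption, killing, ...) is unrestricted. The map
  \<open>\<theta> t\<close> is the time shift on the sample space. Only finite stopping times occur in
  \<open>strong_markov\<close>; general ones reduce to them by truncation. Time homogeneity is part of
  \<open>strong_markov\<close>, since the same family \<open>P\<close> is used after the time \<open>T\<close>.
\<close>

locale regular_diffusion = filtration "space M" F
  for M :: "'w measure" and F :: "real \<Rightarrow> 'w measure" +
  fixes D :: "real set" and b \<sigma> :: "real \<Rightarrow> real"
    and X :: "real \<Rightarrow> 'w \<Rightarrow> real" and \<zeta> :: "'w \<Rightarrow> ereal"
    and \<theta> :: "real \<Rightarrow> 'w \<Rightarrow> 'w" and P :: "real \<Rightarrow> 'w measure"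
  assumes state_space: "is_interval D" "interior D \<noteq> {}"
    and coefficients: "smooth_on (interior D) b" "smooth_on (interior D) \<sigma>"
      "\<And>x. x \<in> interior D \<Longrightarrow> 0 < \<sigma> x"
    and subalgebras: "\<And>t. subalgebra M (F t)"
    and laws: "P \<in> restrict_space borel D \<rightarrow>\<^sub>M prob_algebra M"
    and adapted: "\<And>t. 0 \<le> t \<Longrightarrow> X t \<in> borel_measurable (F t)"
      "\<And>t. 0 \<le> t \<Longrightarrow> Measurable.pred (F t) (\<lambda>\<omega>. ereal t < \<zeta> \<omega>)"
    and in_state_space:
      "\<And>t \<omega>. \<omega> \<in> space M \<Longrightarrow> 0 \<le> t \<Longrightarrow> ereal t < \<zeta> \<omega> \<Longrightarrow> X t \<omega> \<in> D"
    and continuous_paths: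
      "\<And>\<omega>. \<omega> \<in> space M \<Longrightarrow> continuous_on {t. 0 \<le> t \<and> ereal t < \<zeta> \<omega>} (\<lambda>t. X t \<omega>)"
    and start: "\<And>x. x \<in> D \<Longrightarrow> AE \<omega> in P x. 0 < \<zeta> \<omega> \<and> X 0 \<omega> = x"
    and shift_measurable: "\<And>t. 0 \<le> t \<Longrightarrow> \<theta> t \<in> M \<rightarrow>\<^sub>M M"
    and shift:
      "\<And>t \<omega>. \<omega> \<in> space M \<Longrightarrow> 0 \<le> t \<Longrightarrow> ereal t < \<zeta> \<omega> \<Longrightarrow>
         \<zeta> (\<theta> t \<omega>) = \<zeta> \<omega> - ereal t \<and>
         (\<forall>s\<ge>0. ereal (t + s) < \<zeta> \<omega> \<longrightarrow> X s (\<theta> t \<omega>) = X (t + s) \<omega>)"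
    and strong_markov:
      "\<And>x T A (G :: 'w \<Rightarrow> ennreal).
         x \<in> D \<Longrightarrow> stopping_time F T \<Longrightarrow> (\<And>\<omega>. \<omega> \<in> space M \<Longrightarrow> 0 \<le> T \<omega>) \<Longrightarrow>
         A \<in> sets (pre_sigma T) \<Longrightarrow> G \<in> borel_measurable M \<Longrightarrow>
         (\<integral>\<^sup>+\<omega>. (if \<omega> \<in> A \<and> ereal (T \<omega>) < \<zeta> \<omega> then G (\<theta> (T \<omega>) \<omega>) else 0) \<partial>P x) =
         (\<integral>\<^sup>+\<omega>. (if \<omega> \<in> A \<and> ereal (T \<omega>) < \<zeta> \<omega>
               then (\<integral>\<^sup>+\<omega>'. G \<omega>' \<partial>P (X (T \<omega>) \<omega>)) else 0) \<partial>P x)"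
    and regular:
      "\<And>x y. x \<in> interior D \<Longrightarrow> y \<in> D \<Longrightarrow>
         0 < measure (P x) {\<omega> \<in> space M. hitting_time X \<zeta> y \<omega> < \<infinity>}"
    and generator:
      "has_generator_on (interior D) (transition X \<zeta> (\<lambda>t x. P x)) b \<sigma> (\<lambda>_. 0)"

text \<open>
  The increasing and the decreasing solution of \<open>\<L> \<phi> = \<rho> \<phi>\<close>. The quotients \<open>\<phi>(x) / \<phi>(z)\<close> of the
  hitting-time identities are multiplied out because \<open>\<phi>\<close> vanishes at an absorbing boundary point
  of \<open>D\<close> on the appropriate side. For \<open>\<rho> = 0\<close> the same identities single out the pair; there,
  monotonicity need not be strict, and a linearly independent pair exists precisely in the
  transient case.
\<close>

definition fundamental_pair ::
  "real set \<Rightarrow> (real \<Rightarrow> real) \<Rightarrow> (real \<Rightarrow> real) \<Rightarrow> (real \<Rightarrow> 'w \<Rightarrow> real) \<Rightarrow> ('w \<Rightarrow> ereal) \<Rightarrow>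
   (real \<Rightarrow> 'w measure) \<Rightarrow> real \<Rightarrow> (real \<Rightarrow> real) \<Rightarrow> (real \<Rightarrow> real) \<Rightarrow> bool" where
  "fundamental_pair D b \<sigma> X \<zeta> P \<rho> \<phi>p \<phi>m \<longleftrightarrow>
     (\<forall>\<phi>\<in>{\<phi>p, \<phi>m}. continuous_on D \<phi> \<and> C2_on (interior D) \<phi> \<and>
        (\<forall>x\<in>interior D. 0 < \<phi> x \<and> diff_op b \<sigma> \<phi> x = \<rho> * \<phi> x)) \<and>
     mono_on D \<phi>p \<and> antimono_on D \<phi>m \<and>
     (\<forall>\<alpha> \<beta>. (\<forall>x\<in>interior D. \<alpha> * \<phi>p x + \<beta> * \<phi>m x = 0) \<longrightarrow> \<alpha> = 0 \<and> \<beta> = 0) \<and>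
     (\<forall>x\<in>D. \<forall>z\<in>D. x \<le> z \<longrightarrow> \<phi>p x = hitting_laplace X \<zeta> P \<rho> z x * \<phi>p z) \<and>
     (\<forall>x\<in>D. \<forall>z\<in>D. z \<le> x \<longrightarrow> \<phi>m x = hitting_laplace X \<zeta> P \<rho> z x * \<phi>m z)"

section \<open>Stochastic transformations\<close>

definition transformed_law ::
  "(real \<Rightarrow> 'w measure) \<Rightarrow> (real \<Rightarrow> 'w \<Rightarrow> real) \<Rightarrow> ('w \<Rightarrow> ereal) \<Rightarrow> (real \<Rightarrow> 'w measure) \<Rightarrow>
   real \<Rightarrow> (real \<Rightarrow> real) \<Rightarrow> real \<Rightarrow> real \<Rightarrow> 'w measure" where
  "transformed_law F X \<zeta> P \<rho> h t x =
     density (restr_to_subalg (P x) (F t))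
       (\<lambda>\<omega>. if ereal t < \<zeta> \<omega> then ennreal (exp (- \<rho> * t) * (h (X t \<omega>) / h x)) else 0)"

text \<open>
  Positivity of \<open>h\<close> is required in the interior of \<open>D\<close>: a transformation may vanish at an absorbing
  boundary point, as \<open>h(x) = x\<close> does for Brownian motion on \<open>[0,\<infinity>)\<close> absorbed at \<open>0\<close>. The value of
  \<open>h\<close> at a boundary point of \<open>D\<close> is the continuous extension from the interior; otherwise the
  value at an absorbing point would only be constrained by an inequality. \<open>Y\<close> is
  a diffeomorphism of the interior onto its image.
\<close>

definition stochastic_transformation ::
  "real set \<Rightarrow> (real \<Rightarrow> 'w measure) \<Rightarrow> (real \<Rightarrow> 'w \<Rightarrow> real) \<Rightarrow> ('w \<Rightarrow> ereal) \<Rightarrow>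
   (real \<Rightarrow> 'w measure) \<Rightarrow> real \<Rightarrow> (real \<Rightarrow> real) \<Rightarrow> (real \<Rightarrow> real) \<Rightarrow> bool" where
  "stochastic_transformation D F X \<zeta> P \<rho> h Y \<longleftrightarrow>
     continuous_on D h \<and> (\<forall>x\<in>interior D. 0 < h x) \<and>
     (\<forall>x\<in>D. \<forall>t\<ge>0.
        (\<integral>\<^sup>+\<omega>. (if ereal t < \<zeta> \<omega> then ennreal (exp (- \<rho> * t) * h (X t \<omega>)) else 0) \<partial>P x)
          \<le> ennreal (h x)) \<and>
     diffeomorphism_on (interior D) Y \<and>
     (let T = transition X \<zeta> (transformed_law F X \<zeta> P \<rho> h)
      in no_killing_on (interior D) T \<and>
         driftless_on (Y ` interior D) (image_transition (interior D) Y T))"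

end

theory Submission
  imports Defs
begin

text \<open>
  Write \<open>T\<close> for the transition operators of the transformed process; on test functions they are
  \<open>f \<mapsto> exp (-\<rho> t) E\<^sub>x(h(X\<^sub>t) f(X\<^sub>t)) / h(x)\<close>. If \<open>h\<close> solves \<open>\<L> h = \<rho> h\<close>, their generator is
  \<open>f \<mapsto> (\<L>(h f) - \<rho> h f) / h\<close>, which has no zero-order term, and \<open>Y\<close> has zero drift under it exactly
  when \<open>h Y\<close> is a solution too.

  Conversely, \<open>h\<close> is only known to be continuous. Absence of killing, tested with functions that are
  locally \<open>1\<close>, says that \<open>h\<close> is an eigenfunction of the pointwise generator. The generator satisfies
  a maximum principle, so comparison with the classical solution having the same values at the two
  ends of a compact interval shows that \<open>h\<close> coincides with that solution.

  The signs of the coefficients correspond to the supermartingale property. Optional stopping at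
  \<open>H\<^sub>z\<close> turns it into \<open>E\<^sub>x(exp (-\<rho> H\<^sub>z)) h(z) \<le> h(x)\<close>, that is, \<open>h / \<phi>\<^sup>+\<close> is decreasing and
  \<open>h / \<phi>\<^sup>-\<close> is increasing, which forces nonnegative coefficients. In the other direction, \<open>\<phi>\<^sup>+\<close> is
  the increasing limit of the functions \<open>x \<mapsto> E\<^sub>x(exp (-\<rho> H\<^sub>z)) \<phi>\<^sup>+(z)\<close>, which have the
  supermartingale property by the Markov property; similarly for \<open>\<phi>\<^sup>-\<close>.
\<close>

subsection \<open>Twice continuously differentiable functions\<close>

text \<open>Every hypothesis on a generator is a limit as t tends to 0, pointwise in x and only for
  C^2 functions with compact support in the interval. No Dynkin formula is at hand, and h times a
  cutoff is not a test function while h is only continuous. Two devices compensate. A test function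
  equal to 1 near a point is annihilated there by every operator without zero-order term, so absence
  of killing can be exploited although the transformed coefficients are unknown. And a cutoff shows
  that leaving a neighbourhood costs only o(t), so a limit at a local maximum is not disturbed by
  distant values.

  The linear algebra of solutions rests on the Wronskian, which vanishes everywhere or nowhere. It
  replaces existence and uniqueness theory for the equation, and the derivative of Y is c1 c4 - c2
  c3 times the Wronskian divided by h^2; this is the origin of the determinant condition.

  The supermartingale inequality is stated at deterministic times, so optional stopping uses time
  grids of shrinking mesh. Since h may be unbounded, the passage to the limit is by Fatou's
  lemma.\<close>

lemma C2_onI:
  assumes "open I"
    and f': "\<And>x. x \<in> I \<Longrightarrow> (f has_real_derivative f' x) (at x)"
    and f'': "\<And>x. x \<in> I \<Longrightarrow> (f' has_real_derivative f'' x) (at x)"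
    and cont: "continuous_on I f''"
  shows "C2_on I f"
    and "\<And>x. x \<in> I \<Longrightarrow> deriv f x = f' x"
    and "\<And>x. x \<in> I \<Longrightarrow> deriv (deriv f) x = f'' x"
proof -
  show 1: "deriv f x = f' x" if "x \<in> I" for x
    using f'[OF that] by (rule DERIV_imp_deriv)
  have 2: "(deriv f has_real_derivative f'' x) (at x)" if "x \<in> I" for x
    by (rule has_field_derivative_transform_within_open[OF f''[OF that] \<open>open I\<close> that]) (simp add: 1)
  show 3: "deriv (deriv f) x = f'' x" if "x \<in> I" for x
    using 2[OF that] by (rule DERIV_imp_deriv)
  show "C2_on I f"
    unfolding C2_on_def
    using f' 2 cont 3
    by (auto simp: real_differentiable_def cong: continuous_on_cong)
qed

lemma C2_onD:
  assumes "C2_on I f" "x \<in> I"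
  shows "(f has_real_derivative deriv f x) (at x)"
    and "(deriv f has_real_derivative deriv (deriv f) x) (at x)"
  using assms by (auto simp: C2_on_def DERIV_deriv_iff_real_differentiable)

lemma C2_on_continuous:
  assumes "C2_on I f"
  shows "continuous_on I f" "continuous_on I (deriv f)" "continuous_on I (deriv (deriv f))"
proof -
  show "continuous_on I f" "continuous_on I (deriv f)"
    using C2_onD[OF assms] by (auto intro!: continuous_at_imp_continuous_on DERIV_isCont)
  show "continuous_on I (deriv (deriv f))" using assms by (simp add: C2_on_def)
qed

lemma C2_on_cong:
  assumes "open I" "C2_on I f" "\<And>x. x \<in> I \<Longrightarrow> g x = f x"
  shows "C2_on I g"
    and "\<And>x. x \<in> I \<Longrightarrow> deriv g x = deriv f x"
    and "\<And>x. x \<in> I \<Longrightarrow> deriv (deriv g) x = deriv (deriv f) x"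
proof -
  have *: "(g has_real_derivative deriv f x) (at x)" if "x \<in> I" for x
    by (rule has_field_derivative_transform_within_open[OF C2_onD(1)[OF assms(2) that] \<open>open I\<close> that])
      (simp add: assms(3))
  note I = C2_onI[OF \<open>open I\<close> * C2_onD(2)[OF assms(2)] C2_on_continuous(3)[OF assms(2)]]
  show "C2_on I g" by (rule I)
  show "\<And>x. x \<in> I \<Longrightarrow> deriv g x = deriv f x" by (rule I)
  show "\<And>x. x \<in> I \<Longrightarrow> deriv (deriv g) x = deriv (deriv f) x" by (rule I)
qed

lemma C2_on_subset: "C2_on I f \<Longrightarrow> J \<subseteq> I \<Longrightarrow> C2_on J f"
  unfolding C2_on_def by (auto elim: continuous_on_subset)

lemma C2_on_Un:
  assumes "open I" "open J" "C2_on I f" "C2_on J f"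
  shows "C2_on (I \<union> J) f"
  using assms unfolding C2_on_def by (auto intro: continuous_on_open_Un)

lemma C2_on_const: "open I \<Longrightarrow> C2_on I (\<lambda>_. c)"
  by (rule C2_onI(1)[where f' = "\<lambda>_. 0" and f'' = "\<lambda>_. 0"]) (auto intro!: derivative_eq_intros)

lemma C2_on_affine: "open I \<Longrightarrow> C2_on I (\<lambda>x. p * x + q)"
  by (rule C2_onI(1)[where f' = "\<lambda>_. p" and f'' = "\<lambda>_. 0"]) (auto intro!: derivative_eq_intros)

lemma C2_on_add:
  assumes "open I" "C2_on I f" "C2_on I g"
  shows "C2_on I (\<lambda>x. f x + g x)"
    and "\<And>x. x \<in> I \<Longrightarrow> deriv (\<lambda>x. f x + g x) x = deriv f x + deriv g x"
    and "\<And>x. x \<in> I \<Longrightarrow> deriv (deriv (\<lambda>x. f x + g x)) x = deriv (deriv f) x + deriv (deriv g) x"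
proof -
  note I = C2_onI[OF \<open>open I\<close>, where f = "\<lambda>x. f x + g x" and f' = "\<lambda>x. deriv f x + deriv g x"
      and f'' = "\<lambda>x. deriv (deriv f) x + deriv (deriv g) x"]
  note D = DERIV_add[OF C2_onD(1)[OF assms(2)] C2_onD(1)[OF assms(3)]]
    DERIV_add[OF C2_onD(2)[OF assms(2)] C2_onD(2)[OF assms(3)]]
    continuous_on_add[OF C2_on_continuous(3)[OF assms(2)] C2_on_continuous(3)[OF assms(3)]]
  show "C2_on I (\<lambda>x. f x + g x)"
    and "\<And>x. x \<in> I \<Longrightarrow> deriv (\<lambda>x. f x + g x) x = deriv f x + deriv g x"
    and "\<And>x. x \<in> I \<Longrightarrow> deriv (deriv (\<lambda>x. f x + g x)) x = deriv (deriv f) x + deriv (deriv g) x"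
    by (rule I; simp add: D)+
qed

lemma C2_on_mult:
  assumes "open I" "C2_on I f" "C2_on I g"
  shows "C2_on I (\<lambda>x. f x * g x)"
    and "\<And>x. x \<in> I \<Longrightarrow> deriv (\<lambda>x. f x * g x) x = deriv f x * g x + f x * deriv g x"
    and "\<And>x. x \<in> I \<Longrightarrow> deriv (deriv (\<lambda>x. f x * g x)) x =
          deriv (deriv f) x * g x + 2 * deriv f x * deriv g x + f x * deriv (deriv g) x"
proof -
  have 1: "((\<lambda>x. f x * g x) has_real_derivative deriv f x * g x + f x * deriv g x) (at x)"
    if "x \<in> I" for x
    using C2_onD[OF assms(2) that] C2_onD[OF assms(3) that]
    by (auto intro!: derivative_eq_intros)
  have 2: "((\<lambda>x. deriv f x * g x + f x * deriv g x) has_real_derivative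
      deriv (deriv f) x * g x + 2 * deriv f x * deriv g x + f x * deriv (deriv g) x) (at x)"
    if "x \<in> I" for x
    using C2_onD[OF assms(2) that] C2_onD[OF assms(3) that]
    by (auto intro!: derivative_eq_intros)
  have 3: "continuous_on I (\<lambda>x. deriv (deriv f) x * g x + 2 * deriv f x * deriv g x + f x * deriv (deriv g) x)"
    by (intro continuous_intros C2_on_continuous assms)
  note I = C2_onI[OF \<open>open I\<close> 1 2 3]
  show "C2_on I (\<lambda>x. f x * g x)"
    and "\<And>x. x \<in> I \<Longrightarrow> deriv (\<lambda>x. f x * g x) x = deriv f x * g x + f x * deriv g x"
    and "\<And>x. x \<in> I \<Longrightarrow> deriv (deriv (\<lambda>x. f x * g x)) x =
          deriv (deriv f) x * g x + 2 * deriv f x * deriv g x + f x * deriv (deriv g) x"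
    by (rule I; simp)+
qed

lemma C2_on_inverse:
  assumes "open I" "C2_on I f" "\<And>x. x \<in> I \<Longrightarrow> f x \<noteq> 0"
  shows "C2_on I (\<lambda>x. inverse (f x))"
proof -
  have 1: "((\<lambda>x. inverse (f x)) has_real_derivative - (deriv f x * inverse ((f x)^2))) (at x)"
    if "x \<in> I" for x
    using C2_onD[OF assms(2) that] assms(3)[OF that]
    by (auto intro!: derivative_eq_intros simp: power2_eq_square)
  have 2: "((\<lambda>x. - (deriv f x * inverse ((f x)^2))) has_real_derivative
      2 * (deriv f x)\<^sup>2 * inverse ((f x)^3) - deriv (deriv f) x * inverse ((f x)^2)) (at x)"
    if "x \<in> I" for x
    using C2_onD[OF assms(2) that] assms(3)[OF that]
    by (auto intro!: derivative_eq_intros simp: divide_simps) (simp add: algebra_simps eval_nat_numeral)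
  have 3: "continuous_on I (\<lambda>x. 2 * (deriv f x)\<^sup>2 * inverse ((f x)^3) - deriv (deriv f) x * inverse ((f x)^2))"
    by (intro continuous_intros C2_on_continuous assms) (use assms(3) in auto)
  show ?thesis by (rule C2_onI(1)[OF \<open>open I\<close> 1 2 3])
qed

lemma C2_on_compose:
  assumes "open I" "open J" "C2_on I g" "C2_on J f" "\<And>x. x \<in> I \<Longrightarrow> g x \<in> J"
  shows "C2_on I (\<lambda>x. f (g x))"
    and "\<And>x. x \<in> I \<Longrightarrow> deriv (\<lambda>x. f (g x)) x = deriv f (g x) * deriv g x"
    and "\<And>x. x \<in> I \<Longrightarrow> deriv (deriv (\<lambda>x. f (g x))) x =
          deriv (deriv f) (g x) * (deriv g x)\<^sup>2 + deriv f (g x) * deriv (deriv g) x"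
proof -
  have 1: "((\<lambda>x. f (g x)) has_real_derivative deriv f (g x) * deriv g x) (at x)" if "x \<in> I" for x
    using C2_onD[OF assms(3) that] C2_onD[OF assms(4) assms(5)[OF that]] by (blast intro: DERIV_chain2)
  have 2: "((\<lambda>x. deriv f (g x) * deriv g x) has_real_derivative
      deriv (deriv f) (g x) * (deriv g x)\<^sup>2 + deriv f (g x) * deriv (deriv g) x) (at x)"
    if "x \<in> I" for x
  proof -
    have "((\<lambda>x. deriv f (g x)) has_real_derivative deriv (deriv f) (g x) * deriv g x) (at x)"
      using C2_onD[OF assms(3) that] C2_onD[OF assms(4) assms(5)[OF that]] by (blast intro: DERIV_chain2)
    from DERIV_mult[OF this C2_onD(2)[OF assms(3) that]] show ?thesis
      by (simp add: power2_eq_square algebra_simps)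
  qed
  have 3: "continuous_on I (\<lambda>x. deriv (deriv f) (g x) * (deriv g x)\<^sup>2 + deriv f (g x) * deriv (deriv g) x)"
    using assms(5)
    by (intro continuous_intros C2_on_continuous[OF assms(3)]
        continuous_on_compose2[OF C2_on_continuous(2)[OF assms(4)]]
        continuous_on_compose2[OF C2_on_continuous(3)[OF assms(4)]]) auto
  note I = C2_onI[OF \<open>open I\<close> 1 2 3]
  show "C2_on I (\<lambda>x. f (g x))"
    and "\<And>x. x \<in> I \<Longrightarrow> deriv (\<lambda>x. f (g x)) x = deriv f (g x) * deriv g x"
    and "\<And>x. x \<in> I \<Longrightarrow> deriv (deriv (\<lambda>x. f (g x))) x =
          deriv (deriv f) (g x) * (deriv g x)\<^sup>2 + deriv f (g x) * deriv (deriv g) x"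
    by (rule I; simp)+
qed

lemma diff_op_cong:
  assumes "open J" "x \<in> J" "C2_on J f" "\<And>y. y \<in> J \<Longrightarrow> g y = f y"
  shows "diff_op a s g x = diff_op a s f x"
  unfolding diff_op_def using C2_on_cong(2,3)[OF assms(1,3,4)] assms(2) by simp

text \<open>The cross term is where the change of measure produces its new drift: with one factor
  equal to h it becomes \<sigma>^2 h' times the derivative of the other factor.\<close>

lemma diff_op_mult:
  assumes "open I" "C2_on I f" "C2_on I g" "x \<in> I"
  shows "diff_op a s (\<lambda>x. f x * g x) x =
     f x * diff_op a s g x + g x * diff_op a s f x + (s x)\<^sup>2 * deriv f x * deriv g x"
  unfolding diff_op_def C2_on_mult(2,3)[OF assms] by (simp add: algebra_simps)

text \<open>Ito's formula at the level of operators: the first-order coefficient in the new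
  coordinate g is \<open>diff_op a s g\<close>, so zero drift of an image means that the coordinate
  is annihilated.\<close>

lemma diff_op_compose:
  assumes "open I" "open J" "C2_on I g" "C2_on J f" "\<And>x. x \<in> I \<Longrightarrow> g x \<in> J" "x \<in> I"
  shows "diff_op a s (\<lambda>x. f (g x)) x =
     diff_op a s g x * deriv f (g x) + (s x * deriv g x)\<^sup>2 / 2 * deriv (deriv f) (g x)"
  using C2_on_compose(2,3)[OF assms(1-5), of x] assms(6)
  by (simp add: diff_op_def algebra_simps power_mult_distrib)

lemma diff_op_lincomb:
  assumes "open I" "C2_on I f" "C2_on I g"
  shows "C2_on I (\<lambda>x. p * f x + q * g x)"
    and "\<And>x. x \<in> I \<Longrightarrow> diff_op a s (\<lambda>x. p * f x + q * g x) x = p * diff_op a s f x + q * diff_op a s g x"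
proof -
  note c = C2_on_const[OF assms(1), of p] C2_on_const[OF assms(1), of q]
  note m = C2_on_mult[OF assms(1) c(1) assms(2)] C2_on_mult[OF assms(1) c(2) assms(3)]
  show "C2_on I (\<lambda>x. p * f x + q * g x)"
    by (rule C2_on_add(1)[OF assms(1) m(1,4)])
  show "diff_op a s (\<lambda>x. p * f x + q * g x) x = p * diff_op a s f x + q * diff_op a s g x" if "x \<in> I" for x
    unfolding diff_op_def C2_on_add(2,3)[OF assms(1) m(1,4) that] m(2,3,5,6)[OF that]
    by (simp add: algebra_simps)
qed

subsection \<open>Test functions\<close>

lemma not_in_support:
  assumes "x \<notin> closure {x. f x \<noteq> (0::real)}" shows "f x = 0"
  using assms closure_subset[of "{x. f x \<noteq> 0}"] by auto

lemma test_function_bounded: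
  assumes "test_function I f"
  obtains B where "\<And>x. \<bar>f x\<bar> \<le> B" "0 \<le> B"
proof -
  let ?K = "closure {x. f x \<noteq> 0}"
  have K: "compact ?K" and "C2_on UNIV f" using assms by (auto simp: test_function_def)
  have "compact (f ` ?K)"
    by (rule compact_continuous_image[OF continuous_on_subset[OF C2_on_continuous(1)[OF \<open>C2_on UNIV f\<close>]] K]) simp
  then have "bounded (f ` ?K)" by (rule compact_imp_bounded)
  then obtain B where B: "\<And>x. x \<in> ?K \<Longrightarrow> \<bar>f x\<bar> \<le> B" by (auto simp: bounded_iff)
  have "\<bar>f x\<bar> \<le> \<bar>B\<bar>" for x
    using B[of x] not_in_support[of x f] by (cases "x \<in> ?K") auto
  then show ?thesis by (intro that[of "\<bar>B\<bar>"]) auto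
qed

lemma test_function_measurable: "test_function I f \<Longrightarrow> f \<in> borel_measurable borel"
  by (auto simp: test_function_def intro: borel_measurable_continuous_onI C2_on_continuous(1))

lemma test_function_outside: "test_function I f \<Longrightarrow> x \<notin> I \<Longrightarrow> f x = 0"
  using not_in_support[of x f] by (auto simp: test_function_def)

text \<open>Regularity on I suffices, because f is zero on the open set \<open>- K\<close> and the
  two open sets \<open>I\<close> and \<open>- K\<close> cover the line.\<close>

lemma test_functionI:
  assumes "open I" "C2_on I f" "compact K" "K \<subseteq> I" "\<And>x. x \<notin> K \<Longrightarrow> f x = 0"
  shows "test_function I f"
proof -
  have cl: "closed K" using \<open>compact K\<close> compact_imp_closed by blast
  then have sub: "closure {x. f x \<noteq> 0} \<subseteq> K"
    using assms(5) by (intro closure_minimal) auto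
  have "C2_on (-K) f"
    by (rule C2_on_cong(1)[OF _ C2_on_const[of _ 0]]) (use cl assms(5) in auto)
  from C2_on_Un[OF \<open>open I\<close> _ assms(2) this] cl have "C2_on (I \<union> - K) f" by auto
  moreover have "I \<union> - K = UNIV" using assms(4) by auto
  ultimately have "C2_on UNIV f" by simp
  moreover have "compact (closure {x. f x \<noteq> 0})"
    using compact_Int_closed[OF \<open>compact K\<close> closed_closure, of "{x. f x \<noteq> 0}"] sub
    by (simp add: Int_absorb1)
  ultimately show ?thesis using sub assms(4) by (auto simp: test_function_def)
qed

lemma test_function_C2: "test_function I f \<Longrightarrow> C2_on J f"
  unfolding test_function_def by (auto elim: C2_on_subset)

text \<open>The factor u is regular on I only; whatever it does elsewhere is multiplied by
  zero.\<close>

lemma test_function_mult: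
  assumes "open I" "C2_on I u" "test_function I f"
  shows "test_function I (\<lambda>x. u x * f x)"
proof (rule test_functionI[where K = "closure {x. f x \<noteq> 0}"])
  show "C2_on I (\<lambda>x. u x * f x)"
    by (rule C2_on_mult(1)[OF assms(1,2) test_function_C2[OF assms(3)]])
  show "u x * f x = 0" if "x \<notin> closure {x. f x \<noteq> 0}" for x
    using not_in_support[OF that] by simp
qed (use assms in \<open>simp_all add: test_function_def\<close>)

text \<open>The pullback vanishes off the image of a compact set under the inverse of Y, and
  continuity of the inverse keeps that image compact.\<close>

lemma test_function_pullback:
  assumes "open I" "C2_on I Y" "inj_on Y I"
    "continuous_on (Y ` I) (inv_into I Y)" "test_function (Y ` I) g"
  shows "test_function I (\<lambda>x. if x \<in> I then g (Y x) else 0)" (is "test_function I ?f")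
proof (rule test_functionI[OF assms(1)])
  let ?K = "closure {x. g x \<noteq> 0}"
  have K: "compact ?K" "?K \<subseteq> Y ` I" using assms(5) by (auto simp: test_function_def)
  show "C2_on I ?f"
    by (rule C2_on_cong(1)[OF assms(1) C2_on_compose(1)[OF assms(1) open_UNIV assms(2)
            test_function_C2[OF assms(5)]]]) auto
  show "compact (inv_into I Y ` ?K)"
    by (rule compact_continuous_image[OF continuous_on_subset[OF assms(4) K(2)] K(1)])
  show "inv_into I Y ` ?K \<subseteq> I" using K(2) inv_into_into[of _ Y I] by blast
  show "?f x = 0" if "x \<notin> inv_into I Y ` ?K" for x
  proof (cases "x \<in> I")
    case True
    then have "Y x \<notin> ?K" using that inv_into_f_f[OF assms(3) True] by force
    then have "g (Y x) = 0" by (rule not_in_support)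
    then show ?thesis by simp
  qed simp
qed

text \<open>The cube of the positive part is \<open>C\<^sup>2\<close>, which is all the regularity that test functions need.\<close>

lemma C2_on_cube_pos: "C2_on UNIV (\<lambda>x::real. (max 0 x)^3)"
proof -
  have d: "((\<lambda>x::real. (max 0 x)^(Suc (Suc n))) has_real_derivative real (n + 2) * (max 0 x)^(Suc n)) (at x)" for x n
  proof (cases x "0::real" rule: linorder_cases)
    case less
    show ?thesis
      by (rule has_field_derivative_transform_within_open[where S = "{..<0}" and f = "\<lambda>_. 0"])
        (use less in \<open>auto simp: max_def\<close>)
  next
    case greater
    have "((\<lambda>x::real. x^(Suc (Suc n))) has_real_derivative real (n + 2) * x^(Suc n)) (at x)"
      using DERIV_pow[of "Suc (Suc n)" x UNIV] by (simp add: algebra_simps)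
    then have "((\<lambda>x::real. x^(Suc (Suc n))) has_real_derivative real (n + 2) * (max 0 x)^(Suc n)) (at x)"
      using greater by (simp only: max_absorb2[OF less_imp_le])
    then show ?thesis
      by (rule has_field_derivative_transform_within_open[where S = "{0<..}"])
        (use greater in \<open>simp_all add: max_absorb2\<close>)
  next
    case equal
    have "((\<lambda>h::real. (max 0 h)^(Suc n) * (max 0 h / h)) \<longlongrightarrow> 0) (at 0)"
    proof (rule Lim_null_comparison)
      have "norm ((max 0 h)^(Suc n) * (max 0 h / h)) \<le> (max 0 h)^(Suc n) * 1" for h :: real
        unfolding norm_mult by (intro mult_mono) (auto simp: max_def divide_le_eq_1)
      then show "\<forall>\<^sub>F h in at 0. norm ((max 0 h)^(Suc n) * (max 0 h / h)) \<le> (max 0 h :: real)^(Suc n)"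
        by simp
      show "((\<lambda>h::real. (max 0 h)^(Suc n)) \<longlongrightarrow> 0) (at 0)"
        by (rule tendsto_eq_intros refl | simp)+
    qed
    moreover have "((max 0 (0 + h))^(Suc (Suc n)) - (max 0 0)^(Suc (Suc n))) / h
        = (max 0 h)^(Suc n) * (max 0 h / h)" for h :: real
      by simp
    ultimately show ?thesis unfolding equal DERIV_def by (simp only:) simp
  qed
  show ?thesis
  proof (rule C2_onI(1))
    show "((\<lambda>x::real. (max 0 x)^3) has_real_derivative 3 * (max 0 x)^2) (at x)" for x
      using d[of 1 x] by (simp add: numeral_eq_Suc)
    show "((\<lambda>x::real. 3 * (max 0 x)^2) has_real_derivative 6 * max 0 x) (at x)" for x
      using DERIV_cmult[OF d[of 0 x], of 3] by (simp add: numeral_eq_Suc)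
  qed (auto intro!: continuous_intros)
qed

text \<open>With u and v the cubed positive parts of x - p and q - x, the quotient u / (u + v) is
  the required ramp; p < q prevents u and v from vanishing together.\<close>

lemma C2_ramp:
  assumes "p < (q::real)"
  obtains f where "C2_on UNIV f" "\<And>x. 0 \<le> f x" "\<And>x. f x \<le> 1" "\<And>x. x \<le> p \<Longrightarrow> f x = 0"
    "\<And>x. q \<le> x \<Longrightarrow> f x = 1"
proof -
  let ?u = "\<lambda>x::real. (max 0 (1 * x + - p))^3" and ?v = "\<lambda>x::real. (max 0 (-1 * x + q))^3"
  have u: "C2_on UNIV ?u" and v: "C2_on UNIV ?v"
    by (rule C2_on_compose(1)[OF open_UNIV open_UNIV C2_on_affine C2_on_cube_pos]; simp)+
  have pos: "?u x + ?v x > 0" for x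
  proof (cases "x < q")
    case True
    then have "?v x > 0" by (simp add: max_def)
    moreover have "?u x \<ge> 0" by simp
    ultimately show ?thesis by linarith
  next
    case False
    then have "?u x > 0" using assms by (simp add: max_def)
    moreover have "?v x \<ge> 0" by simp
    ultimately show ?thesis by linarith
  qed
  let ?f = "\<lambda>x. ?u x * inverse (?u x + ?v x)"
  show ?thesis
  proof (rule that[of ?f])
    show "C2_on UNIV ?f"
      using pos by (intro C2_on_mult(1) C2_on_inverse C2_on_add(1) u v) (auto simp: less_le)
    show "0 \<le> ?f x" for x using pos[of x] by (intro mult_nonneg_nonneg) auto
    show "?f x \<le> 1" for x using pos[of x] by (simp add: field_simps)
    show "?f x = 0" if "x \<le> p" for x using that by (simp add: max_def)
    show "?f x = 1" if "q \<le> x" for x using that assms by (simp add: max_def)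
  qed
qed

text \<open>The cutoff equals 1 on a neighbourhood of the compact interval and not merely on it, so
  its derivatives vanish at both ends too. It is the product of a rising ramp and a reflected
  one.\<close>

lemma bump:
  assumes "open I" "is_interval I" "\<alpha> \<in> I" "\<beta> \<in> I" "\<alpha> \<le> (\<beta>::real)"
  obtains \<kappa> \<delta> where "test_function I \<kappa>" "\<And>x. 0 \<le> \<kappa> x" "\<And>x. \<kappa> x \<le> 1" "\<delta> > 0"
    "{\<alpha> - \<delta><..<\<beta> + \<delta>} \<subseteq> I" "\<And>x. x \<in> {\<alpha> - \<delta><..<\<beta> + \<delta>} \<Longrightarrow> \<kappa> x = 1"
proof -
  obtain d1 where d1: "d1 > 0" "cball \<alpha> d1 \<subseteq> I" using assms(1,3) open_contains_cball by blast
  obtain d2 where d2: "d2 > 0" "cball \<beta> d2 \<subseteq> I" using assms(1,4) open_contains_cball by blast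
  define d where "d = min d1 d2"
  have "\<alpha> - d \<in> cball \<alpha> d1" "\<beta> + d \<in> cball \<beta> d2" and d: "d > 0"
    using d1 d2 by (auto simp: d_def dist_real_def)
  then have "\<alpha> - d \<in> I" "\<beta> + d \<in> I" using d1 d2 by auto
  then have sub: "{\<alpha> - d..\<beta> + d} \<subseteq> I"
    using assms(2) unfolding is_interval_1 by (meson atLeastAtMost_iff subsetI)
  \<comment> \<open>Each ramp rises in the outer half of a margin of width d; the inner half belongs
    to the neighbourhood, hence the witness \<open>d/2\<close> for \<delta>.\<close>
  obtain f where f: "C2_on UNIV f" "\<And>x. 0 \<le> f x" "\<And>x. f x \<le> 1" "\<And>x. x \<le> \<alpha> - d \<Longrightarrow> f x = 0"
    "\<And>x. \<alpha> - d/2 \<le> x \<Longrightarrow> f x = 1"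
    using C2_ramp[of "\<alpha> - d" "\<alpha> - d/2"] d by auto
  obtain g where g: "C2_on UNIV g" "\<And>x. 0 \<le> g x" "\<And>x. g x \<le> 1" "\<And>x. x \<le> - \<beta> - d \<Longrightarrow> g x = 0"
    "\<And>x. - \<beta> - d/2 \<le> x \<Longrightarrow> g x = 1"
    using C2_ramp[of "- \<beta> - d" "- \<beta> - d/2"] d by auto
  have g': "C2_on UNIV (\<lambda>x. g (-1 * x + 0))"
    by (rule C2_on_compose(1)[OF open_UNIV open_UNIV C2_on_affine g(1)]) auto
  let ?c = "\<lambda>x. f x * g (-1 * x + 0)"
  show ?thesis
  proof (rule that[of ?c "d/2"])
    show "test_function I ?c"
    proof (rule test_functionI[where K = "{\<alpha> - d..\<beta> + d}"])
      show "C2_on I ?c"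
        by (rule C2_on_subset[OF C2_on_mult(1)[OF open_UNIV f(1) g']]) auto
      show "?c x = 0" if "x \<notin> {\<alpha> - d..\<beta> + d}" for x
        using that f(4)[of x] g(4)[of "-x"] by (cases "x \<le> \<alpha> - d") auto
    qed (use sub \<open>open I\<close> in auto)
    show "?c x \<le> 1" for x using f g by (simp add: mult_le_one)
    show "{\<alpha> - d/2<..<\<beta> + d/2} \<subseteq> I" using sub d by (intro subset_trans[OF _ sub]) auto
  qed (use f g d in auto)
qed

subsection \<open>Smooth functions\<close>

text \<open>A finite order of smoothness makes closure properties provable by induction on n:
  differentiating once lowers the order by one. Order 0 is the vacuous base case.\<close>

definition nsmooth_on :: "nat \<Rightarrow> real set \<Rightarrow> (real \<Rightarrow> real) \<Rightarrow> bool" where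
  "nsmooth_on n I f \<longleftrightarrow> (\<forall>k<n. \<forall>x\<in>I. (deriv ^^ k) f differentiable (at x))"

lemma nsmooth_on_0 [simp]: "nsmooth_on 0 I f"
  by (simp add: nsmooth_on_def)

lemma nsmooth_on_Suc:
  "nsmooth_on (Suc n) I f \<longleftrightarrow> (\<forall>x\<in>I. f differentiable (at x)) \<and> nsmooth_on n I (deriv f)"
  by (auto simp: nsmooth_on_def All_less_Suc2 simp del: funpow.simps simp add: funpow_Suc_right)

lemma smooth_on_iff: "smooth_on I f \<longleftrightarrow> (\<forall>n. nsmooth_on n I f)"
  by (auto simp: smooth_on_def nsmooth_on_def)

lemma nsmooth_on_SucI:
  assumes "\<And>x. x \<in> I \<Longrightarrow> f differentiable (at x)" "nsmooth_on n I (deriv f)"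
  shows "nsmooth_on (Suc n) I f"
  using assms by (simp add: nsmooth_on_Suc)

lemma nsmooth_on_mono: "nsmooth_on n I f \<Longrightarrow> m \<le> n \<Longrightarrow> nsmooth_on m I f"
  by (auto simp: nsmooth_on_def)

lemma differentiable_cong_open:
  assumes "open I" "\<And>x. x \<in> I \<Longrightarrow> g x = f x" "x \<in> I" "f differentiable (at (x::real))"
  shows "g differentiable (at x)" and "deriv g x = deriv (f :: real \<Rightarrow> real) x"
proof -
  have "(f has_real_derivative deriv f x) (at x)"
    using assms(4) by (simp add: DERIV_deriv_iff_real_differentiable)
  then have "(g has_real_derivative deriv f x) (at x)"
    by (rule has_field_derivative_transform_within_open[OF _ assms(1,3)]) (rule assms(2)[symmetric])
  then show "g differentiable (at x)" "deriv g x = deriv f x"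
    by (auto intro: DERIV_imp_deriv simp: real_differentiable_def)
qed

lemma nsmooth_on_cong:
  assumes "open I" "nsmooth_on n I f" "\<And>x. x \<in> I \<Longrightarrow> g x = f x"
  shows "nsmooth_on n I g"
  using assms(2,3)
proof (induction n arbitrary: f g)
  case (Suc n)
  from Suc.prems(1) have f: "\<And>x. x \<in> I \<Longrightarrow> f differentiable (at x)" "nsmooth_on n I (deriv f)"
    by (auto simp: nsmooth_on_Suc)
  note c = differentiable_cong_open[OF assms(1) Suc.prems(2) _ f(1)]
  show ?case
    by (intro nsmooth_on_SucI c(1) Suc.IH[OF f(2)] c(2))
qed simp

lemma nsmooth_on_derivI:
  assumes "open I" "\<And>x. x \<in> I \<Longrightarrow> (f has_real_derivative f' x) (at x)" "nsmooth_on n I f'"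
  shows "nsmooth_on (Suc n) I f"
  using assms(2)
  by (intro nsmooth_on_SucI nsmooth_on_cong[OF assms(1,3)])
    (auto simp: real_differentiable_def intro: DERIV_imp_deriv)

lemma nsmooth_on_SucD:
  assumes "nsmooth_on (Suc n) I f"
  shows "x \<in> I \<Longrightarrow> (f has_real_derivative deriv f x) (at x)" "nsmooth_on n I (deriv f)" "nsmooth_on n I f"
  using assms by (auto simp: nsmooth_on_Suc DERIV_deriv_iff_real_differentiable intro: nsmooth_on_mono[OF assms])

lemma nsmooth_on_const: "open I \<Longrightarrow> nsmooth_on n I (\<lambda>_. c)"
proof (induction n arbitrary: c)
  case (Suc n)
  then show ?case by (intro nsmooth_on_derivI[where f' = "\<lambda>_. 0"]) auto
qed simp

lemma nsmooth_on_add: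
  assumes "open I" "nsmooth_on n I f" "nsmooth_on n I g"
  shows "nsmooth_on n I (\<lambda>x. f x + g x)"
  using assms(2,3)
proof (induction n arbitrary: f g)
  case (Suc n)
  note f = nsmooth_on_SucD[OF Suc.prems(1)] and g = nsmooth_on_SucD[OF Suc.prems(2)]
  show ?case
    by (rule nsmooth_on_derivI[OF assms(1) DERIV_add[OF f(1) g(1)] Suc.IH[OF f(2) g(2)]])
qed simp

lemma nsmooth_on_mult:
  assumes "open I" "nsmooth_on n I f" "nsmooth_on n I g"
  shows "nsmooth_on n I (\<lambda>x. f x * g x)"
  using assms(2,3)
proof (induction n arbitrary: f g)
  case (Suc n)
  note f = nsmooth_on_SucD[OF Suc.prems(1)] and g = nsmooth_on_SucD[OF Suc.prems(2)]
  show ?case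
    by (rule nsmooth_on_derivI[OF assms(1) DERIV_mult[OF f(1) g(1)]
        nsmooth_on_add[OF assms(1) Suc.IH[OF f(2) g(3)] Suc.IH[OF g(2) f(3)]]])
qed simp

lemma nsmooth_on_cmult: "open I \<Longrightarrow> nsmooth_on n I f \<Longrightarrow> nsmooth_on n I (\<lambda>x. c * f x)"
  by (intro nsmooth_on_mult nsmooth_on_const)

text \<open>The derivative of 1/f is -(1/f)^2 f', which contains 1/f itself at one order less, so
  the induction closes.\<close>

lemma nsmooth_on_inverse:
  assumes "open I" "nsmooth_on n I f" "\<And>x. x \<in> I \<Longrightarrow> f x \<noteq> 0"
  shows "nsmooth_on n I (\<lambda>x. inverse (f x))"
  using assms(2)
proof (induction n)
  case (Suc n)
  note f = nsmooth_on_SucD[OF Suc.prems]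
  have *: "((\<lambda>x. inverse (f x)) has_real_derivative (-1) * (inverse (f x) * inverse (f x) * deriv f x)) (at x)"
    if "x \<in> I" for x
    using f(1)[OF that] assms(3)[OF that] by (auto intro!: derivative_eq_intros)
  note IH = Suc.IH[OF f(3)]
  show ?case
    by (rule nsmooth_on_derivI[OF assms(1) * nsmooth_on_cmult[OF assms(1)
            nsmooth_on_mult[OF assms(1) nsmooth_on_mult[OF assms(1) IH IH] f(2)]]])
qed simp

lemma nsmooth_on_compose:
  assumes "open I" "nsmooth_on n I g" "nsmooth_on n J f" "\<And>x. x \<in> I \<Longrightarrow> g x \<in> J"
  shows "nsmooth_on n I (\<lambda>x. f (g x))"
  using assms(2,3)
proof (induction n arbitrary: f)
  case (Suc n)
  note g = nsmooth_on_SucD[OF Suc.prems(1)] and f = nsmooth_on_SucD[OF Suc.prems(2)]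
  show ?case
    by (rule nsmooth_on_derivI[OF assms(1) DERIV_chain2[OF f(1)[OF assms(4)] g(1)]
        nsmooth_on_mult[OF assms(1) Suc.IH[OF g(3) f(2)] g(2)]])
qed simp

lemma smooth_on_imp_C2: "smooth_on I f \<Longrightarrow> C2_on I f"
proof -
  assume "smooth_on I f"
  then have *: "\<And>n x. x \<in> I \<Longrightarrow> (deriv ^^ n) f differentiable (at x)" by (auto simp: smooth_on_def)
  have "continuous_on I (deriv (deriv f))"
    using *[of _ 2]
    by (intro continuous_at_imp_continuous_on ballI differentiable_imp_continuous_within) (simp add: numeral_2_eq_2)
  then show ?thesis
    using *[of _ 0] *[of _ 1] by (simp add: C2_on_def)
qed

text \<open>A continuous injection on an interval is an open map. This gives the open image and the
  continuous inverse, after which the inverse function theorem applies pointwise.\<close>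

lemma inverse_function_interval:
  assumes I: "open I" "is_interval I" "I \<noteq> {}"
    and Y: "\<And>x. x \<in> I \<Longrightarrow> (Y has_real_derivative Y' x) (at x)" "\<And>x. x \<in> I \<Longrightarrow> Y' x \<noteq> 0"
    and inj: "inj_on Y I"
  shows "open (Y ` I)" and "continuous_on (Y ` I) (inv_into I Y)"
    and "\<And>y. y \<in> Y ` I \<Longrightarrow> (inv_into I Y has_real_derivative inverse (Y' (inv_into I Y y))) (at y)"
proof -
  have cont: "continuous_on I Y" using Y(1) by (auto intro!: continuous_at_imp_continuous_on DERIV_isCont)
  have op: "\<And>T. open T \<Longrightarrow> T \<subseteq> I \<Longrightarrow> open (Y ` T)"
    using injective_eq_1d_open_map_UNIV[OF cont I(2)] inj by auto
  show o: "open (Y ` I)" using op I by auto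
  show c: "continuous_on (Y ` I) (inv_into I Y)"
    by (rule continuous_on_inverse_open_map[OF cont refl])
      (use op I(1) o inj in \<open>auto simp: openin_open_eq\<close>)
  fix y assume "y \<in> Y ` I"
  then obtain x where x: "x \<in> I" "y = Y x" by auto
  have "(inv_into I Y has_derivative (*) (inverse (Y' x))) (at (Y x))"
  proof (rule has_derivative_inverse_strong[OF I(1) x(1) cont])
    show "(Y has_derivative (*) (Y' x)) (at x)"
      using Y(1)[OF x(1)] by (simp add: has_field_derivative_def)
    show "(*) (Y' x) \<circ> (*) (inverse (Y' x)) = id" using Y(2)[OF x(1)] by (auto simp: fun_eq_iff)
  qed (use inj in auto)
  then show "(inv_into I Y has_real_derivative inverse (Y' (inv_into I Y y))) (at y)"
    using x inj by (simp add: has_field_derivative_def)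
qed

text \<open>Bootstrapping: the derivative of the inverse is 1/Y' composed with the inverse, so each
  order of smoothness of the inverse yields the next.\<close>

lemma diffeomorphism_onI:
  assumes I: "open I" "is_interval I" "I \<noteq> {}"
    and Y: "smooth_on I Y" "\<And>x. x \<in> I \<Longrightarrow> deriv Y x \<noteq> 0" "inj_on Y I"
  shows "diffeomorphism_on I Y"
proof -
  have nY: "nsmooth_on n I Y" for n using Y(1) by (simp add: smooth_on_iff)
  note inv = inverse_function_interval[OF I nsmooth_on_SucD(1)[OF nY[of "Suc 0"]] Y(2,3)]
  have "nsmooth_on n (Y ` I) (inv_into I Y)" for n
  proof (induction n)
    case (Suc n)
    show ?case
      by (rule nsmooth_on_derivI[OF inv(1) inv(3)])
        (auto intro!: inv(1) nsmooth_on_compose[OF inv(1) Suc] nsmooth_on_inverse nsmooth_on_SucD(2)[OF nY] I Y(2)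
          inv_into_into simp: Y(3))
  qed simp
  then show ?thesis using Y by (auto simp: diffeomorphism_on_def smooth_on_iff)
qed

text \<open>Y' has no zero by the chain rule for \<open>inv_into I Y (Y x) = x\<close>; the
  definition speaks of a differentiable inverse and not of Y'.\<close>

lemma diffeomorphism_onD:
  assumes I: "open I" "is_interval I" "I \<noteq> {}" and "diffeomorphism_on I Y"
  shows "C2_on I Y" "inj_on Y I" "\<And>x. x \<in> I \<Longrightarrow> deriv Y x \<noteq> 0" "open (Y ` I)" "continuous_on (Y ` I) (inv_into I Y)"
proof -
  show C2: "C2_on I Y" and inj: "inj_on Y I"
    using assms(4) by (auto simp: diffeomorphism_on_def smooth_on_imp_C2)
  have C2': "C2_on (Y ` I) (inv_into I Y)"
    using assms(4) by (auto simp: diffeomorphism_on_def smooth_on_imp_C2)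
  show d: "deriv Y x \<noteq> 0" if "x \<in> I" for x
  proof
    assume 0: "deriv Y x = 0"
    have 1: "((\<lambda>x. inv_into I Y (Y x)) has_real_derivative deriv (inv_into I Y) (Y x) * deriv Y x) (at x)"
      using that by (intro DERIV_chain2 C2_onD(1)[OF C2] C2_onD(1)[OF C2']) auto
    have "((\<lambda>x. x) has_real_derivative deriv (inv_into I Y) (Y x) * deriv Y x) (at x)"
      by (rule has_field_derivative_transform_within_open[OF 1 I(1) that]) (simp add: inj)
    then have "deriv (inv_into I Y) (Y x) * deriv Y x = 1"
      using DERIV_unique DERIV_ident by blast
    then show False using 0 by simp
  qed
  note inv = inverse_function_interval[OF I C2_onD(1)[OF C2] d inj]
  show "open (Y ` I)" "continuous_on (Y ` I) (inv_into I Y)" using inv(1,2) by auto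
qed

subsection \<open>Wronskians\<close>

text \<open>Abel's identity: the Wronskian satisfies W' = -(2 b / \<sigma>^2) W, because the \<rho>
  terms of the two equations cancel. A zero at one point therefore spreads to the whole
  interval.\<close>

lemma wronskian_zero:
  assumes I: "open I" "is_interval I" and b: "continuous_on I b" and s: "continuous_on I \<sigma>"
    and s0: "\<And>x. x \<in> I \<Longrightarrow> \<sigma> x \<noteq> 0"
    and u: "C2_on I u" "\<And>x. x \<in> I \<Longrightarrow> diff_op b \<sigma> u x = \<rho> * u x"
    and v: "C2_on I v" "\<And>x. x \<in> I \<Longrightarrow> diff_op b \<sigma> v x = \<rho> * v x"
    and x0: "x0 \<in> I" "u x0 * deriv v x0 - deriv u x0 * v x0 = 0" and x: "x \<in> I"
  shows "u x * deriv v x - deriv u x * v x = 0"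
proof -
  define p q where "p = min x0 x" and "q = max x0 x"
  have pq: "{p..q} \<subseteq> I" using I(2) x0(1) x
    unfolding is_interval_1 p_def q_def by (metis atLeastAtMost_iff max_def min_def subsetI)
  define W where "W y = u y * deriv v y - deriv u y * v y" for y
  define r where "r y = 2 * b y / (\<sigma> y)\<^sup>2" for y
  have W: "(W has_real_derivative - r y * W y) (at y)" if "y \<in> I" for y
  proof -
    have d: "(W has_real_derivative u y * deriv (deriv v) y - deriv (deriv u) y * v y) (at y)"
      unfolding W_def using C2_onD[OF u(1) that] C2_onD[OF v(1) that]
      by (auto intro!: derivative_eq_intros)
    have s2: "(\<sigma> y)\<^sup>2 \<noteq> 0" using s0[OF that] by simp
    have u'': "deriv (deriv u) y = (\<rho> * u y - b y * deriv u y) * 2 / (\<sigma> y)\<^sup>2"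
      and v'': "deriv (deriv v) y = (\<rho> * v y - b y * deriv v y) * 2 / (\<sigma> y)\<^sup>2"
      using u(2)[OF that] v(2)[OF that] s2 by (auto simp: diff_op_def field_simps)
    have "u y * deriv (deriv v) y - deriv (deriv u) y * v y = - r y * W y"
      unfolding u'' v'' W_def r_def using s2 by (simp add: field_simps)
    with d show ?thesis by simp
  qed
  have "continuous_on {p..q} r"
    unfolding r_def
    by (intro continuous_intros continuous_on_subset[OF b pq] continuous_on_subset[OF s pq])
      (use s0 pq in auto)
  \<comment> \<open>The integrating factor exp R is built only on the compact interval between the
    two points, so derivatives are taken within that interval.\<close>
  then obtain R where R: "\<And>y. y \<in> {p..q} \<Longrightarrow> (R has_real_derivative r y) (at y within {p..q})"
    by (metis antiderivative_continuous has_real_derivative_iff_has_vector_derivative)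
  have "((\<lambda>y. W y * exp (R y)) has_real_derivative 0) (at y within {p..q})" if "y \<in> {p..q}" for y
    using R[OF that] has_field_derivative_at_within[OF W, of y "{p..q}"] that pq
    by (auto intro!: derivative_eq_intros)
  then obtain c where c: "\<And>y. y \<in> {p..q} \<Longrightarrow> W y * exp (R y) = c"
    using has_field_derivative_zero_constant[of "{p..q}" "\<lambda>y. W y * exp (R y)"] by auto
  have "x0 \<in> {p..q}" "x \<in> {p..q}" by (auto simp: p_def q_def)
  then have "W x0 * exp (R x0) = W x * exp (R x)" using c by simp
  moreover have "W x0 = 0" using x0(2) by (simp add: W_def)
  ultimately have "W x = 0" by simp
  then show ?thesis by (simp add: W_def)
qed

text \<open>Up to the factor -1/v^2, the Wronskian is the derivative of u/v.\<close>

lemma wronskian_zero_proportional: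
  assumes I: "open I" "is_interval I"
    and u: "C2_on I u" and v: "C2_on I v" "\<And>x. x \<in> I \<Longrightarrow> v x \<noteq> 0"
    and W: "\<And>x. x \<in> I \<Longrightarrow> u x * deriv v x - deriv u x * v x = 0"
  shows "\<exists>c. \<forall>x\<in>I. u x = c * v x"
proof -
  have "((\<lambda>x. u x / v x) has_real_derivative 0) (at x within I)" if "x \<in> I" for x
  proof -
    have "((\<lambda>x. u x / v x) has_real_derivative (deriv u x * v x - u x * deriv v x) / (v x * v x)) (at x within I)"
      by (rule has_field_derivative_at_within[OF DERIV_divide[OF C2_onD(1)[OF u that] C2_onD(1)[OF v(1) that] v(2)[OF that]]])
    moreover have "deriv u x * v x - u x * deriv v x = 0" using W[OF that] by simp
    ultimately show ?thesis by simp
  qed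
  then obtain c where "\<And>x. x \<in> I \<Longrightarrow> u x / v x = c"
    using has_field_derivative_zero_constant[of I "\<lambda>x. u x / v x"] is_interval_convex[OF I(2)] by auto
  then have "\<forall>x\<in>I. u x = c * v x" using v(2) by (auto simp: field_simps)
  then show ?thesis ..
qed

subsection \<open>Solutions of the eigenvalue equation\<close>

text \<open>Doob's h-transform on operators: the zero-order terms cancel exactly because h solves
  the eigenvalue equation, and the only trace of h is the added drift \<sigma>^2 h'/h.\<close>

lemma diff_op_transform:
  assumes "open I" "C2_on I h" "C2_on I f" "x \<in> I" "diff_op b \<sigma> h x = \<rho> * h x" "h x \<noteq> 0"
  shows "diff_op b \<sigma> (\<lambda>x. h x * f x) x - \<rho> * (h x * f x) =
    h x * diff_op (\<lambda>x. b x + (\<sigma> x)\<^sup>2 * deriv h x / h x) \<sigma> f x"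
  unfolding diff_op_mult[OF assms(1-4)] assms(5)
  using assms(6) by (simp add: diff_op_def field_simps)

text \<open>The analytic content of \<open>fundamental_pair\<close> on the open interval, separated
  from the process; the hitting-time identities belong to the probabilistic part.\<close>

locale fundamental_solutions =
  fixes I :: "real set" and b \<sigma> :: "real \<Rightarrow> real" and \<rho> :: real and \<phi>p \<phi>m :: "real \<Rightarrow> real"
  assumes I: "open I" "is_interval I" "I \<noteq> {}"
    and smooth_b: "smooth_on I b" and smooth_\<sigma>: "smooth_on I \<sigma>" and \<sigma>_pos: "\<And>x. x \<in> I \<Longrightarrow> 0 < \<sigma> x"
    and C2: "C2_on I \<phi>p" "C2_on I \<phi>m"
    and eq: "\<And>x. x \<in> I \<Longrightarrow> diff_op b \<sigma> \<phi>p x = \<rho> * \<phi>p x" "\<And>x. x \<in> I \<Longrightarrow> diff_op b \<sigma> \<phi>m x = \<rho> * \<phi>m x"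
    and pos: "\<And>x. x \<in> I \<Longrightarrow> 0 < \<phi>p x" "\<And>x. x \<in> I \<Longrightarrow> 0 < \<phi>m x"
    and mono: "mono_on I \<phi>p" "antimono_on I \<phi>m"
    and indep: "\<And>\<alpha> \<beta>. (\<And>x. x \<in> I \<Longrightarrow> \<alpha> * \<phi>p x + \<beta> * \<phi>m x = 0) \<Longrightarrow> \<alpha> = 0 \<and> \<beta> = 0"
begin

abbreviation "wr x \<equiv> \<phi>p x * deriv \<phi>m x - deriv \<phi>p x * \<phi>m x"

lemma continuous_coefficients: "continuous_on I b" "continuous_on I \<sigma>"
  using C2_on_continuous(1) smooth_on_imp_C2 smooth_b smooth_\<sigma> by blast+

lemmas wronskian = wronskian_zero[OF I(1,2) continuous_coefficients less_imp_neq[OF \<sigma>_pos, symmetric]]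

text \<open>A single zero would make the Wronskian vanish identically and the two solutions
  proportional, against linear independence.\<close>

lemma wr_neq_0:
  assumes "x \<in> I" shows "wr x \<noteq> 0"
proof
  assume "wr x = 0"
  then have "wr y = 0" if "y \<in> I" for y
    using wronskian[OF _ C2(1) eq(1) C2(2) eq(2) assms _ that] by simp
  then obtain c where "\<forall>y\<in>I. \<phi>p y = c * \<phi>m y"
    using wronskian_zero_proportional[OF I(1,2) C2] pos(2) by force
  then show False using indep[of 1 "-c"] by simp
qed

text \<open>Monotonicity gives only \<open>wr x \<le> 0\<close>; linear independence excludes
  equality. This covers \<rho> = 0, where neither solution need be strictly monotone by
  itself.\<close>

lemma ratio_strict_antimono:
  assumes "\<alpha> \<in> I" "\<beta> \<in> I" "\<alpha> < \<beta>"
  shows "\<phi>m \<beta> / \<phi>p \<beta> < \<phi>m \<alpha> / \<phi>p \<alpha>"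
proof (rule DERIV_neg_imp_decreasing[OF assms(3)])
  fix x assume "\<alpha> \<le> x" "x \<le> \<beta>"
  then have x: "x \<in> I" using I(2) assms unfolding is_interval_1 by blast
  have "deriv \<phi>p x \<ge> 0"
    using mono_on_imp_deriv_nonneg[OF mono(1) C2_onD(1)[OF C2(1) x]] I(1) x by (simp add: interior_open)
  moreover have "- deriv \<phi>m x \<ge> 0"
    using mono_on_imp_deriv_nonneg[of I "\<lambda>x. - \<phi>m x", OF _ DERIV_minus[OF C2_onD(1)[OF C2(2) x]]] I(1) x mono(2)
    by (simp add: interior_open monotone_on_def)
  ultimately have "wr x \<le> 0"
    using pos[OF x] by (smt (verit) mult_nonneg_nonneg mult_minus_right)
  then have "wr x < 0" using wr_neq_0[OF x] by simp
  then have "(deriv \<phi>m x * \<phi>p x - \<phi>m x * deriv \<phi>p x) / (\<phi>p x * \<phi>p x) < 0"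
    using pos(1)[OF x] by (intro divide_neg_pos) (auto simp: algebra_simps)
  moreover have "((\<lambda>x. \<phi>m x / \<phi>p x) has_real_derivative
      (deriv \<phi>m x * \<phi>p x - \<phi>m x * deriv \<phi>p x) / (\<phi>p x * \<phi>p x)) (at x)"
    using C2_onD(1)[OF C2(2) x] C2_onD(1)[OF C2(1) x] pos(1)[OF x] by (intro DERIV_divide) auto
  ultimately show "\<exists>y. ((\<lambda>x. \<phi>m x / \<phi>p x) has_real_derivative y) (at x) \<and> y < 0" by blast
qed

lemma det_pos:
  assumes "\<alpha> \<in> I" "\<beta> \<in> I" "\<alpha> < \<beta>"
  shows "0 < \<phi>p \<beta> * \<phi>m \<alpha> - \<phi>p \<alpha> * \<phi>m \<beta>"
  using ratio_strict_antimono[OF assms] pos(1)[OF assms(1)] pos(1)[OF assms(2)]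
  by (simp add: field_simps)

text \<open>Solvability of the Dirichlet problem on a compact subinterval, with
  \<open>det_pos\<close> as the nonvanishing determinant of the linear system.\<close>

lemma boundary_values:
  assumes "\<alpha> \<in> I" "\<beta> \<in> I" "\<alpha> < \<beta>"
  obtains c d where "c * \<phi>p \<alpha> + d * \<phi>m \<alpha> = A" "c * \<phi>p \<beta> + d * \<phi>m \<beta> = B"
proof -
  define W where "W = \<phi>p \<beta> * \<phi>m \<alpha> - \<phi>p \<alpha> * \<phi>m \<beta>"
  have W: "W \<noteq> 0" using det_pos[OF assms] by (simp add: W_def)
  show ?thesis
  \<comment> \<open>The witnesses are Cramer's rule.\<close>
  proof (rule that[of "(B * \<phi>m \<alpha> - A * \<phi>m \<beta>) / W" "(A * \<phi>p \<beta> - B * \<phi>p \<alpha>) / W"])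
    have "(B * \<phi>m \<alpha> - A * \<phi>m \<beta>) * \<phi>p \<alpha> + (A * \<phi>p \<beta> - B * \<phi>p \<alpha>) * \<phi>m \<alpha> = A * W"
      unfolding W_def by algebra
    then show "(B * \<phi>m \<alpha> - A * \<phi>m \<beta>) / W * \<phi>p \<alpha> + (A * \<phi>p \<beta> - B * \<phi>p \<alpha>) / W * \<phi>m \<alpha> = A"
      using W by (simp add: field_simps)
    have "(B * \<phi>m \<alpha> - A * \<phi>m \<beta>) * \<phi>p \<beta> + (A * \<phi>p \<beta> - B * \<phi>p \<alpha>) * \<phi>m \<beta> = B * W"
      unfolding W_def by algebra
    then show "(B * \<phi>m \<alpha> - A * \<phi>m \<beta>) / W * \<phi>p \<beta> + (A * \<phi>p \<beta> - B * \<phi>p \<alpha>) / W * \<phi>m \<beta> = B"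
      using W by (simp add: field_simps)
  qed
qed

lemma boundary_values_unique:
  assumes "\<alpha> \<in> I" "\<beta> \<in> I" "\<alpha> < \<beta>"
    and "c * \<phi>p \<alpha> + d * \<phi>m \<alpha> = c' * \<phi>p \<alpha> + d' * \<phi>m \<alpha>"
    and "c * \<phi>p \<beta> + d * \<phi>m \<beta> = c' * \<phi>p \<beta> + d' * \<phi>m \<beta>"
  shows "c = c'" "d = d'"
proof -
  note W = det_pos[OF assms(1-3)]
  have "(c - c') * (\<phi>p \<beta> * \<phi>m \<alpha> - \<phi>p \<alpha> * \<phi>m \<beta>) = 0"
    "(d - d') * (\<phi>p \<beta> * \<phi>m \<alpha> - \<phi>p \<alpha> * \<phi>m \<beta>) = 0"
    using assms(4,5) by algebra+
  then show "c = c'" "d = d'" using W by auto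
qed

lemma lincomb:
  shows C2_lincomb: "C2_on I (\<lambda>x. c * \<phi>p x + d * \<phi>m x)"
    and diff_op_solution: "x \<in> I \<Longrightarrow> diff_op b \<sigma> (\<lambda>x. c * \<phi>p x + d * \<phi>m x) x = \<rho> * (c * \<phi>p x + d * \<phi>m x)"
    and deriv_lincomb: "x \<in> I \<Longrightarrow> deriv (\<lambda>x. c * \<phi>p x + d * \<phi>m x) x = c * deriv \<phi>p x + d * deriv \<phi>m x"
proof -
  show "C2_on I (\<lambda>x. c * \<phi>p x + d * \<phi>m x)" by (rule diff_op_lincomb(1)[OF I(1) C2])
  show "diff_op b \<sigma> (\<lambda>x. c * \<phi>p x + d * \<phi>m x) x = \<rho> * (c * \<phi>p x + d * \<phi>m x)" if "x \<in> I"
    using diff_op_lincomb(2)[OF I(1) C2 that] eq[OF that] by (simp add: algebra_simps)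
  show "deriv (\<lambda>x. c * \<phi>p x + d * \<phi>m x) x = c * deriv \<phi>p x + d * deriv \<phi>m x" if "x \<in> I"
    using C2_onD(1)[OF C2(1) that] C2_onD(1)[OF C2(2) that]
    by (intro DERIV_imp_deriv DERIV_add DERIV_cmult)
qed

text \<open>Subtracting a multiple of \<phi>m makes the Wronskian with \<phi>p vanish at one point,
  hence everywhere; the remainder is then a multiple of \<phi>p.\<close>

lemma solution_lincomb:
  assumes u: "C2_on I u" "\<And>x. x \<in> I \<Longrightarrow> diff_op b \<sigma> u x = \<rho> * u x"
  shows "\<exists>c d. \<forall>x\<in>I. u x = c * \<phi>p x + d * \<phi>m x"
proof -
  obtain x0 where x0: "x0 \<in> I" using I(3) by auto
  define W where "W = wr x0"
  have W: "W \<noteq> 0" using wr_neq_0[OF x0] by (simp add: W_def)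
  \<comment> \<open>Solution of the linear equation that the Wronskian of u - d \<phi>m and \<phi>p
    be zero at x0.\<close>
  define d where "d = - (u x0 * deriv \<phi>p x0 - deriv u x0 * \<phi>p x0) / W"
  let ?w = "\<lambda>x. 1 * u x + (- d) * \<phi>m x"
  have w: "C2_on I ?w" by (rule diff_op_lincomb(1)[OF I(1) u(1) C2(2)])
  have Lw: "diff_op b \<sigma> ?w x = \<rho> * ?w x" if "x \<in> I" for x
    unfolding diff_op_lincomb(2)[OF I(1) u(1) C2(2) that] u(2)[OF that] eq(2)[OF that]
    by (simp add: algebra_simps)
  have dw: "deriv ?w x0 = deriv u x0 - d * deriv \<phi>m x0"
    by (rule DERIV_imp_deriv, rule DERIV_cong[OF DERIV_add[OF
            DERIV_cmult[OF C2_onD(1)[OF u(1) x0]] DERIV_cmult[OF C2_onD(1)[OF C2(2) x0]]]]) simp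
  have "d * W = - (u x0 * deriv \<phi>p x0 - deriv u x0 * \<phi>p x0)" using W by (simp add: d_def)
  then have 0: "?w x0 * deriv \<phi>p x0 - deriv ?w x0 * \<phi>p x0 = 0"
    unfolding dw W_def by (simp add: algebra_simps)
  have "?w x * deriv \<phi>p x - deriv ?w x * \<phi>p x = 0" if "x \<in> I" for x
    by (rule wronskian[OF _ w Lw C2(1) eq(1) x0 0 that])
  then obtain c where "\<forall>x\<in>I. ?w x = c * \<phi>p x"
    using wronskian_zero_proportional[OF I(1,2) w C2(1)] pos(1) by force
  then have "\<forall>x\<in>I. u x = c * \<phi>p x + d * \<phi>m x" by (auto simp: algebra_simps)
  then show ?thesis by blast
qed

text \<open>Elliptic bootstrapping in one dimension: the equation expresses u'' through u, u' and
  smooth coefficients. Hence u and u' are carried together through the induction.\<close>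

lemma solution_smooth:
  assumes u: "C2_on I u" "\<And>x. x \<in> I \<Longrightarrow> diff_op b \<sigma> u x = \<rho> * u x"
  shows "smooth_on I u"
proof -
  have c: "nsmooth_on n I b" "nsmooth_on n I \<sigma>" for n
    using smooth_b smooth_\<sigma> by (auto simp: smooth_on_iff)
  have "nsmooth_on n I u \<and> nsmooth_on n I (deriv u)" for n
  proof (induction n)
    case (Suc n)
    have "nsmooth_on n I (\<lambda>x. (2 * (\<rho> * u x + (-1) * (b x * deriv u x))) * (inverse (\<sigma> x) * inverse (\<sigma> x)))"
      by (intro nsmooth_on_mult nsmooth_on_add nsmooth_on_const nsmooth_on_inverse I c)
        (use Suc \<sigma>_pos in force)+
    moreover have "deriv (deriv u) x = (2 * (\<rho> * u x + (-1) * (b x * deriv u x))) * (inverse (\<sigma> x) * inverse (\<sigma> x))"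
      if "x \<in> I" for x
      using u(2)[OF that] \<sigma>_pos[OF that] by (simp add: diff_op_def field_simps power2_eq_square)
    ultimately have "nsmooth_on n I (deriv (deriv u))" by (rule nsmooth_on_cong[OF I(1)])
    then show ?case
      using Suc u(1) by (auto intro!: nsmooth_on_SucI simp: C2_on_def)
  qed simp
  then show ?thesis by (simp add: smooth_on_iff)
qed

text \<open>The determinant condition rules out that both coefficients are zero.\<close>

lemma positive_combination:
  assumes "c \<ge> 0" "d \<ge> 0" "c * d' - d * c' \<noteq> 0" "x \<in> I"
  shows "0 < c * \<phi>p x + d * \<phi>m x"
proof -
  have "c > 0 \<or> d > 0" using assms(1-3) by auto
  then show ?thesis
    using assms(1,2) pos[OF assms(4)] by (auto intro: add_pos_nonneg add_nonneg_pos)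
qed

text \<open>The quotient rule collapses to Y' = (c d' - d c') wr / h^2. No factor vanishes, so the
  mean value theorem gives injectivity.\<close>

lemma quotient_diffeomorphism:
  assumes det: "c * d' - d * c' \<noteq> 0" and h: "\<And>x. x \<in> I \<Longrightarrow> h x = c * \<phi>p x + d * \<phi>m x"
    and h0: "\<And>x. x \<in> I \<Longrightarrow> h x \<noteq> 0"
    and Y: "\<And>x. x \<in> I \<Longrightarrow> Y x = 1 / h x * (c' * \<phi>p x + d' * \<phi>m x)"
  shows "diffeomorphism_on I Y"
proof -
  let ?h = "\<lambda>x. c * \<phi>p x + d * \<phi>m x" and ?u = "\<lambda>x. c' * \<phi>p x + d' * \<phi>m x"
  have sm: "smooth_on I ?h" "smooth_on I ?u"
    by (intro solution_smooth lincomb | assumption)+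
  have "nsmooth_on n I (\<lambda>x. inverse (?h x) * ?u x)" for n
    using sm h0 h by (intro nsmooth_on_mult nsmooth_on_inverse I) (auto simp: smooth_on_iff)
  then have Ysm: "smooth_on I Y"
    using h Y unfolding smooth_on_iff by (auto intro: nsmooth_on_cong[OF I(1)] simp: divide_inverse)
  have dY: "(Y has_real_derivative (c * d' - d * c') * wr x / (h x)\<^sup>2) (at x)" if "x \<in> I" for x
  proof (rule has_field_derivative_transform_within_open[OF _ I(1) that])
    have "((\<lambda>x. ?u x / ?h x) has_real_derivative
       (deriv ?u x * ?h x - ?u x * deriv ?h x) / (?h x * ?h x)) (at x)"
      using h h0 that by (intro DERIV_divide C2_onD(1)[OF C2_lincomb]) auto
    then show "((\<lambda>x. ?u x / ?h x) has_real_derivative (c * d' - d * c') * wr x / (h x)\<^sup>2) (at x)"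
      unfolding deriv_lincomb[OF that] h[OF that]
      by (rule DERIV_cong) (simp add: power2_eq_square algebra_simps)
    show "\<And>y. y \<in> I \<Longrightarrow> ?u y / ?h y = Y y" using h Y by simp
  qed
  have dY0: "(c * d' - d * c') * wr x / (h x)\<^sup>2 \<noteq> 0" if "x \<in> I" for x
    using det wr_neq_0[OF that] h0[OF that] by simp
  have neq: "Y p \<noteq> Y q" if pq: "p \<in> I" "q \<in> I" "p < q" for p q
  proof
    assume "Y p = Y q"
    have sub: "{p..q} \<subseteq> I" using I(2) pq unfolding is_interval_1 by (meson atLeastAtMost_iff subsetI)
    have "\<exists>z>p. z < q \<and> Y q - Y p = (q - p) * ((c * d' - d * c') * wr z / (h z)\<^sup>2)"
      by (rule MVT2[OF pq(3)]) (use dY sub in auto)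
    then obtain z where z: "p < z" "z < q"
      and "Y q - Y p = (q - p) * ((c * d' - d * c') * wr z / (h z)\<^sup>2)" by blast
    then have "(q - p) * ((c * d' - d * c') * wr z / (h z)\<^sup>2) = 0"
      using \<open>Y p = Y q\<close> by linarith
    moreover have "z \<in> I" using z by (intro subsetD[OF sub]) simp
    ultimately show False using dY0[of z] pq(3) by simp
  qed
  then have inj: "inj_on Y I" by (intro inj_onI) (metis linorder_cases)
  show ?thesis
    by (rule diffeomorphism_onI[OF I Ysm _ inj]) (use DERIV_imp_deriv[OF dY] dY0 in simp)
qed

end

subsection \<open>Transition operators and generators\<close>

lemma interval_subset_closure_interior:
  assumes "is_interval (S::real set)" "interior S \<noteq> {}"
  shows "S \<subseteq> closure (interior S)"
proof -
  have "closure (interior S) = closure S"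
    using assms by (intro convex_closure_interior is_interval_convex)
  then show ?thesis using closure_subset by blast
qed

text \<open>Endpoints belonging to the interval are limits of interior points; this is how facts
  about the interior reach boundary points of the state space.\<close>

lemma continuous_le_on_interval:
  fixes f g :: "real \<Rightarrow> real"
  assumes "is_interval S" "interior S \<noteq> {}" "continuous_on S f" "continuous_on S g"
    and "\<And>x. x \<in> interior S \<Longrightarrow> f x \<le> g x" "x \<in> S"
  shows "f x \<le> g x"
proof -
  have "x \<in> closure (interior S)" using interval_subset_closure_interior[OF assms(1,2)] assms(6) by auto
  then obtain u where u: "\<And>n. u n \<in> interior S" "u \<longlonglongrightarrow> x" by (auto simp: closure_sequential)
  have uS: "eventually (\<lambda>n. u n \<in> S) sequentially" using u(1) interior_subset by (intro always_eventually) auto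
  have "(\<lambda>n. f (u n)) \<longlonglongrightarrow> f x" "(\<lambda>n. g (u n)) \<longlonglongrightarrow> g x"
    using continuous_on_tendsto_compose[OF assms(3) u(2) assms(6) uS]
      continuous_on_tendsto_compose[OF assms(4) u(2) assms(6) uS] by auto
  then show ?thesis
    by (rule LIMSEQ_le) (use assms(5) u(1) in auto)
qed

context regular_diffusion
begin

abbreviation I :: "real set" where "I \<equiv> interior D"

lemma interior_D: "open I" "is_interval I" "I \<noteq> {}" "I \<subseteq> D"
proof -
  show "is_interval I"
    using state_space(1) by (simp add: is_interval_convex_1)
qed (use state_space interior_subset in auto)

lemma law:
  assumes "x \<in> D"
  shows "prob_space (P x)" "sets (P x) = sets M" "space (P x) = space M"
    "subalgebra (P x) (F t)"
proof -
  have "P x \<in> space (prob_algebra M)"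
    using measurable_space[OF laws, of x] assms by (simp add: space_restrict_space)
  then show "prob_space (P x)" and s: "sets (P x) = sets M" by (auto simp: space_prob_algebra)
  then show sp: "space (P x) = space M" by (intro sets_eq_imp_space_eq)
  show "subalgebra (P x) (F t)" using subalgebras[of t] s sp by (simp add: subalgebra_def)
qed

abbreviation "DB \<equiv> restrict_space borel D"

text \<open>g is measurable on the state space only, and X t is known to lie there only before the
  lifetime. Measurability is thus shown on the event of survival and glued with the cemetery value
  c.\<close>

lemma alive_measurable_F:
  assumes g: "g \<in> DB \<rightarrow>\<^sub>M N" and c: "c \<in> space N" and t: "0 \<le> t"
  shows "(\<lambda>\<omega>. if ereal t < \<zeta> \<omega> then g (X t \<omega>) else c) \<in> F t \<rightarrow>\<^sub>M N"
proof (subst measurable_If_restrict_space_iff)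
  show "{\<omega> \<in> space (F t). ereal t < \<zeta> \<omega>} \<in> sets (F t)"
    using adapted(2)[OF t] by (simp add: pred_def)
  have "X t \<in> restrict_space (F t) {\<omega>. ereal t < \<zeta> \<omega>} \<rightarrow>\<^sub>M DB"
    using in_state_space t space_F
    by (intro measurable_restrict_space2 measurable_restrict_space1 adapted)
      (auto simp: space_restrict_space)
  then have "(\<lambda>\<omega>. g (X t \<omega>)) \<in> restrict_space (F t) {\<omega>. ereal t < \<zeta> \<omega>} \<rightarrow>\<^sub>M N"
    using g by (rule measurable_compose)
  then show "(\<lambda>\<omega>. g (X t \<omega>)) \<in> restrict_space (F t) {\<omega>. ereal t < \<zeta> \<omega>} \<rightarrow>\<^sub>M N \<and>
     (\<lambda>\<omega>. c) \<in> restrict_space (F t) {\<omega>. \<not> ereal t < \<zeta> \<omega>} \<rightarrow>\<^sub>M N"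
    using c by simp
qed

lemma F_measurable_M: "f \<in> F t \<rightarrow>\<^sub>M N \<Longrightarrow> f \<in> M \<rightarrow>\<^sub>M N"
  using measurable_from_subalg[OF subalgebras] .

lemma alive_measurable:
  assumes "x \<in> D" "g \<in> DB \<rightarrow>\<^sub>M N" "c \<in> space N" "0 \<le> t"
  shows "(\<lambda>\<omega>. if ereal t < \<zeta> \<omega> then g (X t \<omega>) else c) \<in> P x \<rightarrow>\<^sub>M N"
  using measurable_from_subalg[OF law(4)[OF assms(1)] alive_measurable_F[OF assms(2-4)]] .

abbreviation "base t g x \<equiv> transition X \<zeta> (\<lambda>t x. P x) t g x"

lemma base_integrable:
  assumes "x \<in> D" "0 \<le> t" "g \<in> borel_measurable DB" "\<And>y. y \<in> D \<Longrightarrow> \<bar>g y\<bar> \<le> (B::real)"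
  shows "integrable (P x) (\<lambda>\<omega>. if ereal t < \<zeta> \<omega> then g (X t \<omega>) else 0)"
proof -
  interpret prob_space "P x" by (rule law[OF assms(1)])
  have "0 \<le> B" using assms(4)[OF assms(1)] by auto
  show ?thesis
    using assms(2,4) in_state_space \<open>0 \<le> B\<close> law(3)[OF assms(1)]
    by (intro integrable_const_bound[of _ B] alive_measurable assms AE_I2) auto
qed

lemma base_lincomb:
  assumes "x \<in> D" "0 \<le> t" "f \<in> borel_measurable DB" "\<And>y. y \<in> D \<Longrightarrow> \<bar>f y\<bar> \<le> A"
    "g \<in> borel_measurable DB" "\<And>y. y \<in> D \<Longrightarrow> \<bar>g y\<bar> \<le> B"
  shows "base t (\<lambda>y. p * f y + q * g y) x = p * base t f x + q * base t g x"
proof -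
  note f = base_integrable[OF assms(1-4)] and g = base_integrable[OF assms(1,2,5,6)]
  have "base t (\<lambda>y. p * f y + q * g y) x =
     (\<integral>\<omega>. p * (if ereal t < \<zeta> \<omega> then f (X t \<omega>) else 0) + q * (if ereal t < \<zeta> \<omega> then g (X t \<omega>) else 0) \<partial>P x)"
    unfolding transition_def by (rule Bochner_Integration.integral_cong) auto
  also have "\<dots> = p * base t f x + q * base t g x"
    unfolding transition_def using f g by simp
  finally show ?thesis .
qed

lemma base_mono:
  assumes "x \<in> D" "0 \<le> t" "f \<in> borel_measurable DB" "\<And>y. y \<in> D \<Longrightarrow> \<bar>f y\<bar> \<le> A"
    "g \<in> borel_measurable DB" "\<And>y. y \<in> D \<Longrightarrow> \<bar>g y\<bar> \<le> B" "\<And>y. y \<in> D \<Longrightarrow> f y \<le> g y"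
  shows "base t f x \<le> base t g x"
  unfolding transition_def
  using assms(2,7) in_state_space law(3)[OF assms(1)]
  by (intro integral_mono base_integrable[OF assms(1-4)] base_integrable[OF assms(1,2,5,6)]) auto

text \<open>An inequality, since mass may be lost to the cemetery.\<close>

lemma base_const:
  assumes "x \<in> D" "0 \<le> t" "0 \<le> c"
  shows "base t (\<lambda>_. c) x \<le> c"
proof -
  interpret prob_space "P x" by (rule law[OF assms(1)])
  have "base t (\<lambda>_. c) x \<le> (\<integral>\<omega>. c \<partial>P x)"
    unfolding transition_def using assms
    by (intro integral_mono base_integrable[where B = c and g = "\<lambda>_. c"]) auto
  then show ?thesis by (simp add: prob_space)
qed

text \<open>The density and the integrand are both measurable for \<open>F t\<close>, so the
  integral may be taken under \<open>P x\<close>. Nonnegativity of h on all of D ensures that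
  \<open>ennreal\<close> truncates nothing.\<close>

lemma transition_transformed:
  assumes h: "continuous_on D h" "\<And>y. y \<in> D \<Longrightarrow> 0 \<le> h y" and x: "x \<in> D" "0 < h x" and t: "0 \<le> t"
    and f: "f \<in> borel_measurable DB"
  shows "transition X \<zeta> (transformed_law F X \<zeta> P \<rho> h) t f x =
    exp (- \<rho> * t) / h x * base t (\<lambda>y. h y * f y) x"
proof -
  let ?Q = "restr_to_subalg (P x) (F t)"
  let ?k = "\<lambda>\<omega>. if ereal t < \<zeta> \<omega> then exp (- \<rho> * t) * (h (X t \<omega>) / h x) else 0"
  let ?f = "\<lambda>\<omega>. if ereal t < \<zeta> \<omega> then f (X t \<omega>) else 0"
  have hD: "h \<in> borel_measurable DB" using h(1) by (rule borel_measurable_continuous_on_restrict)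
  have kF: "?k \<in> borel_measurable (F t)"
    using alive_measurable_F[where g = "\<lambda>y. exp (- \<rho> * t) * (h y / h x)" and N = borel and c = 0] hD t by simp
  have fF: "?f \<in> borel_measurable (F t)"
    using alive_measurable_F[OF f _ t, of 0] by simp
  have "(\<lambda>\<omega>. if ereal t < \<zeta> \<omega> then ennreal (exp (- \<rho> * t) * (h (X t \<omega>) / h x)) else 0)
      = (\<lambda>\<omega>. ennreal (?k \<omega>))"
    by auto
  then have "transition X \<zeta> (transformed_law F X \<zeta> P \<rho> h) t f x = integral\<^sup>L (density ?Q (\<lambda>\<omega>. ennreal (?k \<omega>))) ?f"
    by (simp add: transition_def transformed_law_def)
  also have "\<dots> = (\<integral>\<omega>. ?k \<omega> *\<^sub>R ?f \<omega> \<partial>?Q)"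
  proof (rule integral_density)
    have "space ?Q = space M" using law(3)[OF x(1)] by (simp add: space_restr_to_subalg)
    then show "AE \<omega> in ?Q. 0 \<le> ?k \<omega>"
      using h(2) in_state_space t x(2) by (intro AE_I2) auto
  qed (use measurable_in_subalg[OF law(4)[OF x(1)]] kF fF in auto)
  also have "\<dots> = (\<integral>\<omega>. ?k \<omega> *\<^sub>R ?f \<omega> \<partial>P x)"
    using kF fF by (intro integral_subalgebra2 law x) simp
  also have "\<dots> = (\<integral>\<omega>. exp (- \<rho> * t) / h x * (if ereal t < \<zeta> \<omega> then h (X t \<omega>) * f (X t \<omega>) else 0) \<partial>P x)"
    by (intro Bochner_Integration.integral_cong) auto
  also have "\<dots> = exp (- \<rho> * t) / h x * base t (\<lambda>y. h y * f y) x"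
    unfolding transition_def by simp
  finally show ?thesis .
qed

lemma base_generator:
  assumes "test_function I f" "x \<in> I"
  shows "((\<lambda>t. (base t f x - f x) / t) \<longlongrightarrow> diff_op b \<sigma> f x) (at_right 0)"
  using generator assms unfolding has_generator_on_def by simp

end

lemma exp_minus_one_limit: "((\<lambda>t. (exp (p * t) - 1) / t) \<longlongrightarrow> (p::real)) (at_right 0)"
proof -
  have "((\<lambda>t. exp (p * t)) has_real_derivative p) (at 0)"
    by (auto intro!: derivative_eq_intros)
  then have "((\<lambda>t. (exp (p * t) - 1) / t) \<longlongrightarrow> p) (at 0)"
    by (simp add: has_field_derivative_iff)
  then show ?thesis by (rule tendsto_mono[OF at_le[OF subset_UNIV]])
qed

lemma exp_limit_1: "((\<lambda>t. exp (p * t)) \<longlongrightarrow> (1::real)) (at_right 0)"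
proof -
  have "isCont (\<lambda>t::real. exp (p * t)) 0" by simp
  then have "((\<lambda>t. exp (p * t)) \<longlongrightarrow> 1) (at 0)" by (simp add: isCont_def)
  then show ?thesis by (rule tendsto_mono[OF at_le[OF subset_UNIV]])
qed

text \<open>Valid for arbitrary coefficients. A test function that is locally 1 therefore isolates
  the zero-order term of a generator whose other coefficients are unknown.\<close>

lemma diff_op_locally_one:
  assumes "open U" "x \<in> U" "\<And>y. y \<in> U \<Longrightarrow> f y = 1"
  shows "diff_op a s f x = 0"
proof -
  have "diff_op a s f x = diff_op a s (\<lambda>_. 1) x"
    by (rule diff_op_cong[OF assms(1,2) C2_on_const[OF assms(1)] assms(3)])
  then show ?thesis by (simp add: diff_op_def)
qed

text \<open>The chain rule for g composed with Y. Evaluating at \<open>Y x\<close> removes the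
  inverse of Y from the formula.\<close>

lemma image_generator_limit:
  assumes I: "open I" "is_interval I" "I \<noteq> {}" and Y: "diffeomorphism_on I Y"
    and T: "has_generator_on I T a s k"
    and g: "test_function (Y ` I) g" and x: "x \<in> I"
  shows "((\<lambda>t. (image_transition I Y T t g (Y x) - g (Y x)) / t) \<longlongrightarrow>
    diff_op a s Y x * deriv g (Y x) + (s x * deriv Y x)\<^sup>2 / 2 * deriv (deriv g) (Y x) - k x * g (Y x)) (at_right 0)"
proof -
  note YD = diffeomorphism_onD[OF I Y]
  let ?f = "\<lambda>x. if x \<in> I then g (Y x) else 0"
  have f: "test_function I ?f"
    by (rule test_function_pullback[OF I(1) YD(1,2,5) g])
  have "diff_op a s ?f x = diff_op a s (\<lambda>x. g (Y x)) x"
    by (rule diff_op_cong[OF I(1) x C2_on_compose(1)[OF I(1) open_UNIV YD(1) test_function_C2[OF g]]]) auto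
  also have "\<dots> = diff_op a s Y x * deriv g (Y x) + (s x * deriv Y x)\<^sup>2 / 2 * deriv (deriv g) (Y x)"
    by (rule diff_op_compose[OF I(1) open_UNIV YD(1) test_function_C2[OF g] _ x]) simp
  finally have *: "diff_op a s ?f x = \<dots>" .
  have "((\<lambda>t. (T t ?f x - ?f x) / t) \<longlongrightarrow> diff_op a s ?f x - k x * ?f x) (at_right 0)"
    using T f x unfolding has_generator_on_def by blast
  then show ?thesis
    unfolding * using x YD(2) by (simp add: image_transition_def)
qed

section \<open>Generator of the transformed process and behaviour at local maxima\<close>

context regular_diffusion
begin

lemma test_function_DB: "test_function J f \<Longrightarrow> f \<in> borel_measurable DB"
  by (intro measurable_restrict_space1 test_function_measurable)

text \<open>For a C^2 function h the product h f is again a test function, so the generator of the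
  original process applies to it and \<open>diff_op_transform\<close> evaluates the result.\<close>

lemma transformed_generator:
  assumes h: "continuous_on D h" "\<And>y. y \<in> D \<Longrightarrow> 0 \<le> h y" "\<And>y. y \<in> I \<Longrightarrow> 0 < h y"
    "C2_on I h" "\<And>y. y \<in> I \<Longrightarrow> diff_op b \<sigma> h y = \<rho> * h y"
  shows "has_generator_on I (transition X \<zeta> (transformed_law F X \<zeta> P \<rho> h))
    (\<lambda>x. b x + (\<sigma> x)\<^sup>2 * deriv h x / h x) \<sigma> (\<lambda>_. 0)"
  unfolding has_generator_on_def
proof (intro allI impI ballI)
  fix f x assume f: "test_function I f" and x: "x \<in> I"
  let ?T = "transition X \<zeta> (transformed_law F X \<zeta> P \<rho> h)" and ?hf = "\<lambda>y. h y * f y"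
  have hx: "h x > 0" using h(3) x .
  have xD: "x \<in> D" using x interior_D by auto
  \<comment> \<open>The difference quotient is split into the increment of the original semigroup on
    h f and the increment of the discount factor.\<close>
  have "((\<lambda>t. exp (- \<rho> * t) / h x * ((base t ?hf x - ?hf x) / t) + f x * ((exp (- \<rho> * t) - 1) / t))
      \<longlongrightarrow> 1 / h x * diff_op b \<sigma> ?hf x + f x * (- \<rho>)) (at_right 0)"
    using hx
    by (intro tendsto_intros exp_limit_1 exp_minus_one_limit base_generator x
        test_function_mult interior_D h f) auto
  also have "1 / h x * diff_op b \<sigma> ?hf x + f x * (- \<rho>) =
      1 / h x * (diff_op b \<sigma> ?hf x - \<rho> * (h x * f x))"
    using hx by (simp add: field_simps)
  also have "\<dots> = diff_op (\<lambda>x. b x + (\<sigma> x)\<^sup>2 * deriv h x / h x) \<sigma> f x"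
    using hx diff_op_transform[OF interior_D(1) h(4) test_function_C2[OF f] x h(5)[OF x]] by simp
  finally have lim: "((\<lambda>t. exp (- \<rho> * t) / h x * ((base t ?hf x - ?hf x) / t) + f x * ((exp (- \<rho> * t) - 1) / t))
      \<longlongrightarrow> diff_op (\<lambda>x. b x + (\<sigma> x)\<^sup>2 * deriv h x / h x) \<sigma> f x) (at_right 0)" .
  have "\<forall>\<^sub>F t in at_right 0. exp (- \<rho> * t) / h x * ((base t ?hf x - ?hf x) / t) + f x * ((exp (- \<rho> * t) - 1) / t)
      = (?T t f x - f x) / t"
    unfolding eventually_at_right_field
  proof (intro exI[of _ 1] conjI allI impI)
    fix t :: real assume "0 < t" "t < 1"
    have T: "?T t f x = exp (- \<rho> * t) / h x * base t ?hf x"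
      using \<open>0 < t\<close> by (intro transition_transformed h xD hx test_function_DB[OF f]) auto
    show "exp (- \<rho> * t) / h x * ((base t ?hf x - ?hf x) / t) + f x * ((exp (- \<rho> * t) - 1) / t)
      = (?T t f x - f x) / t"
      unfolding T using \<open>0 < t\<close> hx by (simp add: field_simps)
  qed simp
  from Lim_transform_eventually[OF lim this]
  show "((\<lambda>t. (?T t f x - f x) / t) \<longlongrightarrow>
      diff_op (\<lambda>x. b x + (\<sigma> x)\<^sup>2 * deriv h x / h x) \<sigma> f x - 0 * f x) (at_right 0)" by simp
qed

text \<open>The coefficients provided by \<open>no_killing_on\<close> disappear because \<kappa> is
  1 near x. What remains is the eigenvalue equation for h in the sense of difference quotients, with
  no derivative of h; the cutoff keeps the integrand bounded.\<close>

lemma no_killing_limit: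
  assumes h: "continuous_on D h" "\<And>y. y \<in> D \<Longrightarrow> 0 \<le> h y" "\<And>y. y \<in> I \<Longrightarrow> 0 < h y"
    and nk: "no_killing_on I (transition X \<zeta> (transformed_law F X \<zeta> P \<rho> h))"
    and \<kappa>: "test_function I \<kappa>" "open U" "x \<in> U" "\<And>y. y \<in> U \<Longrightarrow> \<kappa> y = 1" and x: "x \<in> I"
  shows "((\<lambda>t. (base t (\<lambda>y. h y * \<kappa> y) x - h x) / t) \<longlongrightarrow> \<rho> * h x) (at_right 0)"
proof -
  let ?T = "transition X \<zeta> (transformed_law F X \<zeta> P \<rho> h)" and ?hf = "\<lambda>y. h y * \<kappa> y"
  obtain a s where "has_generator_on I ?T a s (\<lambda>_. 0)" using nk by (auto simp: no_killing_on_def)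
  then have "((\<lambda>t. (?T t \<kappa> x - \<kappa> x) / t) \<longlongrightarrow> diff_op a s \<kappa> x - 0 * \<kappa> x) (at_right 0)"
    using \<kappa>(1) x unfolding has_generator_on_def by blast
  then have lim0: "((\<lambda>t. (?T t \<kappa> x - 1) / t) \<longlongrightarrow> 0) (at_right 0)"
    using diff_op_locally_one[OF \<kappa>(2-4)] \<kappa>(3,4) by simp
  have hx: "h x > 0" using h(3) x .
  have xD: "x \<in> D" using x interior_D by auto
  \<comment> \<open>The measure change is undone: the original increment is h(x) exp(\<rho> t) times
    the transformed one, plus the increment of exp(\<rho> t), which produces \<rho> h(x).\<close>
  have "((\<lambda>t. h x * exp (\<rho> * t) * ((?T t \<kappa> x - 1) / t) + h x * ((exp (\<rho> * t) - 1) / t))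
     \<longlongrightarrow> h x * 1 * 0 + h x * \<rho>) (at_right 0)"
    by (intro tendsto_intros exp_limit_1 exp_minus_one_limit lim0)
  then have lim: "((\<lambda>t. h x * exp (\<rho> * t) * ((?T t \<kappa> x - 1) / t) + h x * ((exp (\<rho> * t) - 1) / t))
     \<longlongrightarrow> \<rho> * h x) (at_right 0)" by (simp add: mult.commute)
  have "\<forall>\<^sub>F t in at_right 0. h x * exp (\<rho> * t) * ((?T t \<kappa> x - 1) / t) + h x * ((exp (\<rho> * t) - 1) / t)
     = (base t ?hf x - h x) / t"
    unfolding eventually_at_right_field
  proof (intro exI[of _ 1] conjI allI impI)
    fix t :: real assume "0 < t" "t < 1"
    have "?T t \<kappa> x = exp (- \<rho> * t) / h x * base t ?hf x"
      using \<open>0 < t\<close> by (intro transition_transformed h xD hx test_function_DB[OF \<kappa>(1)]) auto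
    then have "base t ?hf x = h x * exp (\<rho> * t) * ?T t \<kappa> x"
      using hx by (simp add: exp_minus field_simps)
    then show "h x * exp (\<rho> * t) * ((?T t \<kappa> x - 1) / t) + h x * ((exp (\<rho> * t) - 1) / t)
     = (base t ?hf x - h x) / t"
      using \<open>0 < t\<close> by (simp add: field_simps)
  qed simp
  from Lim_transform_eventually[OF lim this] show ?thesis .
qed

text \<open>A local maximum suffices although g is only measurable and bounded: values far from x
  have weight o(t), by the generator applied to a cutoff near x. The sign of g(x) matters because
  lost mass lowers the expectation only if g(x) is nonnegative.\<close>

lemma generator_local_max:
  assumes x: "x \<in> I" and g: "g \<in> borel_measurable DB" "\<And>y. y \<in> D \<Longrightarrow> \<bar>g y\<bar> \<le> B"
    and max: "\<delta> > 0" "\<And>y. y \<in> I \<Longrightarrow> \<bar>y - x\<bar> < \<delta> \<Longrightarrow> g y \<le> g x" "0 \<le> g x"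
    and lim: "((\<lambda>t. (base t g x - g x) / t) \<longlongrightarrow> l) (at_right 0)"
  shows "l \<le> 0"
proof -
  have xD: "x \<in> D" using x interior_D by auto
  have B: "B \<ge> 0" using g(2)[OF xD] by auto
  let ?J = "I \<inter> ball x \<delta>"
  have "is_interval ?J" using interior_D(2) by (intro is_interval_Int) (auto simp: is_interval_convex_1)
  then obtain \<kappa> \<epsilon> where \<kappa>: "test_function ?J \<kappa>" "\<And>y. 0 \<le> \<kappa> y" "\<And>y. \<kappa> y \<le> 1" "\<epsilon> > 0"
    "{x - \<epsilon><..<x + \<epsilon>} \<subseteq> ?J" "\<And>y. y \<in> {x - \<epsilon><..<x + \<epsilon>} \<Longrightarrow> \<kappa> y = 1"
    using bump[of ?J x x] interior_D(1) x max(1) by (auto simp: open_Int)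
  have \<kappa>I: "test_function I \<kappa>" using \<kappa>(1) by (auto simp: test_function_def)
  have \<kappa>b: "\<bar>\<kappa> y\<bar> \<le> 1" for y using \<kappa>(2,3)[of y] by auto
  have \<kappa>x: "\<kappa> x = 1" using \<kappa>(4,6) by auto
  have "((\<lambda>t. (base t \<kappa> x - \<kappa> x) / t) \<longlongrightarrow> diff_op b \<sigma> \<kappa> x) (at_right 0)"
    by (rule base_generator[OF \<kappa>I x])
  then have "((\<lambda>t. (base t \<kappa> x - 1) / t) \<longlongrightarrow> 0) (at_right 0)"
    using diff_op_locally_one[of "{x - \<epsilon><..<x + \<epsilon>}" x \<kappa> b \<sigma>] \<kappa>(4,6) \<kappa>x by simp
  then have lim0: "((\<lambda>t. - B * ((base t \<kappa> x - 1) / t)) \<longlongrightarrow> - B * 0) (at_right 0)"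
    by (intro tendsto_intros)
  have "\<forall>\<^sub>F t in at_right 0. (base t g x - g x) / t \<le> - B * ((base t \<kappa> x - 1) / t)"
    unfolding eventually_at_right_field
  proof (intro exI[of _ 1] conjI allI impI)
    fix t :: real assume t: "0 < t" "t < 1"
    \<comment> \<open>A majorant of g: the interpolation g(x) \<kappa> + B (1 - \<kappa>), with the
      local bound inside the neighbourhood and the global bound outside.\<close>
    let ?k = "\<lambda>y. (g x - B) * \<kappa> y + 1 * B"
    have km: "\<kappa> \<in> borel_measurable DB" by (rule test_function_DB[OF \<kappa>I])
    have le: "g y \<le> ?k y" if "y \<in> D" for y
    proof (cases "y \<in> ?J")
      case True
      then have "g y \<le> g x" using max(2)[of y] by (auto simp: dist_real_def abs_minus_commute)
      moreover have "0 \<le> (B - g x) * (1 - \<kappa> y)"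
        using g(2)[OF xD] \<kappa>(3)[of y] by (intro mult_nonneg_nonneg) auto
      ultimately show ?thesis by (simp add: algebra_simps)
    next
      case False
      then have "\<kappa> y = 0" by (rule test_function_outside[OF \<kappa>(1)])
      then show ?thesis using g(2)[OF that] by simp
    qed
    have kb: "\<bar>?k y\<bar> \<le> \<bar>g x - B\<bar> * 1 + B" for y
    proof -
      have "\<bar>(g x - B) * \<kappa> y\<bar> \<le> \<bar>g x - B\<bar> * 1"
        unfolding abs_mult by (intro mult_left_mono \<kappa>b) simp
      then show ?thesis using B by simp
    qed
    have "base t g x \<le> base t ?k x"
      by (rule base_mono[OF xD _ g _ kb le]) (use t km in auto)
    also have "\<dots> = (g x - B) * base t \<kappa> x + 1 * base t (\<lambda>_. B) x"
      by (rule base_lincomb[OF xD _ km \<kappa>b, where B = B]) (use t B in auto)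
    finally have 1: "base t g x \<le> (g x - B) * base t \<kappa> x + base t (\<lambda>_. B) x" by simp
    have 2: "base t (\<lambda>_. B) x \<le> B" using base_const[OF xD _ B, of t] t by simp
    \<comment> \<open>The place where g(x) \<ge> 0 compensates for a total mass that may be below
      1.\<close>
    have 3: "g x * base t \<kappa> x \<le> g x * 1"
    proof (rule mult_left_mono[OF _ max(3)])
      have "base t \<kappa> x \<le> base t (\<lambda>_. 1) x"
        by (rule base_mono[OF xD _ km \<kappa>b, where B = 1]) (use t \<kappa> in auto)
      also have "\<dots> \<le> 1" using base_const[OF xD _, of t 1] t by simp
      finally show "base t \<kappa> x \<le> 1" .
    qed
    have "base t g x - g x \<le> - B * (base t \<kappa> x - 1)" using 1 2 3 by (simp add: algebra_simps)
    then show "(base t g x - g x) / t \<le> - B * ((base t \<kappa> x - 1) / t)"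
      using t(1) divide_right_mono[of "base t g x - g x" "- B * (base t \<kappa> x - 1)" t] by simp
  qed simp
  from tendsto_le[OF _ lim0 lim this] show ?thesis by simp
qed

end

section \<open>Maximum principle on compact intervals\<close>

lemma C2_on_exp: "open J \<Longrightarrow> C2_on J (\<lambda>x. exp (l * x))"
  and diff_op_exp: "diff_op a s (\<lambda>x. exp (l * x)) x = (l * a x + (s x)\<^sup>2 / 2 * l\<^sup>2) * exp (l * x)"
proof -
  have 1: "((\<lambda>x. exp (l * x)) has_real_derivative l * exp (l * x)) (at x)" for x
    by (auto intro!: derivative_eq_intros)
  have 2: "((\<lambda>x. l * exp (l * x)) has_real_derivative l\<^sup>2 * exp (l * x)) (at x)" for x
    by (auto intro!: derivative_eq_intros simp: power2_eq_square)
  have 3: "continuous_on J (\<lambda>x. l\<^sup>2 * exp (l * x))" for J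
    by (intro continuous_intros)
  show "C2_on J (\<lambda>x. exp (l * x))" if "open J" by (rule C2_onI(1)[OF that 1 2 3])
  note D = C2_onI(2,3)[OF open_UNIV 1 2 3 UNIV_I]
  show "diff_op a s (\<lambda>x. exp (l * x)) x = (l * a x + (s x)\<^sup>2 / 2 * l\<^sup>2) * exp (l * x)"
    unfolding diff_op_def D by (simp add: algebra_simps)
qed

lemma bounded_times_test_function:
  assumes "continuous_on I u" "test_function I f"
  obtains B where "\<And>x. \<bar>u x * f x\<bar> \<le> B"
proof -
  let ?K = "closure {x. f x \<noteq> 0}"
  have K: "compact ?K" "?K \<subseteq> I" and "C2_on UNIV f" using assms(2) by (auto simp: test_function_def)
  have "continuous_on ?K (\<lambda>x. u x * f x)"
    by (intro continuous_on_mult continuous_on_subset[OF assms(1) K(2)]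
        continuous_on_subset[OF C2_on_continuous(1)[OF \<open>C2_on UNIV f\<close>]]) simp
  then have "compact ((\<lambda>x. u x * f x) ` ?K)" using K(1) by (rule compact_continuous_image)
  then have "bounded ((\<lambda>x. u x * f x) ` ?K)" by (rule compact_imp_bounded)
  then obtain B where B: "\<And>x. x \<in> ?K \<Longrightarrow> \<bar>u x * f x\<bar> \<le> B" by (auto simp: bounded_iff)
  have "\<bar>u x * f x\<bar> \<le> \<bar>B\<bar>" for x
  proof (cases "x \<in> ?K")
    case True then show ?thesis using B[of x] by linarith
  next
    case False
    then have "f x = 0" by (rule not_in_support)
    then show ?thesis by simp
  qed
  then show ?thesis by (rule that)
qed

context regular_diffusion
begin

text \<open>Boundedness on all of D is assumed because the process started inside the interval also
  sees values outside it. At an interior maximum of the perturbed function the limit would be \<rho>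
  w + e L\<psi> > 0, against \<open>generator_local_max\<close>.\<close>

lemma generator_maximum_principle:
  assumes ab: "\<alpha> \<in> I" "\<beta> \<in> I" "\<alpha> < \<beta>" and \<rho>: "0 \<le> \<rho>"
    and w: "w \<in> borel_measurable DB" "\<And>y. y \<in> D \<Longrightarrow> \<bar>w y\<bar> \<le> B" "continuous_on {\<alpha>..\<beta>} w"
      "w \<alpha> \<le> 0" "w \<beta> \<le> 0"
    and lim: "\<And>x. \<alpha> < x \<Longrightarrow> x < \<beta> \<Longrightarrow> ((\<lambda>t. (base t w x - w x) / t) \<longlongrightarrow> \<rho> * w x) (at_right 0)"
    and y: "y \<in> {\<alpha>..\<beta>}"
  shows "w y \<le> 0"
proof (rule ccontr)
  assume "\<not> w y \<le> 0"
  then have wy: "w y > 0" by simp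
  have sub: "{\<alpha>..\<beta>} \<subseteq> I"
    using interior_D(2) ab unfolding is_interval_1 by (meson atLeastAtMost_iff subsetI)
  have cont: "continuous_on I b" "continuous_on I \<sigma>"
    using coefficients C2_on_continuous(1) smooth_on_imp_C2 by blast+
  have "continuous_on {\<alpha>..\<beta>} (\<lambda>x. - 2 * b x / (\<sigma> x)\<^sup>2)"
    by (intro continuous_intros continuous_on_subset[OF cont(1) sub] continuous_on_subset[OF cont(2) sub])
      (use coefficients(3) sub in force)
  then have "bounded ((\<lambda>x. - 2 * b x / (\<sigma> x)\<^sup>2) ` {\<alpha>..\<beta>})"
    by (intro compact_imp_bounded compact_continuous_image) auto
  then obtain K where K: "\<forall>x\<in>{\<alpha>..\<beta>}. \<bar>- 2 * b x / (\<sigma> x)\<^sup>2\<bar> \<le> K"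
    unfolding bounded_iff by auto
  \<comment> \<open>Since L exp(l x) = (l/2) (2 b + l \<sigma>^2) exp(l x), any positive l above the
    maximum of -2 b / \<sigma>^2 makes it strictly positive.\<close>
  define l where "l = \<bar>K\<bar> + 1"
  have L\<psi>: "l * b x + (\<sigma> x)\<^sup>2 / 2 * l\<^sup>2 > 0" if "x \<in> {\<alpha>..\<beta>}" for x
  proof -
    have s: "(\<sigma> x)\<^sup>2 > 0" using coefficients(3)[of x] sub that by auto
    have "- 2 * b x / (\<sigma> x)\<^sup>2 < l" using abs_ge_self[of "- 2 * b x / (\<sigma> x)\<^sup>2"] bspec[OF K that]
      unfolding l_def by linarith
    then have "- 2 * b x < l * (\<sigma> x)\<^sup>2" by (simp only: pos_divide_less_eq[OF s])
    then have "0 < 2 * b x + l * (\<sigma> x)\<^sup>2" by linarith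
    then have "0 < l / 2 * (2 * b x + l * (\<sigma> x)\<^sup>2)" by (intro mult_pos_pos) (auto simp: l_def)
    then show ?thesis by (simp add: algebra_simps power2_eq_square)
  qed
  obtain \<kappa> \<delta> where \<kappa>: "test_function I \<kappa>" "\<And>x. 0 \<le> \<kappa> x" "\<And>x. \<kappa> x \<le> 1" "\<delta> > 0"
    "{\<alpha> - \<delta><..<\<beta> + \<delta>} \<subseteq> I" "\<And>x. x \<in> {\<alpha> - \<delta><..<\<beta> + \<delta>} \<Longrightarrow> \<kappa> x = 1"
    using bump[OF interior_D(1,2) ab(1,2) less_imp_le[OF ab(3)]] by blast
  \<comment> \<open>For \<open>\<rho> = 0\<close> the equation for \<open>w\<close> alone gives no contradiction at a maximum; adding a small
    multiple of a function with strictly positive generator does.\<close>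
  define \<psi> where "\<psi> x = exp (l * x) * \<kappa> x" for x
  have \<psi>: "test_function I \<psi>"
    unfolding \<psi>_def by (rule test_function_mult[OF interior_D(1) C2_on_exp[OF interior_D(1)] \<kappa>(1)])
  obtain C' where C': "\<And>x. \<bar>\<psi> x\<bar> \<le> C'" using test_function_bounded[OF \<psi>] by blast
  have \<psi>L: "diff_op b \<sigma> \<psi> x > 0" if "x \<in> {\<alpha>..\<beta>}" for x
  proof -
    have "diff_op b \<sigma> \<psi> x = diff_op b \<sigma> (\<lambda>x. exp (l * x)) x"
      by (rule diff_op_cong[of "{\<alpha> - \<delta><..<\<beta> + \<delta>}"]) (use that \<kappa> C2_on_exp in \<open>auto simp: \<psi>_def\<close>)
    then show ?thesis using L\<psi>[OF that] by (simp add: diff_op_exp)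
  qed
  define C where "C = exp (l * \<beta>)"
  have \<psi>C: "0 < \<psi> x" "\<psi> x \<le> C" if "x \<in> {\<alpha>..\<beta>}" for x
    using that \<kappa>(4) \<kappa>(6)[of x] by (auto simp: \<psi>_def C_def l_def intro!: mult_left_mono)
  have C: "C > 0" by (simp add: C_def)
  \<comment> \<open>The perturbation stays below w(y)/2 on the interval, so w is still positive at
    the new maximum, which therefore is not an endpoint.\<close>
  define e where "e = w y / (2 * C)"
  have e: "e > 0" using wy C by (simp add: e_def)
  define g where "g x = 1 * w x + e * \<psi> x" for x
  have e\<psi>: "e * \<psi> x \<le> w y / 2" if "x \<in> {\<alpha>..\<beta>}" for x
    using mult_left_mono[OF \<psi>C(2)[OF that], of e] e C by (simp add: e_def)
  have "continuous_on {\<alpha>..\<beta>} g"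
    unfolding g_def
    by (intro continuous_intros w(3) C2_on_continuous(1)[OF test_function_C2[OF \<psi>]])
  then obtain x0 where x0: "x0 \<in> {\<alpha>..\<beta>}" "\<And>x. x \<in> {\<alpha>..\<beta>} \<Longrightarrow> g x \<le> g x0"
    using continuous_attains_sup[of "{\<alpha>..\<beta>}" g] ab(3) by auto
  have gy: "w y < g x0"
    using x0(2)[OF y] mult_pos_pos[OF e \<psi>C(1)[OF y]] by (simp add: g_def)
  have "x0 \<noteq> \<alpha>" "x0 \<noteq> \<beta>" and wx0: "w x0 > 0"
    using gy e\<psi>[OF x0(1)] w(4,5) wy by (auto simp: g_def)
  then have x0': "\<alpha> < x0" "x0 < \<beta>" using x0(1) by auto
  have x0I: "x0 \<in> I" using x0(1) sub by auto
  have x0D: "x0 \<in> D" using x0I interior_D by auto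
  have "((\<lambda>t. 1 * ((base t w x0 - w x0) / t) + e * ((base t \<psi> x0 - \<psi> x0) / t)) \<longlongrightarrow>
      1 * (\<rho> * w x0) + e * diff_op b \<sigma> \<psi> x0) (at_right 0)"
    by (intro tendsto_intros lim x0' base_generator \<psi> x0I)
  moreover have "\<forall>\<^sub>F t in at_right 0. 1 * ((base t w x0 - w x0) / t) + e * ((base t \<psi> x0 - \<psi> x0) / t)
      = (base t g x0 - g x0) / t"
    unfolding eventually_at_right_field
  proof (intro exI[of _ 1] conjI allI impI)
    fix t :: real assume t: "0 < t" "t < 1"
    have "base t g x0 = 1 * base t w x0 + e * base t \<psi> x0"
      unfolding g_def by (rule base_lincomb[OF x0D _ w(1,2) test_function_DB[OF \<psi>] C']) (use t in auto)
    then show "1 * ((base t w x0 - w x0) / t) + e * ((base t \<psi> x0 - \<psi> x0) / t) = (base t g x0 - g x0) / t"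
      using t by (simp add: g_def field_simps)
  qed simp
  ultimately have lg: "((\<lambda>t. (base t g x0 - g x0) / t) \<longlongrightarrow> 1 * (\<rho> * w x0) + e * diff_op b \<sigma> \<psi> x0) (at_right 0)"
    by (rule Lim_transform_eventually)
  have "1 * (\<rho> * w x0) + e * diff_op b \<sigma> \<psi> x0 \<le> 0"
  proof (rule generator_local_max[OF x0I _ _ _ _ _ lg])
    show "g \<in> borel_measurable DB"
      unfolding g_def using w(1) test_function_DB[OF \<psi>] by measurable
    show "\<bar>g x\<bar> \<le> B + e * C'" if "x \<in> D" for x
    proof -
      have "\<bar>g x\<bar> \<le> \<bar>w x\<bar> + e * \<bar>\<psi> x\<bar>"
        using abs_triangle_ineq[of "w x" "e * \<psi> x"] e by (simp add: g_def abs_mult)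
      then show ?thesis using w(2)[OF that] mult_left_mono[OF C'[of x], of e] e by linarith
    qed
    show "0 < min (x0 - \<alpha>) (\<beta> - x0)" using x0' by simp
    show "g x \<le> g x0" if "\<bar>x - x0\<bar> < min (x0 - \<alpha>) (\<beta> - x0)" for x
      using that by (intro x0(2)) auto
    show "0 \<le> g x0" using gy wy by simp
  qed
  moreover have "0 \<le> \<rho> * w x0" "0 < e * diff_op b \<sigma> \<psi> x0"
    using \<rho> wx0 e \<psi>L[OF x0(1)] by auto
  ultimately show False by simp
qed

lemma nonneg_on_D:
  fixes h :: "real \<Rightarrow> real"
  assumes "continuous_on D h" "\<And>x. x \<in> I \<Longrightarrow> 0 \<le> h x" "x \<in> D"
  shows "0 \<le> h x"
  using continuous_le_on_interval[of D "\<lambda>_. 0" h x] state_space assms by simp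

end

subsection \<open>Eigenfunctions and driftless images\<close>

locale diffusion_with_solutions = regular_diffusion M F D b \<sigma> X \<zeta> \<theta> P
  for M :: "'w measure" and F D b \<sigma> X \<zeta> \<theta> P +
  fixes \<rho> :: real and \<phi>p \<phi>m :: "real \<Rightarrow> real"
  assumes \<rho>: "0 \<le> \<rho>" and pair: "fundamental_pair D b \<sigma> X \<zeta> P \<rho> \<phi>p \<phi>m"
begin

sublocale sol: fundamental_solutions I b \<sigma> \<rho> \<phi>p \<phi>m
proof
  show "mono_on I \<phi>p" "antimono_on I \<phi>m"
    using pair interior_D(4) by (auto simp: fundamental_pair_def intro: monotone_on_subset)
  show "\<alpha> = 0 \<and> \<beta> = 0" if "\<And>x. x \<in> I \<Longrightarrow> \<alpha> * \<phi>p x + \<beta> * \<phi>m x = 0" for \<alpha> \<beta>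
  proof -
    have "\<forall>\<alpha> \<beta>. (\<forall>x\<in>I. \<alpha> * \<phi>p x + \<beta> * \<phi>m x = 0) \<longrightarrow> \<alpha> = 0 \<and> \<beta> = 0"
      using pair unfolding fundamental_pair_def by blast
    then show ?thesis using that by blast
  qed
  show "C2_on I \<phi>p" "C2_on I \<phi>m" using pair unfolding fundamental_pair_def by blast+
  show "0 < \<phi>p x" "0 < \<phi>m x" "diff_op b \<sigma> \<phi>p x = \<rho> * \<phi>p x" "diff_op b \<sigma> \<phi>m x = \<rho> * \<phi>m x"
    if "x \<in> I" for x
    using pair that unfolding fundamental_pair_def by blast+
qed (use interior_D coefficients in auto)

lemma \<phi>_continuous: "continuous_on D \<phi>p" "continuous_on D \<phi>m"
  using pair unfolding fundamental_pair_def by blast+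

text \<open>Both h and the comparison solution are multiplied by a cutoff that is 1 near the
  interval. The products are bounded on D, as the maximum principle requires, and their difference
  is unchanged on the interval.\<close>

lemma no_killing_solution:
  assumes h: "continuous_on D h" "\<And>y. y \<in> I \<Longrightarrow> 0 < h y"
    and nk: "no_killing_on I (transition X \<zeta> (transformed_law F X \<zeta> P \<rho> h))"
    and ab: "\<alpha> \<in> I" "\<beta> \<in> I" "\<alpha> < \<beta>"
  shows "\<exists>c d. \<forall>x\<in>{\<alpha>..\<beta>}. h x = c * \<phi>p x + d * \<phi>m x"
proof -
  obtain c d where cd: "c * \<phi>p \<alpha> + d * \<phi>m \<alpha> = h \<alpha>" "c * \<phi>p \<beta> + d * \<phi>m \<beta> = h \<beta>"
    using sol.boundary_values[OF ab] by blast
  let ?v = "\<lambda>x. c * \<phi>p x + d * \<phi>m x"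
  obtain \<kappa> \<delta> where \<kappa>: "test_function I \<kappa>" "\<And>x. 0 \<le> \<kappa> x" "\<And>x. \<kappa> x \<le> 1" "\<delta> > 0"
    "{\<alpha> - \<delta><..<\<beta> + \<delta>} \<subseteq> I" "\<And>x. x \<in> {\<alpha> - \<delta><..<\<beta> + \<delta>} \<Longrightarrow> \<kappa> x = 1"
    using bump[OF interior_D(1,2) ab(1,2) less_imp_le[OF ab(3)]] by blast
  let ?U = "{\<alpha> - \<delta><..<\<beta> + \<delta>}"
  have sub: "{\<alpha>..\<beta>} \<subseteq> ?U" using \<kappa>(4) by auto
  have h0: "0 \<le> h y" if "y \<in> D" for y by (rule nonneg_on_D[OF h(1) less_imp_le[OF h(2)] that])
  have hI: "continuous_on I h" using h(1) interior_D(4) by (rule continuous_on_subset)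
  let ?f = "\<lambda>x. h x * \<kappa> x" and ?g = "\<lambda>x. ?v x * \<kappa> x"
  have fm: "?f \<in> borel_measurable DB"
    using borel_measurable_continuous_on_restrict[OF h(1)] test_function_DB[OF \<kappa>(1)] by measurable
  obtain A where A: "\<And>x. \<bar>?f x\<bar> \<le> A" using bounded_times_test_function[OF hI \<kappa>(1)] by blast
  have g: "test_function I ?g" by (rule test_function_mult[OF interior_D(1) sol.C2_lincomb \<kappa>(1)])
  obtain B where B: "\<And>x. \<bar>?g x\<bar> \<le> B" using test_function_bounded[OF g] by blast
  have limf: "((\<lambda>t. (base t ?f x - h x) / t) \<longlongrightarrow> \<rho> * h x) (at_right 0)" if "\<alpha> < x" "x < \<beta>" for x
    by (rule no_killing_limit[OF h(1) h0 h(2) nk \<kappa>(1), of ?U]) (use that \<kappa> in auto)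
  have limg: "((\<lambda>t. (base t ?g x - ?g x) / t) \<longlongrightarrow> \<rho> * ?v x) (at_right 0)" if "\<alpha> < x" "x < \<beta>" for x
  proof -
    have x: "x \<in> ?U" "x \<in> I" using that \<kappa>(4,5) by auto
    have "diff_op b \<sigma> ?g x = diff_op b \<sigma> ?v x"
      by (rule diff_op_cong[of ?U]) (use x \<kappa>(6) C2_on_subset[OF sol.C2_lincomb \<kappa>(5)] in auto)
    also have "\<dots> = \<rho> * ?v x" by (rule sol.diff_op_solution[OF x(2)])
    finally show ?thesis using base_generator[OF g x(2)] by simp
  qed
  \<comment> \<open>The sign p = 1 or p = -1 gives the two inequalities by one argument; the
    equation is linear.\<close>
  have le: "p * (h x - ?v x) \<le> 0" if x: "x \<in> {\<alpha>..\<beta>}" and p: "\<bar>p\<bar> = 1" for x p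
  proof -
    let ?w = "\<lambda>x. p * ?f x + (- p) * ?g x"
    have weq: "?w x = p * (h x - ?v x)" if "x \<in> ?U" for x
      using \<kappa>(6)[OF that] by (simp add: algebra_simps)
    have "?w x \<le> 0"
    proof (rule generator_maximum_principle[OF ab \<rho> _ _ _ _ _ _ x])
      show "?w \<in> borel_measurable DB"
        using fm test_function_DB[OF g] by measurable
      show "\<bar>?w y\<bar> \<le> A + B" for y
      proof -
        have "\<bar>?w y\<bar> \<le> \<bar>p\<bar> * \<bar>?f y\<bar> + \<bar>p\<bar> * \<bar>?g y\<bar>"
          using abs_triangle_ineq[of "p * ?f y" "(- p) * ?g y"] by (simp only: abs_mult abs_minus_cancel)
        then show ?thesis using A[of y] B[of y] p by simp
      qed
      have "continuous_on {\<alpha>..\<beta>} ?f"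
        using sub \<kappa>(5)
        by (intro continuous_on_mult continuous_on_subset[OF hI]
            C2_on_continuous(1)[OF test_function_C2[OF \<kappa>(1)]]) auto
      then show "continuous_on {\<alpha>..\<beta>} ?w"
        by (intro continuous_on_add continuous_on_mult[OF continuous_on_const]
            C2_on_continuous(1)[OF test_function_C2[OF g]])
      show "?w \<alpha> \<le> 0" "?w \<beta> \<le> 0"
        using weq[of \<alpha>] weq[of \<beta>] sub ab(3) cd by simp_all
      fix x assume x: "\<alpha> < x" "x < \<beta>"
      have xU: "x \<in> ?U" using x \<kappa>(4) by auto
      have xD: "x \<in> D" using xU \<kappa>(5) interior_D(4) by auto
      have "((\<lambda>t. p * ((base t ?f x - h x) / t) + (- p) * ((base t ?g x - ?g x) / t)) \<longlongrightarrow>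
          p * (\<rho> * h x) + (- p) * (\<rho> * ?v x)) (at_right 0)"
        by (intro tendsto_add tendsto_mult[OF tendsto_const] limf limg x)
      moreover have "p * (\<rho> * h x) + (- p) * (\<rho> * ?v x) = \<rho> * ?w x"
        using \<kappa>(6)[OF xU] by (simp add: algebra_simps)
      moreover have "\<forall>\<^sub>F t in at_right 0. p * ((base t ?f x - h x) / t) + (- p) * ((base t ?g x - ?g x) / t)
          = (base t ?w x - ?w x) / t"
        unfolding eventually_at_right_field
      proof (intro exI[of _ 1] conjI allI impI)
        fix t :: real assume t: "0 < t" "t < 1"
        have arith: "p * ((u - u') / t) + (- p) * ((v - v') / t) = (z - (p * u' + (- p) * v')) / t"
          if "z = p * u + (- p) * v" for u u' v v' z
          unfolding that using t(1) by (simp add: field_simps)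
        have eq: "base t ?w x = p * base t ?f x + (- p) * base t ?g x"
          by (rule base_lincomb[OF xD _ fm A test_function_DB[OF g] B]) (use t in auto)
        have "?w x = p * h x + (- p) * ?g x" using \<kappa>(6)[OF xU] by simp
        then show "p * ((base t ?f x - h x) / t) + (- p) * ((base t ?g x - ?g x) / t)
          = (base t ?w x - ?w x) / t"
          by (simp only: arith[OF eq])
      qed simp
      ultimately show "((\<lambda>t. (base t ?w x - ?w x) / t) \<longlongrightarrow> \<rho> * ?w x) (at_right 0)"
        using Lim_transform_eventually by force
    qed
    then show ?thesis using weq[of x] x sub by auto
  qed
  have "h x = ?v x" if "x \<in> {\<alpha>..\<beta>}" for x
    using le[OF that, of 1] le[OF that, of "-1"] by simp
  then show ?thesis by blast
qed

text \<open>The coefficients found on a compact interval might depend on it. Every point of I shares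
  an interval with the fixed reference interval [p, q], whose end values determine the coefficients;
  continuity then adds the endpoints of D.\<close>

lemma no_killing_lincomb:
  assumes h: "continuous_on D h" "\<And>y. y \<in> I \<Longrightarrow> 0 < h y"
    and nk: "no_killing_on I (transition X \<zeta> (transformed_law F X \<zeta> P \<rho> h))"
  shows "\<exists>c d. \<forall>x\<in>D. h x = c * \<phi>p x + d * \<phi>m x"
proof -
  obtain p where p: "p \<in> I" using interior_D(3) by auto
  then obtain e where e: "e > 0" "ball p e \<subseteq> I" using interior_D(1) open_contains_ball by blast
  define q where "q = p + e / 2"
  have q: "q \<in> I" "p < q" using e by (auto simp: q_def dist_real_def)
  obtain c d where cd: "\<And>x. x \<in> {p..q} \<Longrightarrow> h x = c * \<phi>p x + d * \<phi>m x"
    using no_killing_solution[OF h nk p q] by blast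
  have I: "h x = c * \<phi>p x + d * \<phi>m x" if x: "x \<in> I" for x
  proof -
    define \<alpha> \<beta> where "\<alpha> = min p x" and "\<beta> = max q x"
    have ab: "\<alpha> \<in> I" "\<beta> \<in> I" "\<alpha> < \<beta>" using p q x by (auto simp: \<alpha>_def \<beta>_def min_def max_def)
    obtain c' d' where cd': "\<And>x. x \<in> {\<alpha>..\<beta>} \<Longrightarrow> h x = c' * \<phi>p x + d' * \<phi>m x"
      using no_killing_solution[OF h nk ab] by blast
    have *: "p \<in> {\<alpha>..\<beta>}" "q \<in> {\<alpha>..\<beta>}" "x \<in> {\<alpha>..\<beta>}" "p \<in> {p..q}" "q \<in> {p..q}"
      using q(2) by (auto simp: \<alpha>_def \<beta>_def)
    have "c = c'" "d = d'"
      using sol.boundary_values_unique[OF p q, of c d c' d'] cd[OF *(4)] cd[OF *(5)] cd'[OF *(1)] cd'[OF *(2)]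
      by auto
    then show ?thesis using cd'[OF *(3)] by simp
  qed
  have cont: "continuous_on D (\<lambda>x. c * \<phi>p x + d * \<phi>m x)"
    by (intro continuous_intros \<phi>_continuous)
  have "h x = c * \<phi>p x + d * \<phi>m x" if "x \<in> D" for x
    by (rule order_antisym; rule continuous_le_on_interval[OF state_space _ _ _ that])
      (use h(1) cont I in auto)
  then show ?thesis by blast
qed

end

text \<open>A test function that is z - Y(x) near Y(x) has value 0, slope 1 and second derivative 0
  there. The unknown diffusion coefficient and killing rate of the image drop out and only the drift
  is left.\<close>

lemma image_drift_zero:
  assumes I: "open I" "is_interval I" "I \<noteq> {}" and Y: "diffeomorphism_on I Y"
    and T: "has_generator_on I T a s (\<lambda>_. 0)"
    and driftless: "driftless_on (Y ` I) (image_transition I Y T)" and x: "x \<in> I"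
  shows "diff_op a s Y x = 0"
proof -
  note YD = diffeomorphism_onD[OF I Y]
  have YI: "is_interval (Y ` I)"
    using connected_continuous_image[OF C2_on_continuous(1)[OF YD(1)]] I(2)
    by (simp add: is_interval_connected_1)
  obtain s' k where gen: "has_generator_on (Y ` I) (image_transition I Y T) (\<lambda>_. 0) s' k"
    using driftless by (auto simp: driftless_on_def)
  let ?y = "Y x"
  have y: "?y \<in> Y ` I" using x by simp
  obtain \<kappa> \<delta> where \<kappa>: "test_function (Y ` I) \<kappa>" "\<And>z. 0 \<le> \<kappa> z" "\<And>z. \<kappa> z \<le> 1"
    "\<delta> > 0" "{?y - \<delta><..<?y + \<delta>} \<subseteq> Y ` I" "\<And>z. z \<in> {?y - \<delta><..<?y + \<delta>} \<Longrightarrow> \<kappa> z = 1"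
    using bump[OF YD(4) YI y y order_refl] by blast
  let ?U = "{?y - \<delta><..<?y + \<delta>}"
  have yU: "?y \<in> ?U" using \<kappa>(4) by simp
  \<comment> \<open>The affine coordinate centred at \<open>?y\<close>, cut off to have compact
    support in the image.\<close>
  define g where "g z = (1 * z + (- ?y)) * \<kappa> z" for z
  have g: "test_function (Y ` I) g"
    unfolding g_def by (rule test_function_mult[OF YD(4) C2_on_affine[OF YD(4)] \<kappa>(1)])
  have U: "open ?U" by simp
  have 1: "((\<lambda>z. 1 * z + (- ?y)) has_real_derivative 1) (at z)" for z :: real
    by (auto intro!: derivative_eq_intros)
  have 2: "((\<lambda>_. 1) has_real_derivative 0) (at z)" for z :: real by simp
  have affine: "deriv (\<lambda>z. 1 * z + (- ?y)) ?y = 1" "deriv (deriv (\<lambda>z. 1 * z + (- ?y))) ?y = 0"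
    using C2_onI(2,3)[OF open_UNIV 1 2 continuous_on_const] by simp_all
  have "g z = 1 * z + (- ?y)" if "z \<in> ?U" for z
    using \<kappa>(6)[OF that] by (simp add: g_def)
  from C2_on_cong(2,3)[OF U C2_on_affine[OF U] this]
  have cong: "deriv g ?y = deriv (\<lambda>z. 1 * z + (- ?y)) ?y" "deriv (deriv g) ?y = deriv (deriv (\<lambda>z. 1 * z + (- ?y))) ?y"
    using yU by blast+
  have g0: "g ?y = 0" and g1: "deriv g ?y = 1" and g2: "deriv (deriv g) ?y = 0"
    unfolding cong affine by (simp_all add: g_def)
  have "((\<lambda>t. (image_transition I Y T t g ?y - g ?y) / t) \<longlongrightarrow> diff_op (\<lambda>_. 0) s' g ?y - k ?y * g ?y) (at_right 0)"
    using gen g y unfolding has_generator_on_def by blast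
  moreover have "((\<lambda>t. (image_transition I Y T t g ?y - g ?y) / t) \<longlongrightarrow>
    diff_op a s Y x * deriv g ?y + (s x * deriv Y x)\<^sup>2 / 2 * deriv (deriv g) ?y - 0 * g ?y) (at_right 0)"
    by (rule image_generator_limit[OF I Y T g x])
  ultimately have "diff_op (\<lambda>_. 0) s' g ?y - k ?y * g ?y =
    diff_op a s Y x * deriv g ?y + (s x * deriv Y x)\<^sup>2 / 2 * deriv (deriv g) ?y - 0 * g ?y"
    by (intro tendsto_unique[of "at_right (0::real)"]) auto
  then show ?thesis by (simp add: g0 g1 g2 diff_op_def)
qed

lemma image_driftless:
  assumes I: "open I" "is_interval I" "I \<noteq> {}" and Y: "diffeomorphism_on I Y"
    and T: "has_generator_on I T a s (\<lambda>_. 0)" and 0: "\<And>x. x \<in> I \<Longrightarrow> diff_op a s Y x = 0"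
  shows "driftless_on (Y ` I) (image_transition I Y T)"
proof -
  have inj: "inj_on Y I" using diffeomorphism_onD[OF I Y] by simp
  \<comment> \<open>The image has diffusion coefficient s Y' read in the new coordinate. Its sign is
    immaterial, since the operator contains only its square.\<close>
  have "has_generator_on (Y ` I) (image_transition I Y T) (\<lambda>_. 0)
     (\<lambda>y. s (inv_into I Y y) * deriv Y (inv_into I Y y)) (\<lambda>_. 0)"
    unfolding has_generator_on_def
  proof (intro allI impI ballI)
    fix g y assume g: "test_function (Y ` I) g" and "y \<in> Y ` I"
    then obtain x where x: "x \<in> I" "y = Y x" by auto
    show "((\<lambda>t. (image_transition I Y T t g y - g y) / t) \<longlongrightarrow>
      diff_op (\<lambda>_. 0) (\<lambda>y. s (inv_into I Y y) * deriv Y (inv_into I Y y)) g y - 0 * g y) (at_right 0)"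
      using image_generator_limit[OF I Y T g x(1)] 0[OF x(1)] inj x by (simp add: diff_op_def)
  qed
  then show ?thesis by (auto simp: driftless_on_def)
qed

section \<open>Driftless images and linear combinations of the solutions\<close>

context diffusion_with_solutions
begin

abbreviation "transformed h \<equiv> transition X \<zeta> (transformed_law F X \<zeta> P \<rho> h)"
abbreviation "transformed_drift h x \<equiv> b x + (\<sigma> x)\<^sup>2 * deriv h x / h x"

lemma lincomb_C2:
  assumes "\<And>x. x \<in> I \<Longrightarrow> h x = c * \<phi>p x + d * \<phi>m x"
  shows "C2_on I h" "x \<in> I \<Longrightarrow> diff_op b \<sigma> h x = \<rho> * h x"
proof -
  show "C2_on I h" by (rule C2_on_cong(1)[OF interior_D(1) sol.C2_lincomb assms])
  show "diff_op b \<sigma> h x = \<rho> * h x" if "x \<in> I"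
    using diff_op_cong[OF interior_D(1) that sol.C2_lincomb assms] sol.diff_op_solution[OF that] assms[OF that]
    by simp
qed

lemma transformed_generator_lincomb:
  assumes h: "continuous_on D h" "\<And>x. x \<in> I \<Longrightarrow> 0 < h x" "\<And>x. x \<in> I \<Longrightarrow> h x = c * \<phi>p x + d * \<phi>m x"
  shows "has_generator_on I (transformed h) (transformed_drift h) \<sigma> (\<lambda>_. 0)"
  by (rule transformed_generator[OF h(1) nonneg_on_D[OF h(1) less_imp_le[OF h(2)]] h(2) lincomb_C2[OF h(3)]])

lemma drift_iff:
  assumes h: "\<And>x. x \<in> I \<Longrightarrow> 0 < h x" "\<And>x. x \<in> I \<Longrightarrow> h x = c * \<phi>p x + d * \<phi>m x"
    and Y: "C2_on I Y" and x: "x \<in> I"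
  shows "diff_op (transformed_drift h) \<sigma> Y x = 0 \<longleftrightarrow>
    diff_op b \<sigma> (\<lambda>x. h x * Y x) x = \<rho> * (h x * Y x)"
proof -
  have "h x \<noteq> 0" using h(1)[OF x] by simp
  from diff_op_transform[OF interior_D(1) lincomb_C2(1)[OF h(2)] Y x lincomb_C2(2)[OF h(2) x] this] this
  show ?thesis by auto
qed

lemma driftless_lincomb:
  assumes h: "continuous_on D h" "\<And>x. x \<in> I \<Longrightarrow> 0 < h x" "\<And>x. x \<in> I \<Longrightarrow> h x = c * \<phi>p x + d * \<phi>m x"
    and Y: "diffeomorphism_on I Y" "driftless_on (Y ` I) (image_transition I Y (transformed h))"
  shows "\<exists>c' d'. \<forall>x\<in>I. h x * Y x = c' * \<phi>p x + d' * \<phi>m x"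
proof -
  note gen = transformed_generator_lincomb[OF h]
  have C2: "C2_on I Y" using diffeomorphism_onD[OF interior_D(1-3) Y(1)] by simp
  show ?thesis
  proof (rule sol.solution_lincomb)
    show "C2_on I (\<lambda>x. h x * Y x)"
      by (rule C2_on_mult(1)[OF interior_D(1) lincomb_C2(1)[OF h(3)] C2])
    show "diff_op b \<sigma> (\<lambda>x. h x * Y x) x = \<rho> * (h x * Y x)" if "x \<in> I" for x
      using drift_iff[OF h(2,3) C2 that] image_drift_zero[OF interior_D(1-3) Y(1) gen Y(2) that] by simp
  qed
qed

lemma lincomb_driftless:
  assumes h: "continuous_on D h" "\<And>x. x \<in> I \<Longrightarrow> 0 < h x" "\<And>x. x \<in> I \<Longrightarrow> h x = c * \<phi>p x + d * \<phi>m x"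
    and Y: "diffeomorphism_on I Y" "\<And>x. x \<in> I \<Longrightarrow> h x * Y x = c' * \<phi>p x + d' * \<phi>m x"
  shows "driftless_on (Y ` I) (image_transition I Y (transformed h))"
proof (rule image_driftless[OF interior_D(1-3) Y(1) transformed_generator_lincomb[OF h]])
  have C2: "C2_on I Y" using diffeomorphism_onD[OF interior_D(1-3) Y(1)] by simp
  show "diff_op (transformed_drift h) \<sigma> Y x = 0" if "x \<in> I" for x
    using drift_iff[OF h(2,3) C2 that] lincomb_C2(2)[OF Y(2) that] by simp
qed

text \<open>With determinant zero the numerator and denominator of Y are linearly dependent.
  Cross-multiplying at two points gives equal values of Y without a case distinction on vanishing
  coefficients.\<close>

lemma injective_quotient_det:
  assumes h: "\<And>x. x \<in> I \<Longrightarrow> 0 < h x" "\<And>x. x \<in> I \<Longrightarrow> h x = c * \<phi>p x + d * \<phi>m x"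
    and Y: "inj_on Y I" "\<And>x. x \<in> I \<Longrightarrow> h x * Y x = c' * \<phi>p x + d' * \<phi>m x"
  shows "c * d' - d * c' \<noteq> 0"
proof
  assume det: "c * d' - d * c' = 0"
  obtain p where p: "p \<in> I" using interior_D(3) by auto
  then obtain e where e: "e > 0" "ball p e \<subseteq> I" using interior_D(1) open_contains_ball by blast
  define q where "q = p + e / 2"
  have q: "q \<in> I" "p \<noteq> q" using e by (auto simp: q_def dist_real_def)
  have "(c' * \<phi>p p + d' * \<phi>m p) * (c * \<phi>p q + d * \<phi>m q) = (c' * \<phi>p q + d' * \<phi>m q) * (c * \<phi>p p + d * \<phi>m p)"
    using det by algebra
  then have "h p * Y p * h q = h q * Y q * h p" using h(2) Y(2) p q(1) by simp
  then have "Y p = Y q" using h(1)[OF p] h(1)[OF q(1)] by simp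
  then show False using Y(1) p q by (simp add: inj_on_def)
qed

end

subsection \<open>Hitting times and optional stopping\<close>

context regular_diffusion
begin

lemma path_continuous_on:
  assumes "\<omega> \<in> space M" "ereal q < \<zeta> \<omega>"
  shows "continuous_on {0..q} (\<lambda>t. X t \<omega>)"
proof (rule continuous_on_subset[OF continuous_paths[OF assms(1)]], safe)
  fix t assume "t \<in> {0..q}"
  then show "0 \<le> t" "ereal t < \<zeta> \<omega>"
    using le_less_trans[of "ereal t" "ereal q" "\<zeta> \<omega>"] assms(2) by auto
qed

abbreviation "H \<equiv> hitting_time X \<zeta>"

lemma hitting_time_le:
  assumes "0 \<le> t" "ereal t < \<zeta> \<omega>" "X t \<omega> = z"
  shows "H z \<omega> \<le> ereal t"
  unfolding hitting_time_def using assms by (intro Inf_lower) auto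

text \<open>The set of visits to z need not be closed, because the path may end at its lifetime. Any
  one visit q bounds a compact interval of survival, on which continuity yields a first
  visit.\<close>

lemma hitting_time_attained:
  assumes \<omega>: "\<omega> \<in> space M" and fin: "H z \<omega> < \<infinity>"
  obtains s where "0 \<le> s" "ereal s < \<zeta> \<omega>" "X s \<omega> = z" "H z \<omega> = ereal s"
proof -
  let ?A = "{t. 0 \<le> t \<and> ereal t < \<zeta> \<omega> \<and> X t \<omega> = z}"
  have "?A \<noteq> {}"
  proof
    assume "?A = {}"
    then have "H z \<omega> = Inf (ereal ` {})" unfolding hitting_time_def by (rule arg_cong)
    then show False using fin by (simp add: top_ereal_def)
  qed
  then obtain q where q: "q \<in> ?A" by blast
  let ?B = "{t \<in> {0..q}. X t \<omega> = z}"
  have "closed ?B"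
    using q by (intro continuous_closed_preimage_constant path_continuous_on[OF \<omega>]) auto
  then have "compact ({0..q} \<inter> ?B)" by (intro compact_Int_closed) auto
  moreover have "{0..q} \<inter> ?B \<noteq> {}" using q by auto
  ultimately have "\<exists>s\<in>{0..q} \<inter> ?B. \<forall>t\<in>{0..q} \<inter> ?B. s \<le> t" by (rule compact_attains_inf)
  then obtain s where s: "s \<in> {0..q} \<inter> ?B" "\<And>t. t \<in> {0..q} \<inter> ?B \<Longrightarrow> s \<le> t" by blast
  have sA: "s \<in> ?A" using s(1) q le_less_trans[of "ereal s" "ereal q" "\<zeta> \<omega>"] by auto
  have le: "s \<le> t" if "t \<in> ?A" for t
    using s(2)[of t] s(1) that by (cases "t \<le> q") auto
  have "ereal s \<le> H z \<omega>"
    unfolding hitting_time_def by (rule Inf_greatest) (use le in auto)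
  then have "H z \<omega> = ereal s" using hitting_time_le[of s \<omega> z] sA by (intro order_antisym) auto
  then show ?thesis using that[of s] sA by simp
qed

lemma hitting_time_le_iff:
  assumes "\<omega> \<in> space M"
  shows "H z \<omega> \<le> ereal t \<longleftrightarrow> (\<exists>s. 0 \<le> s \<and> s \<le> t \<and> ereal s < \<zeta> \<omega> \<and> X s \<omega> = z)"
proof
  assume le: "H z \<omega> \<le> ereal t"
  then have "H z \<omega> < \<infinity>" by (rule le_less_trans) simp
  then obtain s where s: "0 \<le> s" "ereal s < \<zeta> \<omega>" "X s \<omega> = z" "H z \<omega> = ereal s"
    by (rule hitting_time_attained[OF assms])
  then show "\<exists>s. 0 \<le> s \<and> s \<le> t \<and> ereal s < \<zeta> \<omega> \<and> X s \<omega> = z" using le by auto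
next
  assume "\<exists>s. 0 \<le> s \<and> s \<le> t \<and> ereal s < \<zeta> \<omega> \<and> X s \<omega> = z"
  then obtain s where s: "0 \<le> s" "s \<le> t" "ereal s < \<zeta> \<omega>" "X s \<omega> = z" by blast
  from hitting_time_le[OF s(1,3,4)] have "H z \<omega> \<le> ereal s" .
  also have "\<dots> \<le> ereal t" using s(2) by simp
  finally show "H z \<omega> \<le> ereal t" .
qed

lemma hitting_time_nonneg: "0 \<le> H z \<omega>"
  unfolding hitting_time_def by (rule Inf_greatest) auto

text \<open>The \<open>\<sigma>\<close>-algebras of the filtration are not completed, so \<open>{H z \<le> t}\<close> has to be written with
  countably many times. The endpoint \<open>t\<close> may be irrational and is needed for paths that first hit at time \<open>t\<close>.\<close>

definition skeleton :: "real \<Rightarrow> real set" where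
  "skeleton t = insert t ({q \<in> \<rat>. 0 \<le> q \<and> q \<le> t})"

lemma countable_skeleton: "countable (skeleton t)"
  unfolding skeleton_def using countable_rat by (auto intro: countable_subset)

lemma skeleton_le: "q \<in> skeleton t \<Longrightarrow> 0 \<le> t \<Longrightarrow> 0 \<le> q \<and> q \<le> t"
  by (auto simp: skeleton_def)

lemma skeleton_dense:
  assumes "0 \<le> s" "s \<le> q" "e > 0"
  obtains r where "r \<in> skeleton q" "s \<le> r" "r < s + e"
proof (cases "s = q")
  case True
  then show ?thesis using that[of q] assms by (auto simp: skeleton_def)
next
  case False
  then have "s < min q (s + e)" using assms by auto
  then obtain r where "r \<in> \<rat>" "s < r" "r < min q (s + e)" using Rats_dense_in_real by blast
  then show ?thesis using that[of r] assms(1) by (auto simp: skeleton_def)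
qed

text \<open>The time q certifies survival, so the path is continuous on the compact interval [0, q]
  and arbitrarily close approaches to z at times r force a visit. Approaching z only as the lifetime
  is reached is thereby excluded.\<close>

lemma hitting_time_le_skeleton:
  assumes \<omega>: "\<omega> \<in> space M" and t: "0 \<le> t"
  shows "H z \<omega> \<le> ereal t \<longleftrightarrow>
    (\<exists>q\<in>skeleton t. ereal q < \<zeta> \<omega> \<and> (\<forall>n::nat. \<exists>r\<in>skeleton q. \<bar>X r \<omega> - z\<bar> < 1 / real (Suc n)))"
  unfolding hitting_time_le_iff[OF \<omega>]
proof
  assume "\<exists>s. 0 \<le> s \<and> s \<le> t \<and> ereal s < \<zeta> \<omega> \<and> X s \<omega> = z"
  then obtain s where s: "0 \<le> s" "s \<le> t" "ereal s < \<zeta> \<omega>" "X s \<omega> = z" by blast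
  \<comment> \<open>The visit s itself need not belong to the countable set, so a slightly later
    time q must still precede the lifetime.\<close>
  obtain e where e: "e > 0" "ereal (s + e) \<le> \<zeta> \<omega>"
  proof -
    obtain u where "ereal s < ereal u" "ereal u < \<zeta> \<omega>" using s(3) ereal_dense2 by blast
    then show ?thesis using that[of "u - s"] by auto
  qed
  obtain q where q: "q \<in> skeleton t" "s \<le> q" "q < s + e"
    using skeleton_dense[OF s(1,2) e(1)] by blast
  have q\<zeta>: "ereal q < \<zeta> \<omega>" using q(3) e(2) less_le_trans[of "ereal q" "ereal (s + e)"] by simp
  have "\<exists>r\<in>skeleton q. \<bar>X r \<omega> - z\<bar> < 1 / real (Suc n)" for n
  proof -
    have "s \<in> {0..q}" "0 < 1 / real (Suc n)" using s(1) q(2) by auto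
    then have "\<exists>d>0. \<forall>r\<in>{0..q}. dist r s < d \<longrightarrow> dist (X r \<omega>) (X s \<omega>) < 1 / real (Suc n)"
      using iffD1[OF continuous_on_iff path_continuous_on[OF \<omega> q\<zeta>]] by blast
    then obtain d where d: "d > 0" "\<And>r. r \<in> {0..q} \<Longrightarrow> dist r s < d \<Longrightarrow> dist (X r \<omega>) (X s \<omega>) < 1 / real (Suc n)"
      by blast
    obtain r where r: "r \<in> skeleton q" "s \<le> r" "r < s + d"
      using skeleton_dense[OF s(1) q(2) d(1)] by blast
    have "\<bar>X r \<omega> - z\<bar> < 1 / real (Suc n)"
      using d(2)[of r] r skeleton_le[OF r(1)] s(1,4) q(2) by (auto simp: dist_real_def)
    then show ?thesis using r(1) by blast
  qed
  then show "\<exists>q\<in>skeleton t. ereal q < \<zeta> \<omega> \<and> (\<forall>n::nat. \<exists>r\<in>skeleton q. \<bar>X r \<omega> - z\<bar> < 1 / real (Suc n))"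
    using q(1) q\<zeta> by blast
next
  assume "\<exists>q\<in>skeleton t. ereal q < \<zeta> \<omega> \<and> (\<forall>n::nat. \<exists>r\<in>skeleton q. \<bar>X r \<omega> - z\<bar> < 1 / real (Suc n))"
  then obtain q where q: "q \<in> skeleton t" "ereal q < \<zeta> \<omega>"
    and near: "\<And>n::nat. \<exists>r\<in>skeleton q. \<bar>X r \<omega> - z\<bar> < 1 / real (Suc n)" by blast
  have q0: "0 \<le> q" "q \<le> t" using skeleton_le[OF q(1) t] by auto
  have "continuous_on {0..q} (\<lambda>r. \<bar>X r \<omega> - z\<bar>)"
    by (intro continuous_intros path_continuous_on \<omega> q)
  then obtain s where s: "s \<in> {0..q}" "\<And>r. r \<in> {0..q} \<Longrightarrow> \<bar>X s \<omega> - z\<bar> \<le> \<bar>X r \<omega> - z\<bar>"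
    using continuous_attains_inf[of "{0..q}" "\<lambda>r. \<bar>X r \<omega> - z\<bar>"] q0 by auto
  have "X s \<omega> = z"
  proof (rule ccontr)
    assume "X s \<omega> \<noteq> z"
    then have "0 < \<bar>X s \<omega> - z\<bar>" by simp
    then obtain n where n: "1 / real (Suc n) < \<bar>X s \<omega> - z\<bar>" using nat_approx_posE by blast
    obtain r where "r \<in> skeleton q" "\<bar>X r \<omega> - z\<bar> < 1 / real (Suc n)" using near by blast
    then show False using s(2)[of r] skeleton_le[of r q] q0 n by fastforce
  qed
  then show "\<exists>s. 0 \<le> s \<and> s \<le> t \<and> ereal s < \<zeta> \<omega> \<and> X s \<omega> = z"
    using s(1) q0 q(2) le_less_trans[of "ereal s" "ereal q" "\<zeta> \<omega>"] by (intro exI[of _ s]) auto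
qed

lemma F_mono_sets: "A \<in> sets (F s) \<Longrightarrow> s \<le> t \<Longrightarrow> A \<in> sets (F t)"
  using sets_F_mono by blast

lemma hitting_time_measurable_F:
  assumes t: "0 \<le> t"
  shows "{\<omega> \<in> space M. H z \<omega> \<le> ereal t} \<in> sets (F t)"
proof -
  have "{\<omega> \<in> space (F t). \<exists>q\<in>skeleton t. ereal q < \<zeta> \<omega> \<and>
      (\<forall>n::nat. \<exists>r\<in>skeleton q. \<bar>X r \<omega> - z\<bar> < 1 / real (Suc n))} \<in> sets (F t)"
  proof (intro sets.sets_Collect_countable_Ex' sets.sets_Collect_conj sets.sets_Collect_countable_All
      countable_skeleton)
    fix q assume q: "q \<in> skeleton t"
    then have q0: "0 \<le> q" "q \<le> t" using skeleton_le[OF q t] by auto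
    have "{\<omega> \<in> space (F q). ereal q < \<zeta> \<omega>} \<in> sets (F q)"
      using adapted(2)[OF q0(1)] by (simp add: pred_def)
    from F_mono_sets[OF this q0(2)]
    show "{\<omega> \<in> space (F t). ereal q < \<zeta> \<omega>} \<in> sets (F t)" by (simp add: space_F)
    fix n :: nat and r assume "r \<in> skeleton q"
    then have r0: "0 \<le> r" "r \<le> t" using skeleton_le[of r q] q0 by auto
    have [measurable]: "X r \<in> borel_measurable (F r)" by (rule adapted(1)[OF r0(1)])
    have "{\<omega> \<in> space (F r). \<bar>X r \<omega> - z\<bar> < 1 / real (Suc n)} \<in> sets (F r)" by measurable
    from F_mono_sets[OF this r0(2)]
    show "{\<omega> \<in> space (F t). \<bar>X r \<omega> - z\<bar> < 1 / real (Suc n)} \<in> sets (F t)" by (simp add: space_F)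
  qed
  also have "{\<omega> \<in> space (F t). \<exists>q\<in>skeleton t. ereal q < \<zeta> \<omega> \<and>
      (\<forall>n::nat. \<exists>r\<in>skeleton q. \<bar>X r \<omega> - z\<bar> < 1 / real (Suc n))} = {\<omega> \<in> space M. H z \<omega> \<le> ereal t}"
    using hitting_time_le_skeleton[OF _ t] by (auto simp: space_F)
  finally show ?thesis .
qed

lemma F_subset_M: "A \<in> sets (F t) \<Longrightarrow> A \<in> sets M"
  using subalgebras[of t] by (auto simp: subalgebra_def)

lemma hitting_time_measurable: "H z \<in> borel_measurable M"
proof (rule borel_measurableI_le)
  fix y :: ereal
  show "{\<omega> \<in> space M. H z \<omega> \<le> y} \<in> sets M"
  proof (cases y)
    case (real t)
    show ?thesis
    proof (cases "0 \<le> t")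
      case True
      then show ?thesis using F_subset_M[OF hitting_time_measurable_F[OF True]] real by simp
    next
      case False
      then have "\<not> H z \<omega> \<le> y" for \<omega>
        using hitting_time_nonneg[of z \<omega>] real by (metis ereal_less_eq(5) order_trans)
      then show ?thesis by simp
    qed
  next
    case MInf
    then have "\<not> H z \<omega> \<le> y" for \<omega> using hitting_time_nonneg[of z \<omega>] by auto
    then show ?thesis by simp
  qed simp
qed

definition hitting_discount :: "real \<Rightarrow> real \<Rightarrow> 'w \<Rightarrow> real" where
  "hitting_discount \<rho> z \<omega> = (if H z \<omega> = \<infinity> then 0 else exp (- \<rho> * real_of_ereal (H z \<omega>)))"

lemma hitting_discount_measurable: "hitting_discount \<rho> z \<in> borel_measurable M"
proof -
  have [measurable]: "H z \<in> borel_measurable M" by (rule hitting_time_measurable)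
  show ?thesis unfolding hitting_discount_def by measurable
qed

lemma hitting_discount_nonneg: "0 \<le> hitting_discount \<rho> z \<omega>"
  by (simp add: hitting_discount_def)

lemma hitting_discount_le_1: "0 \<le> \<rho> \<Longrightarrow> hitting_discount \<rho> z \<omega> \<le> 1"
  using hitting_time_nonneg[of z \<omega>] by (auto simp: hitting_discount_def real_of_ereal_pos)

lemma nn_integral_hitting_discount:
  assumes "x \<in> D" "0 \<le> \<rho>" "0 \<le> c"
  shows "(\<integral>\<^sup>+\<omega>. ennreal (c * hitting_discount \<rho> z \<omega>) \<partial>P x) = ennreal (c * hitting_laplace X \<zeta> P \<rho> z x)"
proof -
  interpret prob_space "P x" by (rule law[OF assms(1)])
  have "hitting_discount \<rho> z \<in> borel_measurable (P x)"
    using hitting_discount_measurable law(2)[OF assms(1)] by (simp cong: measurable_cong_sets)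
  then have int: "integrable (P x) (hitting_discount \<rho> z)"
    using hitting_discount_le_1[OF assms(2)] hitting_discount_nonneg
    by (intro integrable_const_bound[of _ 1] AE_I2) auto
  have "(\<integral>\<^sup>+\<omega>. ennreal (c * hitting_discount \<rho> z \<omega>) \<partial>P x) = ennreal (\<integral>\<omega>. c * hitting_discount \<rho> z \<omega> \<partial>P x)"
    using int hitting_discount_nonneg assms(3) by (intro nn_integral_eq_integral) auto
  also have "(\<integral>\<omega>. c * hitting_discount \<rho> z \<omega> \<partial>P x) = c * hitting_laplace X \<zeta> P \<rho> z x"
    by (simp add: hitting_laplace_def hitting_discount_def)
  finally show ?thesis .
qed

lemma markov:
  fixes G :: "'w \<Rightarrow> ennreal"
  assumes "x \<in> D" "0 \<le> t" "A \<in> sets (F t)" "G \<in> borel_measurable M"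
  shows "(\<integral>\<^sup>+\<omega>. (if \<omega> \<in> A \<and> ereal t < \<zeta> \<omega> then G (\<theta> t \<omega>) else 0) \<partial>P x) =
    (\<integral>\<^sup>+\<omega>. (if \<omega> \<in> A \<and> ereal t < \<zeta> \<omega> then (\<integral>\<^sup>+\<omega>'. G \<omega>' \<partial>P (X t \<omega>)) else 0) \<partial>P x)"
proof -
  have "A \<in> sets (pre_sigma (\<lambda>_. t))"
  proof (rule sets_pre_sigmaI[OF stopping_time_const])
    show "{\<omega> \<in> A. t \<le> s} \<in> sets (F s)" for s
      using F_mono_sets[OF assms(3), of s] by (cases "t \<le> s") auto
  qed
  from strong_markov[OF assms(1) stopping_time_const _ this assms(4)] assms(2) show ?thesis by simp
qed

text \<open>A visit after time t is a visit, so H z is at most t plus the hitting time of the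
  shifted path. Equality fails for paths that visit z before t.\<close>

lemma hitting_discount_shift:
  assumes "\<omega> \<in> space M" "0 \<le> t" "ereal t < \<zeta> \<omega>" "0 \<le> \<rho>"
  shows "exp (- \<rho> * t) * hitting_discount \<rho> z (\<theta> t \<omega>) \<le> hitting_discount \<rho> z \<omega>"
proof (cases "H z (\<theta> t \<omega>) = \<infinity>")
  case True
  then show ?thesis using hitting_discount_nonneg by (simp add: hitting_discount_def)
next
  case False
  have \<theta>: "\<theta> t \<omega> \<in> space M" using measurable_space[OF shift_measurable[OF assms(2)] assms(1)] .
  obtain s where s: "0 \<le> s" "ereal s < \<zeta> (\<theta> t \<omega>)" "X s (\<theta> t \<omega>) = z" "H z (\<theta> t \<omega>) = ereal s"
    using hitting_time_attained[OF \<theta>] False by (metis ereal_infty_less(1))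
  note sh = shift[OF assms(1-3)]
  have ts: "ereal (t + s) < \<zeta> \<omega>" using s(2) sh by (cases "\<zeta> \<omega>") auto
  moreover have "X (t + s) \<omega> = z" using sh s(1,3) ts by auto
  ultimately have le: "H z \<omega> \<le> ereal (t + s)" using hitting_time_le[of "t + s" \<omega> z] assms(2) s(1) by simp
  then obtain u where u: "H z \<omega> = ereal u" "u \<le> t + s"
    using hitting_time_nonneg[of z \<omega>] by (cases "H z \<omega>") auto
  have "exp (- \<rho> * t) * hitting_discount \<rho> z (\<theta> t \<omega>) = exp (- \<rho> * (t + s))"
    by (simp add: hitting_discount_def s(4) exp_add[symmetric] algebra_simps)
  also have "\<dots> \<le> exp (- \<rho> * u)" using u(2) assms(4) by (simp add: mult_left_mono)
  finally show ?thesis by (simp add: hitting_discount_def u(1))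
qed

text \<open>The Markov property turns the left side into the expectation of the discount for the
  first visit after t, and \<open>hitting_discount_shift\<close> compares it with the first visit
  overall. The factor c stands for a value of \<phi> at z.\<close>

lemma hitting_laplace_excessive:
  assumes "x \<in> D" "0 \<le> t" "0 \<le> \<rho>" "0 \<le> c"
  shows "(\<integral>\<^sup>+\<omega>. (if ereal t < \<zeta> \<omega> then ennreal (c * exp (- \<rho> * t) * hitting_laplace X \<zeta> P \<rho> z (X t \<omega>)) else 0) \<partial>P x)
    \<le> ennreal (c * hitting_laplace X \<zeta> P \<rho> z x)"
proof -
  let ?G = "\<lambda>\<omega>. ennreal (c * exp (- \<rho> * t) * hitting_discount \<rho> z \<omega>)"
  have sp: "space (P x) = space M" by (rule law[OF assms(1)])
  have "(\<integral>\<^sup>+\<omega>. (if ereal t < \<zeta> \<omega> then ennreal (c * exp (- \<rho> * t) * hitting_laplace X \<zeta> P \<rho> z (X t \<omega>)) else 0) \<partial>P x) =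
    (\<integral>\<^sup>+\<omega>. (if \<omega> \<in> space M \<and> ereal t < \<zeta> \<omega> then (\<integral>\<^sup>+\<omega>'. ?G \<omega>' \<partial>P (X t \<omega>)) else 0) \<partial>P x)"
    using assms in_state_space[OF _ assms(2)]
    by (intro nn_integral_cong) (simp add: sp nn_integral_hitting_discount)
  also have "\<dots> = (\<integral>\<^sup>+\<omega>. (if \<omega> \<in> space M \<and> ereal t < \<zeta> \<omega> then ?G (\<theta> t \<omega>) else 0) \<partial>P x)"
    using hitting_discount_measurable sets.top[of "F t"]
    by (intro markov[symmetric] assms) (auto simp: space_F)
  also have "\<dots> \<le> (\<integral>\<^sup>+\<omega>. ennreal (c * hitting_discount \<rho> z \<omega>) \<partial>P x)"
  proof (rule nn_integral_mono)
    fix \<omega> assume \<omega>: "\<omega> \<in> space (P x)"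
    show "(if \<omega> \<in> space M \<and> ereal t < \<zeta> \<omega> then ?G (\<theta> t \<omega>) else 0) \<le> ennreal (c * hitting_discount \<rho> z \<omega>)"
      using mult_left_mono[OF hitting_discount_shift[OF _ assms(2) _ assms(3), of \<omega> z] assms(4)]
      by (auto simp: mult.assoc intro!: ennreal_leI)
  qed
  also have "\<dots> = ennreal (c * hitting_laplace X \<zeta> P \<rho> z x)"
    by (rule nn_integral_hitting_discount[OF assms(1,3,4)])
  finally show ?thesis .
qed

end

text \<open>A largest element of D has to be reached and not just approached, hence the case
  distinction; the supremum in the extended reals covers unbounded D.\<close>

lemma exhausting_sequence:
  fixes D :: "real set"
  assumes "x \<in> D"
  obtains u :: "nat \<Rightarrow> real" where "incseq u" "\<And>n. u n \<in> D" "x \<le> u 0" "\<And>y. y \<in> D \<Longrightarrow> \<exists>n. y \<le> u n"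
proof -
  let ?D = "{y \<in> D. x \<le> y}"
  obtain f :: "nat \<Rightarrow> ereal" where f: "incseq f" "range f \<subseteq> ereal ` ?D" "Sup (ereal ` ?D) = (SUP n. f n)"
    using Sup_countable_SUP[of "ereal ` ?D"] assms by auto
  show ?thesis
  proof (cases "Sup (ereal ` ?D) \<in> ereal ` ?D")
    case True
    then obtain m where m: "m \<in> D" "x \<le> m" "Sup (ereal ` ?D) = ereal m" by auto
    have "y \<le> m" if "y \<in> D" for y
    proof (cases "x \<le> y")
      case True
      then have "ereal y \<le> Sup (ereal ` ?D)" using that by (intro Sup_upper) auto
      then show ?thesis using m by simp
    qed (use m in simp)
    then show ?thesis using that[of "\<lambda>_. m"] m by (auto simp: incseq_def)
  next
    case False
    define u where "u n = real_of_ereal (f n)" for n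
    have u: "f n = ereal (u n)" "u n \<in> ?D" for n
    proof -
      have "f n \<in> ereal ` ?D" using f(2) by blast
      then show "f n = ereal (u n)" "u n \<in> ?D" by (auto simp: u_def)
    qed
    show ?thesis
    proof (rule that[of u])
      show "incseq u" using f(1) by (simp add: incseq_def u(1))
      show "\<exists>n. y \<le> u n" if "y \<in> D" for y
      proof (cases "x \<le> y")
        case True
        then have "ereal y \<in> ereal ` ?D" using that by simp
        then have "ereal y < Sup (ereal ` ?D)"
          using False Sup_upper[of "ereal y"] by (metis order.not_eq_order_implies_strict)
        then obtain n where "ereal y < f n" unfolding f(3) less_SUP_iff by blast
        then show ?thesis by (intro exI[of _ n]) (simp add: u(1))
      next
        case False
        then show ?thesis using u(2)[of 0] by (intro exI[of _ 0]) auto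
      qed
    qed (use u(2) in auto)
  qed
qed

section \<open>Functions with the discounted supermartingale property\<close>

context regular_diffusion
begin

text \<open>For nonnegative h these are the \<rho>-supermedian functions of potential theory; the
  inequality is the mass condition of the measure change.\<close>

definition excessive :: "real \<Rightarrow> (real \<Rightarrow> real) \<Rightarrow> bool" where
  "excessive \<rho> h \<longleftrightarrow> (\<forall>x\<in>D. \<forall>t\<ge>0.
     (\<integral>\<^sup>+\<omega>. (if ereal t < \<zeta> \<omega> then ennreal (exp (- \<rho> * t) * h (X t \<omega>)) else 0) \<partial>P x) \<le> ennreal (h x))"

lemma excessiveD:
  "excessive \<rho> h \<Longrightarrow> x \<in> D \<Longrightarrow> 0 \<le> t \<Longrightarrow>
   (\<integral>\<^sup>+\<omega>. (if ereal t < \<zeta> \<omega> then ennreal (exp (- \<rho> * t) * h (X t \<omega>)) else 0) \<partial>P x) \<le> ennreal (h x)"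
  by (auto simp: excessive_def)

text \<open>\<open>S n\<close> is the side of \<open>z n\<close> on which \<phi> is a multiple of
  the hitting transform, a function already known to have the property. Monotone convergence removes
  the restriction; leaving S abstract serves both the increasing and the decreasing
  solution.\<close>

lemma excessive_from_hitting:
  fixes S :: "nat \<Rightarrow> real set"
  assumes x: "x \<in> D" "x \<in> S 0" and t: "0 \<le> t" and \<rho>: "0 \<le> \<rho>"
    and S: "incseq S" "\<And>n. S n \<in> sets borel" "\<And>y. y \<in> D \<Longrightarrow> \<exists>n. y \<in> S n"
    and \<phi>: "\<phi> \<in> borel_measurable DB" "\<And>y. y \<in> D \<Longrightarrow> 0 \<le> \<phi> y"
    and z: "\<And>n. z n \<in> D"
      "\<And>n y. y \<in> D \<Longrightarrow> y \<in> S n \<Longrightarrow> \<phi> y = hitting_laplace X \<zeta> P \<rho> (z n) y * \<phi> (z n)"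
  shows "(\<integral>\<^sup>+\<omega>. (if ereal t < \<zeta> \<omega> then ennreal (exp (- \<rho> * t) * \<phi> (X t \<omega>)) else 0) \<partial>P x) \<le> ennreal (\<phi> x)"
proof -
  let ?g = "\<lambda>n y. ennreal (exp (- \<rho> * t) * (indicator (S n) y * \<phi> y))"
  let ?f = "\<lambda>n \<omega>. if ereal t < \<zeta> \<omega> then ?g n (X t \<omega>) else 0"
  have sp: "space (P x) = space M" by (rule law[OF x(1)])
  have Smono: "S m \<subseteq> S n" if "m \<le> n" for m n using S(1) that by (simp add: incseq_def)
  have fSUP: "(SUP n. ?f n \<omega>) = (if ereal t < \<zeta> \<omega> then ennreal (exp (- \<rho> * t) * \<phi> (X t \<omega>)) else 0)"
    if "\<omega> \<in> space M" for \<omega>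
  proof (cases "ereal t < \<zeta> \<omega>")
    case True
    then have XD: "X t \<omega> \<in> D" using in_state_space that t by blast
    obtain n where n: "X t \<omega> \<in> S n" using S(3)[OF XD] by blast
    show ?thesis
    proof (rule antisym)
      show "(SUP n. ?f n \<omega>) \<le> (if ereal t < \<zeta> \<omega> then ennreal (exp (- \<rho> * t) * \<phi> (X t \<omega>)) else 0)"
        using True \<phi>(2)[OF XD] by (intro SUP_least) (auto intro!: ennreal_leI split: split_indicator)
      show "(if ereal t < \<zeta> \<omega> then ennreal (exp (- \<rho> * t) * \<phi> (X t \<omega>)) else 0) \<le> (SUP n. ?f n \<omega>)"
        using True n by (intro SUP_upper2[of n]) auto
    qed
  qed simp
  have "(\<integral>\<^sup>+\<omega>. (if ereal t < \<zeta> \<omega> then ennreal (exp (- \<rho> * t) * \<phi> (X t \<omega>)) else 0) \<partial>P x) =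
      (\<integral>\<^sup>+\<omega>. (SUP n. if \<omega> \<in> space M then ?f n \<omega> else 0) \<partial>P x)"
    using fSUP by (intro nn_integral_cong) (simp add: sp)
  also have "\<dots> = (SUP n. \<integral>\<^sup>+\<omega>. (if \<omega> \<in> space M then ?f n \<omega> else 0) \<partial>P x)"
  proof (rule nn_integral_monotone_convergence_SUP)
    show "incseq (\<lambda>n \<omega>. if \<omega> \<in> space M then ?f n \<omega> else 0)"
      unfolding incseq_def le_fun_def
    proof (intro allI impI)
      fix m n :: nat and \<omega> assume mn: "m \<le> n"
      show "(if \<omega> \<in> space M then ?f m \<omega> else 0) \<le> (if \<omega> \<in> space M then ?f n \<omega> else 0)"
        using Smono[OF mn] \<phi>(2) in_state_space[of \<omega> t] t
        by (auto intro!: ennreal_leI split: split_indicator)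
    qed
    have "?f n \<in> borel_measurable (P x)" for n
    proof (rule alive_measurable[OF x(1) _ _ t])
      have [measurable]: "S n \<in> sets borel" "\<phi> \<in> borel_measurable DB" using S(2) \<phi>(1) by auto
      have [measurable]: "indicator (S n) \<in> borel_measurable DB"
        by (intro measurable_restrict_space1) measurable
      show "?g n \<in> borel_measurable DB" by measurable
    qed simp
    then show "(\<lambda>\<omega>. if \<omega> \<in> space M then ?f n \<omega> else 0) \<in> borel_measurable (P x)" for n
      by (rule measurable_cong[THEN iffD1, rotated]) (simp add: sp)
  qed
  also have "\<dots> \<le> ennreal (\<phi> x)"
  proof (rule SUP_least)
    fix n
    \<comment> \<open>On \<open>S n\<close> the two integrands agree; off it the left one is zero.
      Since x lies in every \<open>S n\<close>, the resulting bound does not depend on n.\<close>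
    have "(\<integral>\<^sup>+\<omega>. (if \<omega> \<in> space M then ?f n \<omega> else 0) \<partial>P x) \<le>
      (\<integral>\<^sup>+\<omega>. (if ereal t < \<zeta> \<omega>
        then ennreal (\<phi> (z n) * exp (- \<rho> * t) * hitting_laplace X \<zeta> P \<rho> (z n) (X t \<omega>)) else 0) \<partial>P x)"
    proof (rule nn_integral_mono)
      fix \<omega> assume "\<omega> \<in> space (P x)"
      then have \<omega>: "\<omega> \<in> space M" by (simp add: sp)
      show "(if \<omega> \<in> space M then ?f n \<omega> else 0) \<le> (if ereal t < \<zeta> \<omega>
        then ennreal (\<phi> (z n) * exp (- \<rho> * t) * hitting_laplace X \<zeta> P \<rho> (z n) (X t \<omega>)) else 0)"
        using z(2)[OF in_state_space[OF \<omega> t], of n]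
        by (auto simp: mult_ac split: split_indicator)
    qed
    also have "\<dots> \<le> ennreal (\<phi> (z n) * hitting_laplace X \<zeta> P \<rho> (z n) x)"
      by (rule hitting_laplace_excessive[OF x(1) t \<rho> \<phi>(2)[OF z(1)]])
    also have "\<phi> (z n) * hitting_laplace X \<zeta> P \<rho> (z n) x = \<phi> x"
      using z(2)[of x n] x Smono[of 0 n] by (auto simp: mult.commute)
    finally show "(\<integral>\<^sup>+\<omega>. (if \<omega> \<in> space M then ?f n \<omega> else 0) \<partial>P x) \<le> ennreal (\<phi> x)" .
  qed
  finally show ?thesis .
qed

text \<open>The one-step supermartingale inequality localised to an event A of the past, as needed
  for stopping: by the Markov property, after t the process restarts from X t.\<close>

lemma excessive_markov_step:
  assumes x: "x \<in> D" and t: "0 \<le> t" and \<delta>: "0 \<le> \<delta>" and A: "A \<in> sets (F t)"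
    and h: "h \<in> borel_measurable DB" "excessive \<rho> h"
  shows "(\<integral>\<^sup>+\<omega>. (if \<omega> \<in> A \<and> ereal (t + \<delta>) < \<zeta> \<omega> then ennreal (exp (- \<rho> * (t + \<delta>)) * h (X (t + \<delta>) \<omega>)) else 0) \<partial>P x)
    \<le> (\<integral>\<^sup>+\<omega>. (if \<omega> \<in> A \<and> ereal t < \<zeta> \<omega> then ennreal (exp (- \<rho> * t) * h (X t \<omega>)) else 0) \<partial>P x)"
proof -
  let ?g = "\<lambda>\<omega>. if ereal \<delta> < \<zeta> \<omega> then ennreal (exp (- \<rho> * \<delta>) * h (X \<delta> \<omega>)) else 0"
  let ?G = "\<lambda>\<omega>. ennreal (exp (- \<rho> * t)) * ?g \<omega>"
  have sp: "space (P x) = space M" by (rule law[OF x])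
  have gM: "?g \<in> borel_measurable M"
  proof (rule F_measurable_M[OF alive_measurable_F[OF _ _ \<delta>]])
    show "(\<lambda>y. ennreal (exp (- \<rho> * \<delta>) * h y)) \<in> borel_measurable DB" using h(1) by measurable
  qed simp
  have "(\<integral>\<^sup>+\<omega>. (if \<omega> \<in> A \<and> ereal (t + \<delta>) < \<zeta> \<omega> then ennreal (exp (- \<rho> * (t + \<delta>)) * h (X (t + \<delta>) \<omega>)) else 0) \<partial>P x) =
     (\<integral>\<^sup>+\<omega>. (if \<omega> \<in> A \<and> ereal t < \<zeta> \<omega> then ?G (\<theta> t \<omega>) else 0) \<partial>P x)"
  proof (rule nn_integral_cong)
    fix \<omega> assume "\<omega> \<in> space (P x)"
    then have \<omega>: "\<omega> \<in> space M" by (simp add: sp)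
    show "(if \<omega> \<in> A \<and> ereal (t + \<delta>) < \<zeta> \<omega> then ennreal (exp (- \<rho> * (t + \<delta>)) * h (X (t + \<delta>) \<omega>)) else 0) =
      (if \<omega> \<in> A \<and> ereal t < \<zeta> \<omega> then ?G (\<theta> t \<omega>) else 0)"
    proof (cases "ereal t < \<zeta> \<omega>")
      case True
      note sh = shift[OF \<omega> t True]
      have iff: "ereal \<delta> < \<zeta> (\<theta> t \<omega>) \<longleftrightarrow> ereal (t + \<delta>) < \<zeta> \<omega>"
        using sh by (cases "\<zeta> \<omega>") auto
      have "X \<delta> (\<theta> t \<omega>) = X (t + \<delta>) \<omega>" if "ereal (t + \<delta>) < \<zeta> \<omega>" using sh \<delta> that by blast
      then show ?thesis using True iff
        by (auto simp: ennreal_mult'[symmetric] exp_add[symmetric] algebra_simps mult.assoc[symmetric])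
    next
      case False
      then have "\<not> ereal (t + \<delta>) < \<zeta> \<omega>"
        using \<delta> le_less_trans[of "ereal t" "ereal (t + \<delta>)" "\<zeta> \<omega>"] by auto
      then show ?thesis using False by simp
    qed
  qed
  also have "\<dots> = (\<integral>\<^sup>+\<omega>. (if \<omega> \<in> A \<and> ereal t < \<zeta> \<omega> then (\<integral>\<^sup>+\<omega>'. ?G \<omega>' \<partial>P (X t \<omega>)) else 0) \<partial>P x)"
    by (rule markov[OF x t A borel_measurable_times_ennreal[OF borel_measurable_const gM]])
  also have "\<dots> \<le> (\<integral>\<^sup>+\<omega>. (if \<omega> \<in> A \<and> ereal t < \<zeta> \<omega> then ennreal (exp (- \<rho> * t) * h (X t \<omega>)) else 0) \<partial>P x)"
  proof (rule nn_integral_mono)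
    fix \<omega> assume "\<omega> \<in> space (P x)"
    then have \<omega>: "\<omega> \<in> space M" by (simp add: sp)
    have "(\<integral>\<^sup>+\<omega>'. ?G \<omega>' \<partial>P (X t \<omega>)) \<le> ennreal (exp (- \<rho> * t) * h (X t \<omega>))" if "ereal t < \<zeta> \<omega>"
    proof -
      have XD: "X t \<omega> \<in> D" by (rule in_state_space[OF \<omega> t that])
      have "?g \<in> borel_measurable (P (X t \<omega>))"
        using gM law(2)[OF XD] by (simp cong: measurable_cong_sets)
      then have "(\<integral>\<^sup>+\<omega>'. ?G \<omega>' \<partial>P (X t \<omega>)) = ennreal (exp (- \<rho> * t)) * (\<integral>\<^sup>+\<omega>'. ?g \<omega>' \<partial>P (X t \<omega>))"
        by (rule nn_integral_cmult)
      also have "\<dots> \<le> ennreal (exp (- \<rho> * t)) * ennreal (h (X t \<omega>))"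
        by (intro mult_left_mono excessiveD[OF h(2) XD \<delta>]) simp
      finally show ?thesis by (simp add: ennreal_mult')
    qed
    then show "(if \<omega> \<in> A \<and> ereal t < \<zeta> \<omega> then (\<integral>\<^sup>+\<omega>'. ?G \<omega>' \<partial>P (X t \<omega>)) else 0) \<le>
      (if \<omega> \<in> A \<and> ereal t < \<zeta> \<omega> then ennreal (exp (- \<rho> * t) * h (X t \<omega>)) else 0)" by auto
  qed
  finally show ?thesis .
qed

section \<open>Optional stopping along a time grid\<close>

definition grid_value :: "real \<Rightarrow> (real \<Rightarrow> real) \<Rightarrow> real \<Rightarrow> nat \<Rightarrow> 'w \<Rightarrow> ennreal" where
  "grid_value \<rho> h \<delta> j \<omega> = (if ereal (real j * \<delta>) < \<zeta> \<omega>
     then ennreal (exp (- \<rho> * (real j * \<delta>)) * h (X (real j * \<delta>) \<omega>)) else 0)"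

text \<open>The discounted value is collected at the first grid time not before H z. At most one
  index j contributes to a given path, so the sum over j is the value at the discretised stopping
  time.\<close>

definition grid_stopped :: "real \<Rightarrow> (real \<Rightarrow> real) \<Rightarrow> real \<Rightarrow> real \<Rightarrow> nat \<Rightarrow> 'w \<Rightarrow> ennreal" where
  "grid_stopped \<rho> h \<delta> z j \<omega> =
     (if H z \<omega> \<le> ereal (real j * \<delta>) \<and> (\<forall>i<j. \<not> H z \<omega> \<le> ereal (real i * \<delta>))
      then grid_value \<rho> h \<delta> j \<omega> else 0)"

text \<open>Induction on the number of grid points: the collected value plus the current value of
  the paths not yet stopped has expectation at most h(x). Whether a path continues past a grid time
  is decided by that time, so the localised Markov step applies.\<close>

lemma discrete_optional_stopping:
  fixes z :: real
  assumes x: "x \<in> D" and \<delta>: "0 \<le> \<delta>"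
    and h: "h \<in> borel_measurable DB" "excessive \<rho> h"
  shows "\<And>j. grid_stopped \<rho> h \<delta> z j \<in> borel_measurable (P x)" and "(\<integral>\<^sup>+\<omega>. (\<Sum>j\<le>k. grid_stopped \<rho> h \<delta> z j \<omega>) \<partial>P x) \<le> ennreal (h x)"
proof -
  let ?u = "grid_value \<rho> h \<delta>" and ?B = "grid_stopped \<rho> h \<delta> z"
  have sets: "sets (P x) = sets M" and sp: "space (P x) = space M" by (rule law[OF x])+
  have [measurable]: "H z \<in> borel_measurable M" by (rule hitting_time_measurable)
  have [measurable]: "?u j \<in> borel_measurable M" for j
    unfolding grid_value_def
  proof (rule F_measurable_M[OF alive_measurable_F])
    show "(\<lambda>y. ennreal (exp (- \<rho> * (real j * \<delta>)) * h y)) \<in> borel_measurable DB" using h(1) by measurable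
    show "0 \<le> real j * \<delta>" using \<delta> by simp
  qed simp
  have BM[measurable]: "?B j \<in> borel_measurable M" for j
    unfolding grid_stopped_def by measurable
  show BP: "?B j \<in> borel_measurable (P x)" for j
    using BM by (simp cong: measurable_cong_sets add: measurable_cong_sets[OF sets refl])
  \<comment> \<open>The part not yet stopped, which strengthens the claim to one that is inductive;
    it is discarded at the end.\<close>
  define C where "C k \<omega> = (if H z \<omega> \<le> ereal (real k * \<delta>) then 0 else ?u k \<omega>)" for k \<omega>
  have CM[measurable]: "C j \<in> borel_measurable M" for j
    unfolding C_def by measurable
  have CP: "C j \<in> borel_measurable (P x)" for j
    using CM by (simp add: measurable_cong_sets[OF sets refl])
  have V: "(\<integral>\<^sup>+\<omega>. (\<Sum>j\<le>k. ?B j \<omega>) + C k \<omega> \<partial>P x) \<le> ennreal (h x)"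
  proof (induction k)
    case 0
    have "(\<Sum>j\<le>0. ?B j \<omega>) + C 0 \<omega> = ?u 0 \<omega>" for \<omega> by (simp add: grid_stopped_def C_def)
    then show ?case using excessiveD[OF h(2) x, of 0] by (simp add: grid_value_def cong: if_cong)
  next
    case (Suc k)
    have eq: "?B (Suc k) \<omega> + C (Suc k) \<omega> = (if H z \<omega> \<le> ereal (real k * \<delta>) then 0 else ?u (Suc k) \<omega>)" for \<omega>
    proof (cases "H z \<omega> \<le> ereal (real k * \<delta>)")
      case True
      have "H z \<omega> \<le> ereal (real (Suc k) * \<delta>)"
        by (rule order_trans[OF True]) (use \<delta> in \<open>simp add: mult_right_mono\<close>)
      then show ?thesis using True by (auto simp: grid_stopped_def C_def)
    next
      case False
      have "\<not> H z \<omega> \<le> ereal (real i * \<delta>)" if "i < Suc k" for i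
      proof
        assume "H z \<omega> \<le> ereal (real i * \<delta>)"
        also have "\<dots> \<le> ereal (real k * \<delta>)" using that \<delta> by (simp add: mult_right_mono)
        finally show False using False by simp
      qed
      then show ?thesis using False by (auto simp: grid_stopped_def C_def)
    qed
    let ?A = "{\<omega> \<in> space M. \<not> H z \<omega> \<le> ereal (real k * \<delta>)}"
    have "{\<omega> \<in> space M. H z \<omega> \<le> ereal (real k * \<delta>)} \<in> sets (F (real k * \<delta>))"
      using \<delta> by (intro hitting_time_measurable_F) simp
    from sets.compl_sets[OF this] have A: "?A \<in> sets (F (real k * \<delta>))"
      by (simp add: space_F set_diff_eq Collect_conj_eq[symmetric] cong: conj_cong)
    have step: "(\<integral>\<^sup>+\<omega>. ?B (Suc k) \<omega> + C (Suc k) \<omega> \<partial>P x) \<le> (\<integral>\<^sup>+\<omega>. C k \<omega> \<partial>P x)"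
    proof -
      have "(\<integral>\<^sup>+\<omega>. ?B (Suc k) \<omega> + C (Suc k) \<omega> \<partial>P x) =
        (\<integral>\<^sup>+\<omega>. (if \<omega> \<in> ?A \<and> ereal (real k * \<delta> + \<delta>) < \<zeta> \<omega>
          then ennreal (exp (- \<rho> * (real k * \<delta> + \<delta>)) * h (X (real k * \<delta> + \<delta>) \<omega>)) else 0) \<partial>P x)"
        unfolding eq by (intro nn_integral_cong) (simp add: sp grid_value_def algebra_simps)
      also have "\<dots> \<le> (\<integral>\<^sup>+\<omega>. (if \<omega> \<in> ?A \<and> ereal (real k * \<delta>) < \<zeta> \<omega>
          then ennreal (exp (- \<rho> * (real k * \<delta>)) * h (X (real k * \<delta>) \<omega>)) else 0) \<partial>P x)"
        using \<delta> by (intro excessive_markov_step x A h) auto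
      also have "\<dots> = (\<integral>\<^sup>+\<omega>. C k \<omega> \<partial>P x)"
        by (intro nn_integral_cong) (simp add: sp grid_value_def C_def)
      finally show ?thesis .
    qed
    have "(\<integral>\<^sup>+\<omega>. (\<Sum>j\<le>Suc k. ?B j \<omega>) + C (Suc k) \<omega> \<partial>P x) =
      (\<integral>\<^sup>+\<omega>. (\<Sum>j\<le>k. ?B j \<omega>) + (?B (Suc k) \<omega> + C (Suc k) \<omega>) \<partial>P x)"
      by (simp add: add.assoc)
    also have "\<dots> = (\<integral>\<^sup>+\<omega>. (\<Sum>j\<le>k. ?B j \<omega>) \<partial>P x) + (\<integral>\<^sup>+\<omega>. ?B (Suc k) \<omega> + C (Suc k) \<omega> \<partial>P x)"
      using BP CP by (intro nn_integral_add) auto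
    also have "\<dots> \<le> (\<integral>\<^sup>+\<omega>. (\<Sum>j\<le>k. ?B j \<omega>) \<partial>P x) + (\<integral>\<^sup>+\<omega>. C k \<omega> \<partial>P x)"
      using step by (rule add_left_mono)
    also have "\<dots> = (\<integral>\<^sup>+\<omega>. (\<Sum>j\<le>k. ?B j \<omega>) + C k \<omega> \<partial>P x)"
      using BP CP by (intro nn_integral_add[symmetric]) auto
    also note Suc.IH
    finally show ?case .
  qed
  have "(\<integral>\<^sup>+\<omega>. (\<Sum>j\<le>k. ?B j \<omega>) \<partial>P x) \<le> (\<integral>\<^sup>+\<omega>. (\<Sum>j\<le>k. ?B j \<omega>) + C k \<omega> \<partial>P x)"
    by (intro nn_integral_mono) simp
  then show "(\<integral>\<^sup>+\<omega>. (\<Sum>j\<le>k. ?B j \<omega>) \<partial>P x) \<le> ennreal (h x)" using V by (rule order_trans)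
qed

text \<open>On a path with finite H z the grid values converge to exp(-\<rho> H z) h(z), by
  continuity of the path and of h; on the other paths the integrand is zero.\<close>

lemma excessive_hitting:
  assumes x: "x \<in> D" and z: "z \<in> D" and \<rho>: "0 \<le> \<rho>"
    and h: "continuous_on D h" "\<And>y. y \<in> D \<Longrightarrow> 0 \<le> h y" "excessive \<rho> h"
  shows "hitting_laplace X \<zeta> P \<rho> z x * h z \<le> h x"
proof -
  have hm: "h \<in> borel_measurable DB" by (rule borel_measurable_continuous_on_restrict[OF h(1)])
  have sp: "space (P x) = space M" by (rule law[OF x])
  \<comment> \<open>Mesh 1/(n+1) with (n+1)^2 steps reaches up to time n+1: the grid becomes finer
    and longer at once, so it eventually covers any finite hitting time.\<close>
  define d where "d n = 1 / real (Suc n)" for n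
  define f where "f n \<omega> = (\<Sum>j\<le>Suc n * Suc n. grid_stopped \<rho> h (d n) z j \<omega>)" for n \<omega>
  have d: "0 \<le> d n" for n by (simp add: d_def)
  note stop = discrete_optional_stopping[OF x d hm h(3)]
  have fP: "f n \<in> borel_measurable (P x)" for n
    unfolding f_def by (intro borel_measurable_sum stop(1))
  have fle: "(\<integral>\<^sup>+\<omega>. f n \<omega> \<partial>P x) \<le> ennreal (h x)" for n
    unfolding f_def by (rule stop(2))
  have lim: "ennreal (h z * hitting_discount \<rho> z \<omega>) \<le> liminf (\<lambda>n. f n \<omega>)" if \<omega>: "\<omega> \<in> space M" for \<omega>
  proof (cases "H z \<omega> < \<infinity>")
    case False
    then show ?thesis by (simp add: hitting_discount_def)
  next
    case True
    obtain s where s: "0 \<le> s" "ereal s < \<zeta> \<omega>" "X s \<omega> = z" "H z \<omega> = ereal s"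
      by (rule hitting_time_attained[OF \<omega> True])
    \<comment> \<open>Index of the first grid time not before s. The times \<open>r n\<close>
      approach s from the right, and since s precedes the lifetime, they do so too for large
      n.\<close>
    define J where "J n = nat \<lceil>s * real (Suc n)\<rceil>" for n
    define r where "r n = real (J n) * d n" for n
    have J: "s * real (Suc n) \<le> real (J n)" "real (J n) < s * real (Suc n) + 1" for n
    proof -
      have "0 \<le> s * real (Suc n)" using s(1) by simp
      then have "real (J n) = of_int \<lceil>s * real (Suc n)\<rceil>" unfolding J_def by (intro of_nat_nat) linarith
      then show "s * real (Suc n) \<le> real (J n)" "real (J n) < s * real (Suc n) + 1" by linarith+
    qed
    have r: "s \<le> r n" "r n \<le> s + d n" for n
    proof -
      have m: "0 < real (Suc n)" by simp
      have rn: "r n = real (J n) / real (Suc n)" by (simp add: r_def d_def)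
      have *: "s + d n = (s * real (Suc n) + 1) / real (Suc n)"
        using m by (simp add: d_def add_divide_distrib del: of_nat_Suc)
      show "s \<le> r n" unfolding rn pos_le_divide_eq[OF m] by (rule J(1))
      show "r n \<le> s + d n"
        unfolding rn * by (rule divide_right_mono[OF less_imp_le[OF J(2)] less_imp_le[OF m]])
    qed
    have "d \<longlonglongrightarrow> 0" unfolding d_def using LIMSEQ_inverse_real_of_nat by (simp add: inverse_eq_divide)
    then have "(\<lambda>n. s + d n) \<longlonglongrightarrow> s + 0" by (intro tendsto_intros)
    then have rs: "r \<longlonglongrightarrow> s"
      using r by (intro tendsto_sandwich[of "\<lambda>_. s" r sequentially "\<lambda>n. s + d n"] always_eventually) auto
    then have "(\<lambda>n. ereal (r n)) \<longlonglongrightarrow> ereal s" by simp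
    then have ev\<zeta>: "\<forall>\<^sub>F n in sequentially. ereal (r n) < \<zeta> \<omega>" using s(2) by (rule order_tendstoD)
    have "continuous_on {t. 0 \<le> t \<and> ereal t < \<zeta> \<omega>} (\<lambda>t. h (X t \<omega>))"
      by (rule continuous_on_compose2[OF h(1) continuous_paths[OF \<omega>]]) (use in_state_space[OF \<omega>] in auto)
    then have "(\<lambda>n. h (X (r n) \<omega>)) \<longlonglongrightarrow> h (X s \<omega>)"
    proof (rule continuous_on_tendsto_compose[OF _ rs])
      show "\<forall>\<^sub>F n in sequentially. r n \<in> {t. 0 \<le> t \<and> ereal t < \<zeta> \<omega>}"
        using ev\<zeta> by eventually_elim (use r(1) s(1) order_trans in auto)
    qed (use s in simp)
    then have "(\<lambda>n. exp (- \<rho> * r n) * h (X (r n) \<omega>)) \<longlonglongrightarrow> exp (- \<rho> * s) * h z"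
      unfolding s(3) by (intro tendsto_intros rs)
    then have "(\<lambda>n. ennreal (exp (- \<rho> * r n) * h (X (r n) \<omega>))) \<longlonglongrightarrow> ennreal (exp (- \<rho> * s) * h z)"
      by (rule tendsto_ennrealI)
    then have "ennreal (exp (- \<rho> * s) * h z) = liminf (\<lambda>n. ennreal (exp (- \<rho> * r n) * h (X (r n) \<omega>)))"
      by (intro lim_imp_Liminf[symmetric]) auto
    also have "\<dots> \<le> liminf (\<lambda>n. f n \<omega>)"
    proof (rule Liminf_mono)
      obtain N where N: "s \<le> real N" using real_arch_simple by blast
      show "\<forall>\<^sub>F n in sequentially. ennreal (exp (- \<rho> * r n) * h (X (r n) \<omega>)) \<le> f n \<omega>"
        using ev\<zeta> eventually_ge_at_top[of N]
      proof eventually_elim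
        case (elim n)
        have "s \<le> real (Suc n)" using N elim(2) by simp
        then have "s * real (Suc n) \<le> real (Suc n) * real (Suc n)" by (intro mult_right_mono) auto
        then have "\<lceil>s * real (Suc n)\<rceil> \<le> int (Suc n * Suc n)"
          by (simp only: ceiling_le_iff of_int_of_nat_eq of_nat_mult of_int_mult)
        then have Jle: "J n \<le> Suc n * Suc n" unfolding J_def by linarith
        have first: "\<not> H z \<omega> \<le> ereal (real i * d n)" if "i < J n" for i
        proof -
          have "real i + 1 \<le> real (J n)" using that by simp
          then have "real i < s * real (Suc n)" using J(2)[of n] by linarith
          then have "real i * d n < s" by (simp add: d_def divide_less_eq)
          then show ?thesis by (simp add: s(4))
        qed
        have "H z \<omega> \<le> ereal (r n)" using r(1) s(4) by simp
        then have "grid_stopped \<rho> h (d n) z (J n) \<omega> = ennreal (exp (- \<rho> * r n) * h (X (r n) \<omega>))"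
          using first elim(1) unfolding grid_stopped_def grid_value_def r_def by auto
        moreover have "grid_stopped \<rho> h (d n) z (J n) \<omega> \<le> f n \<omega>"
          unfolding f_def by (rule member_le_sum) (use Jle in auto)
        ultimately show ?case by simp
      qed
    qed
    finally show ?thesis by (simp add: hitting_discount_def s(4) mult.commute)
  qed
  have "ennreal (h z * hitting_laplace X \<zeta> P \<rho> z x) = (\<integral>\<^sup>+\<omega>. ennreal (h z * hitting_discount \<rho> z \<omega>) \<partial>P x)"
    by (rule nn_integral_hitting_discount[OF x \<rho> h(2)[OF z], symmetric])
  also have "\<dots> \<le> (\<integral>\<^sup>+\<omega>. liminf (\<lambda>n. f n \<omega>) \<partial>P x)"
    using lim by (intro nn_integral_mono) (simp add: sp)
  also have "\<dots> \<le> liminf (\<lambda>n. \<integral>\<^sup>+\<omega>. f n \<omega> \<partial>P x)"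
    by (rule nn_integral_liminf[OF fP])
  also have "\<dots> \<le> liminf (\<lambda>n. ennreal (h x))"
    using fle by (intro Liminf_mono always_eventually) auto
  also have "\<dots> = ennreal (h x)" by (simp add: Liminf_const)
  finally show ?thesis using h(2)[OF x] by (simp add: mult.commute)
qed

end

section \<open>Signs of the coefficients and the characterization\<close>

context diffusion_with_solutions
begin

lemma hitting_identities:
  "x \<in> D \<Longrightarrow> z \<in> D \<Longrightarrow> x \<le> z \<Longrightarrow> \<phi>p x = hitting_laplace X \<zeta> P \<rho> z x * \<phi>p z"
  "x \<in> D \<Longrightarrow> z \<in> D \<Longrightarrow> z \<le> x \<Longrightarrow> \<phi>m x = hitting_laplace X \<zeta> P \<rho> z x * \<phi>m z"
  using pair unfolding fundamental_pair_def by blast+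

lemma \<phi>_nonneg: "x \<in> D \<Longrightarrow> 0 \<le> \<phi>p x" "x \<in> D \<Longrightarrow> 0 \<le> \<phi>m x"
  by (rule nonneg_on_D[OF \<phi>_continuous(1) less_imp_le[OF sol.pos(1)]]
      nonneg_on_D[OF \<phi>_continuous(2) less_imp_le[OF sol.pos(2)]]; assumption)+

lemma \<phi>_measurable: "\<phi>p \<in> borel_measurable DB" "\<phi>m \<in> borel_measurable DB"
  by (rule borel_measurable_continuous_on_restrict \<phi>_continuous)+

lemma excessive_\<phi>p: "excessive \<rho> \<phi>p"
  unfolding excessive_def
proof (intro ballI allI impI)
  fix x and t :: real assume x: "x \<in> D" and t: "0 \<le> t"
  obtain u where u: "incseq u" "\<And>n. u n \<in> D" "x \<le> u 0" "\<And>y. y \<in> D \<Longrightarrow> \<exists>n. y \<le> u n"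
    using exhausting_sequence[OF x] by blast
  show "(\<integral>\<^sup>+\<omega>. (if ereal t < \<zeta> \<omega> then ennreal (exp (- \<rho> * t) * \<phi>p (X t \<omega>)) else 0) \<partial>P x) \<le> ennreal (\<phi>p x)"
  proof (rule excessive_from_hitting[OF x _ t \<rho> _ _ _ \<phi>_measurable(1) \<phi>_nonneg(1) u(2)])
    show "incseq (\<lambda>n. {..u n})" using u(1) by (auto simp: incseq_def intro: order_trans)
    show "\<phi>p y = hitting_laplace X \<zeta> P \<rho> (u n) y * \<phi>p (u n)" if "y \<in> D" "y \<in> {..u n}" for n y
      using hitting_identities(1)[OF that(1) u(2), of n] that(2) by simp
  qed (use u in auto)
qed

lemma excessive_\<phi>m: "excessive \<rho> \<phi>m"
  unfolding excessive_def
proof (intro ballI allI impI)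
  fix x and t :: real assume x: "x \<in> D" and t: "0 \<le> t"
  \<comment> \<open>Reflecting D turns the increasing exhausting sequence into one decreasing
    through D.\<close>
  have mx: "- x \<in> uminus ` D" using x by simp
  obtain u where u: "incseq u" "\<And>n. u n \<in> uminus ` D" "- x \<le> u 0" "\<And>y. y \<in> uminus ` D \<Longrightarrow> \<exists>n. y \<le> u n"
    using exhausting_sequence[OF mx] by blast
  have uD: "- u n \<in> D" for n using u(2)[of n] by auto
  have le: "\<exists>n. - u n \<le> y" if "y \<in> D" for y
    using u(4)[of "- y"] that by (auto simp: minus_le_iff)
  show "(\<integral>\<^sup>+\<omega>. (if ereal t < \<zeta> \<omega> then ennreal (exp (- \<rho> * t) * \<phi>m (X t \<omega>)) else 0) \<partial>P x) \<le> ennreal (\<phi>m x)"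
  proof (rule excessive_from_hitting[OF x _ t \<rho> _ _ _ \<phi>_measurable(2) \<phi>_nonneg(2) uD])
    show "incseq (\<lambda>n. {- u n..})" using u(1) by (auto simp: incseq_def intro: order_trans)
    show "\<phi>m y = hitting_laplace X \<zeta> P \<rho> (- u n) y * \<phi>m (- u n)" if "y \<in> D" "y \<in> {- u n..}" for n y
      using hitting_identities(2)[OF that(1) uD, of n] that(2) by simp
  qed (use u(3) le in auto)
qed

lemma excessive_lincomb:
  assumes cd: "0 \<le> c" "0 \<le> d" and h: "\<And>x. x \<in> D \<Longrightarrow> h x = c * \<phi>p x + d * \<phi>m x"
  shows "excessive \<rho> h"
  unfolding excessive_def
proof (intro ballI allI impI)
  fix x and t :: real assume x: "x \<in> D" and t: "0 \<le> t"
  have sp: "space (P x) = space M" by (rule law[OF x])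
  let ?u = "\<lambda>\<phi> \<omega>. if ereal t < \<zeta> \<omega> then ennreal (exp (- \<rho> * t) * \<phi> (X t \<omega>)) else 0"
  have um: "?u \<phi> \<in> borel_measurable (P x)" if "\<phi> \<in> borel_measurable DB" for \<phi> :: "real \<Rightarrow> real"
  proof (rule alive_measurable[OF x _ _ t])
    show "(\<lambda>y. ennreal (exp (- \<rho> * t) * \<phi> y)) \<in> borel_measurable DB" using that by measurable
  qed simp
  note m = um[OF \<phi>_measurable(1)] um[OF \<phi>_measurable(2)]
  have "(\<integral>\<^sup>+\<omega>. ?u h \<omega> \<partial>P x) = (\<integral>\<^sup>+\<omega>. ennreal c * ?u \<phi>p \<omega> + ennreal d * ?u \<phi>m \<omega> \<partial>P x)"
  proof (rule nn_integral_cong)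
    fix \<omega> assume "\<omega> \<in> space (P x)"
    then have \<omega>: "\<omega> \<in> space M" by (simp add: sp)
    show "?u h \<omega> = ennreal c * ?u \<phi>p \<omega> + ennreal d * ?u \<phi>m \<omega>"
    proof (cases "ereal t < \<zeta> \<omega>")
      case True
      then have XD: "X t \<omega> \<in> D" using in_state_space[OF \<omega> t] by blast
      then show ?thesis
        using True cd \<phi>_nonneg[OF XD]
        by (simp add: h[OF XD] ennreal_mult'[symmetric] ennreal_plus[symmetric] algebra_simps del: ennreal_plus)
    qed simp
  qed
  also have "\<dots> = ennreal c * (\<integral>\<^sup>+\<omega>. ?u \<phi>p \<omega> \<partial>P x) + ennreal d * (\<integral>\<^sup>+\<omega>. ?u \<phi>m \<omega> \<partial>P x)"
    by (subst nn_integral_add) (use m in \<open>simp_all add: nn_integral_cmult\<close>)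
  also have "\<dots> \<le> ennreal c * ennreal (\<phi>p x) + ennreal d * ennreal (\<phi>m x)"
    by (intro add_mono mult_left_mono excessiveD[OF excessive_\<phi>p x t] excessiveD[OF excessive_\<phi>m x t]) simp_all
  also have "\<dots> = ennreal (h x)"
    using cd \<phi>_nonneg[OF x]
    by (simp add: h[OF x] ennreal_mult'[symmetric] ennreal_plus[symmetric] del: ennreal_plus)
  finally show "(\<integral>\<^sup>+\<omega>. ?u h \<omega> \<partial>P x) \<le> ennreal (h x)" .
qed

text \<open>Going from p up to q, the hitting factor is \<phi>p(p)/\<phi>p(q). The \<phi>p component
  of h turns the hitting inequality into an equality and cancels, leaving d times the positive
  determinant; going down from q to p isolates c.\<close>

lemma excessive_lincomb_nonneg:
  assumes h: "continuous_on D h" "\<And>x. x \<in> I \<Longrightarrow> 0 < h x" "excessive \<rho> h"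
    and cd: "\<And>x. x \<in> D \<Longrightarrow> h x = c * \<phi>p x + d * \<phi>m x"
  shows "0 \<le> c" "0 \<le> d"
proof -
  obtain p where p: "p \<in> I" using interior_D(3) by auto
  then obtain e where e: "e > 0" "ball p e \<subseteq> I" using interior_D(1) open_contains_ball by blast
  define q where "q = p + e / 2"
  have q: "q \<in> I" "p < q" using e by (auto simp: q_def dist_real_def)
  have pD: "p \<in> D" and qD: "q \<in> D" using p q interior_D(4) by auto
  note W = sol.det_pos[OF p q]
  have h0: "0 \<le> h y" if "y \<in> D" for y by (rule nonneg_on_D[OF h(1) less_imp_le[OF h(2)] that])
  define a where "a = hitting_laplace X \<zeta> P \<rho> q p"
  define b' where "b' = hitting_laplace X \<zeta> P \<rho> p q"
  have a: "\<phi>p p = a * \<phi>p q" using hitting_identities(1)[OF pD qD] q(2) by (simp add: a_def)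
  have b': "\<phi>m q = b' * \<phi>m p" using hitting_identities(2)[OF qD pD] q(2) by (simp add: b'_def)
  have "a * h q \<le> h p" unfolding a_def by (rule excessive_hitting[OF pD qD \<rho> h(1) h0 h(3)])
  then have "0 \<le> (h p - a * h q) * \<phi>p q" using sol.pos(1)[OF q(1)] by (intro mult_nonneg_nonneg) auto
  also have "\<dots> = d * (\<phi>p q * \<phi>m p - \<phi>p p * \<phi>m q)"
    unfolding cd[OF pD] cd[OF qD] a by (simp add: algebra_simps)
  finally show "0 \<le> d" using W by (simp add: zero_le_mult_iff)
  have "b' * h p \<le> h q" unfolding b'_def by (rule excessive_hitting[OF qD pD \<rho> h(1) h0 h(3)])
  then have "0 \<le> (h q - b' * h p) * \<phi>m p" using sol.pos(2)[OF p] by (intro mult_nonneg_nonneg) auto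
  also have "\<dots> = c * (\<phi>p q * \<phi>m p - \<phi>p p * \<phi>m q)"
    unfolding cd[OF pD] cd[OF qD] b' by (simp add: algebra_simps)
  finally show "0 \<le> c" using W by (simp add: zero_le_mult_iff)
qed

lemma stochastic_transformation_iff:
  "stochastic_transformation D F X \<zeta> P \<rho> h Y \<longleftrightarrow>
    continuous_on D h \<and> (\<forall>x\<in>I. 0 < h x) \<and> excessive \<rho> h \<and> diffeomorphism_on I Y \<and>
    no_killing_on I (transformed h) \<and> driftless_on (Y ` I) (image_transition I Y (transformed h))"
  by (simp add: stochastic_transformation_def excessive_def Let_def)

lemma transformation_characterization:
  "stochastic_transformation D F X \<zeta> P \<rho> h Y \<longleftrightarrow>
    (\<exists>c1 c2 c3 c4 :: real. c1 \<ge> 0 \<and> c2 \<ge> 0 \<and> c1 * c4 - c2 * c3 \<noteq> 0 \<and>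
      (\<forall>x\<in>D. h x = c1 * \<phi>p x + c2 * \<phi>m x) \<and>
      (\<forall>x\<in>I. Y x = 1 / h x * (c3 * \<phi>p x + c4 * \<phi>m x)))" (is "?L \<longleftrightarrow> ?R")
proof
  assume ?L
  then have h: "continuous_on D h" "\<And>x. x \<in> I \<Longrightarrow> 0 < h x" "excessive \<rho> h"
    and Y: "diffeomorphism_on I Y" and nk: "no_killing_on I (transformed h)"
    and dl: "driftless_on (Y ` I) (image_transition I Y (transformed h))"
    unfolding stochastic_transformation_iff by blast+
  obtain c1 c2 where c: "\<And>x. x \<in> D \<Longrightarrow> h x = c1 * \<phi>p x + c2 * \<phi>m x"
    using no_killing_lincomb[OF h(1,2) nk] by blast
  have cI: "h x = c1 * \<phi>p x + c2 * \<phi>m x" if "x \<in> I" for x using c that interior_D(4) by blast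
  obtain c3 c4 where c': "\<And>x. x \<in> I \<Longrightarrow> h x * Y x = c3 * \<phi>p x + c4 * \<phi>m x"
    using driftless_lincomb[OF h(1,2) cI Y dl] by blast
  have "c1 * c4 - c2 * c3 \<noteq> 0"
    by (rule injective_quotient_det[OF h(2) cI diffeomorphism_onD(2)[OF interior_D(1-3) Y] c'])
  moreover have "c1 \<ge> 0" "c2 \<ge> 0" using excessive_lincomb_nonneg[OF h c] by auto
  moreover have "Y x = 1 / h x * (c3 * \<phi>p x + c4 * \<phi>m x)" if "x \<in> I" for x
    using c'[OF that] h(2)[OF that] by (simp add: field_simps)
  ultimately show ?R using c by blast
next
  assume ?R
  then obtain c1 c2 c3 c4 where c: "c1 \<ge> 0" "c2 \<ge> 0" "c1 * c4 - c2 * c3 \<noteq> 0"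
    and h: "\<And>x. x \<in> D \<Longrightarrow> h x = c1 * \<phi>p x + c2 * \<phi>m x"
    and Y: "\<And>x. x \<in> I \<Longrightarrow> Y x = 1 / h x * (c3 * \<phi>p x + c4 * \<phi>m x)" by blast
  have hI: "h x = c1 * \<phi>p x + c2 * \<phi>m x" if "x \<in> I" for x using h that interior_D(4) by blast
  have pos: "0 < h x" if "x \<in> I" for x
    using sol.positive_combination[OF c that] hI[OF that] by simp
  have cont: "continuous_on D h"
    by (subst continuous_on_cong[OF refl h]) (auto intro!: continuous_intros \<phi>_continuous)
  have neq: "h x \<noteq> 0" if "x \<in> I" for x using pos[OF that] by simp
  have diffeo: "diffeomorphism_on I Y" by (rule sol.quotient_diffeomorphism[OF c(3) hI neq Y])
  have hY: "h x * Y x = c3 * \<phi>p x + c4 * \<phi>m x" if "x \<in> I" for x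
    using Y[OF that] neq[OF that] by simp
  have "no_killing_on I (transformed h)"
    unfolding no_killing_on_def using transformed_generator_lincomb[OF cont pos hI] by blast
  then show ?L
    unfolding stochastic_transformation_iff
    using cont pos excessive_lincomb[OF c(1,2) h] diffeo lincomb_driftless[OF cont pos hI diffeo hY] by blast
qed

end

theorem theorem3p3:
  fixes M :: "'w measure" and F :: "real \<Rightarrow> 'w measure" and D :: "real set"
    and b \<sigma> :: "real \<Rightarrow> real" and X :: "real \<Rightarrow> 'w \<Rightarrow> real" and \<zeta> :: "'w \<Rightarrow> ereal"
    and \<theta> :: "real \<Rightarrow> 'w \<Rightarrow> 'w" and P :: "real \<Rightarrow> 'w measure"
    and \<rho> :: real and \<phi>p \<phi>m h Y :: "real \<Rightarrow> real"
  assumes "regular_diffusion M F D b \<sigma> X \<zeta> \<theta> P"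
    and "\<rho> \<ge> 0"
    and "fundamental_pair D b \<sigma> X \<zeta> P \<rho> \<phi>p \<phi>m"
  shows "stochastic_transformation D F X \<zeta> P \<rho> h Y \<longleftrightarrow>
    (\<exists>c1 c2 c3 c4 :: real. c1 \<ge> 0 \<and> c2 \<ge> 0 \<and> c1 * c4 - c2 * c3 \<noteq> 0 \<and>
      (\<forall>x\<in>D. h x = c1 * \<phi>p x + c2 * \<phi>m x) \<and>
      (\<forall>x\<in>interior D. Y x = 1 / h x * (c3 * \<phi>p x + c4 * \<phi>m x)))"
proof -
  interpret diffusion_with_solutions M F D b \<sigma> X \<zeta> \<theta> P \<rho> \<phi>p \<phi>m
    using assms by (simp add: diffusion_with_solutions_def diffusion_with_solutions_axioms_def)
  show ?thesis by (rule transformation_characterization)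
qed

end
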